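(* Given an integer $m\ge0$, there are two disjoint infinite sets $\mathbf{a},\mathbf{b}\subseteq\mathbb{D}$ such that (i) $\mathbf{a}$ and $\mathbf{b}$ satisfy the Blaschke condition; (ii) $\lim\mathbf{a}=\lim\mathbf{b}=\{1\}$; (iii) $\dim\left(\mathcal{Z}_{\mathbf{a}}^\perp\cap\mathcal{Z}_{\mathbf{b}}\right)=0$ and $\dim\left(\mathcal{Z}_{\mathbf{a}}\cap\mathcal{Z}_{\mathbf{b}}^\perp\right)=m$. In this case, there exists a geodesic in $\mathrm{Gr}(H^2)$ joining $\mathcal{Z}_{\mathbf{a}}$ and $\mathcal{Z}_{\mathbf{b}}$ if and only if $m=0$.
   Context: $H^2$ is the Hardy space of the unit disk $\mathbb{D}$. A set $\mathbf{a}=\{a_k:k\ge1\}\subset\mathbb{D}$ satisfies the Blaschke condition if $\sum_k(1-|a_k|)<\infty$. $\mathcal{Z}_{\mathbf{a}}=\{f\in H^2:f(a)=0\text{ for all }a\in\mathbf{a}\}$, similarly for $\mathbf{b}$; orthogonal complements are in $H^2$. $\lim\mathbf{a}=\overline{\mathbf{a}}\setminus\mathbf{a}$ is the limit set of $\mathbf{a}$. $\mathrm{Gr}(H^2)$ is the manifold of closed subspaces of $H^2$; a geodesic joining $\mathcal{S}$ and $\mathcal{T}$ is a curve $\delta(t)=e^{itX}\mathcal{S}$, $t\in[0,1]$, with $X=X^*$ a bounded operator such that $X\mathcal{S}\subset\mathcal{S}^\perp$, $X\mathcal{S}^\perp\subset\mathcal{S}$ and $e^{iX}\mathcal{S}=\mathcal{T}$.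 *)

theory Defs
  imports "HOL-Complex_Analysis.Complex_Analysis"
begin

definition taylor_coeff :: "(complex \<Rightarrow> complex) \<Rightarrow> nat \<Rightarrow> complex" where
  "taylor_coeff f n = (deriv ^^ n) f 0 / fact n"

definition circle_mean :: "(complex \<Rightarrow> complex) \<Rightarrow> real \<Rightarrow> real" where
  "circle_mean f r = integral {0..2 * pi} (\<lambda>t. (cmod (f (of_real r * cis t)))\<^sup>2) / (2 * pi)"

definition hardy_fun :: "(complex \<Rightarrow> complex) \<Rightarrow> bool" where
  "hardy_fun f \<longleftrightarrow> f holomorphic_on ball 0 1 \<and> bdd_above (circle_mean f ` {0<..<1})"

lemma taylor_sums:
  assumes "f holomorphic_on ball 0 1" "norm z < 1"
  shows "(\<lambda>n. taylor_coeff f n * z ^ n) sums f z"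
  using holomorphic_power_series[OF assms(1), of z] assms(2)
  by (simp add: taylor_coeff_def)

lemma has_integral_cis:
  "((\<lambda>t. cis (of_int k * t)) has_integral (if k = 0 then of_real (2 * pi) else 0)) {0..2 * pi}"
proof (cases "k = 0")
  case True
  have "((\<lambda>t::real. 1::complex) has_integral of_real (2 * pi)) {0..2 * pi}"
    using has_integral_const_real[of "1::complex" 0 "2 * pi"] by (simp add: scaleR_conv_of_real)
  then show ?thesis using True by simp
next
  case False
  have "((\<lambda>t. cis (of_int k * t)) has_integral
      (cis (of_int k * (2 * pi)) / (\<i> * of_int k) - cis (of_int k * 0) / (\<i> * of_int k))) {0..2 * pi}"
  proof (rule fundamental_theorem_of_calculus)
    fix t :: real
    have "((\<lambda>t. cis (of_int k * t)) has_vector_derivative (of_int k *\<^sub>R (\<i> * cis (of_int k * t))))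
        (at t within {0..2 * pi})"
      unfolding cis_conv_exp
      by (auto intro!: derivative_eq_intros has_vector_derivative_real_field
               simp: scaleR_conv_of_real algebra_simps)
    then have "((\<lambda>t. cis (of_int k * t) / (\<i> * of_int k)) has_vector_derivative
        (of_int k *\<^sub>R (\<i> * cis (of_int k * t))) / (\<i> * of_int k)) (at t within {0..2 * pi})"
      by (rule has_vector_derivative_divide)
    then show "((\<lambda>t. cis (of_int k * t) / (\<i> * of_int k)) has_vector_derivative cis (of_int k * t))
        (at t within {0..2 * pi})"
      using False by (simp add: scaleR_conv_of_real)
  qed simp
  moreover have "cis (of_int k * (2 * pi)) = 1"
    using cis_multiple_2pi[of "of_int k"] by (simp add: mult_ac)
  ultimately show ?thesis using False by simp
qed

lemma has_integral_trig_poly: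
  "((\<lambda>t. (cmod (\<Sum>n<N. c n * cis (of_nat n * t)))\<^sup>2) has_integral 2 * pi * (\<Sum>n<N. (cmod (c n))\<^sup>2)) {0..2 * pi}"
proof -
  have *: "((\<lambda>t. \<Sum>m<N. \<Sum>n<N. c m * cnj (c n) * cis (of_int (int m - int n) * t)) has_integral
     (\<Sum>m<N. \<Sum>n<N. c m * cnj (c n) * (if int m - int n = 0 then of_real (2 * pi) else 0))) {0..2 * pi}"
    by (intro has_integral_sum has_integral_mult_right has_integral_cis) auto
  have 1: "(\<Sum>m<N. \<Sum>n<N. c m * cnj (c n) * cis (of_int (int m - int n) * t))
      = of_real ((cmod (\<Sum>n<N. c n * cis (of_nat n * t)))\<^sup>2)" for t
  proof -
    have "cis (of_int (int m - int n) * t) = cis (of_nat m * t) * cnj (cis (of_nat n * t))" for m n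
      by (simp add: cis_cnj cis_mult algebra_simps)
    then show ?thesis
      unfolding complex_norm_square cnj_sum sum_product complex_cnj_mult
      by (intro sum.cong refl) (simp only: mult_ac)
  qed
  have 2: "(\<Sum>m<N. \<Sum>n<N. c m * cnj (c n) * (if int m - int n = 0 then of_real (2 * pi) else 0))
      = of_real (2 * pi * (\<Sum>n<N. (cmod (c n))\<^sup>2))"
  proof -
    have "(\<Sum>n<N. c m * cnj (c n) * (if int m - int n = 0 then of_real (2 * pi) else 0))
        = of_real (2 * pi * (cmod (c m))\<^sup>2)" if "m < N" for m
    proof -
      have "(\<Sum>n<N. c m * cnj (c n) * (if int m - int n = 0 then of_real (2 * pi) else 0))
         = (\<Sum>n<N. if n = m then c m * cnj (c m) * of_real (2 * pi) else 0)"
        by (intro sum.cong) auto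
      also have "\<dots> = of_real (2 * pi * (cmod (c m))\<^sup>2)"
        using that complex_norm_square[of "c m"] by (simp add: mult_ac)
      finally show ?thesis .
    qed
    then show ?thesis by (simp add: sum_distrib_left)
  qed
  show ?thesis
    using has_integral_linear[OF *[unfolded 1 2] bounded_linear_Re] by (simp add: o_def)
qed

lemma parseval_circle_mean:
  assumes "f holomorphic_on ball 0 1" "0 < r" "r < 1"
  shows "(\<lambda>n. (cmod (taylor_coeff f n))\<^sup>2 * r ^ (2 * n)) sums circle_mean f r"
proof -
  define c where "c = (\<lambda>n. taylor_coeff f n * of_real r ^ n)"
  obtain s where s: "r < s" "s < 1" using dense assms(3) by blast
  have "summable (\<lambda>n. taylor_coeff f n * of_real s ^ n)"
    using taylor_sums[OF assms(1), of "of_real s"] s assms(2) by (simp add: sums_iff)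
  then have sc: "summable (\<lambda>n. norm (c n))"
    unfolding c_def using s assms(2) by (elim powser_insidea) auto
  have lim: "(\<lambda>N. \<Sum>n<N. c n * cis (of_nat n * t)) \<longlonglongrightarrow> f (of_real r * cis t)" for t
    using taylor_sums[OF assms(1), of "of_real r * cis t"] assms(2,3)
    unfolding sums_def c_def power_mult_distrib Complex.DeMoivre
    by (simp add: norm_mult mult.assoc)
  have "(\<lambda>N. integral {0..2 * pi} (\<lambda>t. (cmod (\<Sum>n<N. c n * cis (of_nat n * t)))\<^sup>2))
      \<longlonglongrightarrow> integral {0..2 * pi} (\<lambda>t. (cmod (f (of_real r * cis t)))\<^sup>2)"
  proof (rule dominated_convergence(2))
    show "(\<lambda>t. (cmod (\<Sum>n<N. c n * cis (of_nat n * t)))\<^sup>2) integrable_on {0..2 * pi}" for N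
      using has_integral_trig_poly[where N = N and c = c] by blast
    show "(\<lambda>t::real. (\<Sum>n. norm (c n))\<^sup>2) integrable_on {0..2 * pi}"
      by (rule integrable_const_ivl)
    show "norm ((cmod (\<Sum>n<N. c n * cis (of_nat n * t)))\<^sup>2) \<le> (\<Sum>n. norm (c n))\<^sup>2" for N t
    proof -
      have "cmod (\<Sum>n<N. c n * cis (of_nat n * t)) \<le> (\<Sum>n<N. norm (c n))"
        by (rule order_trans[OF norm_sum]) (simp add: norm_mult)
      also have "\<dots> \<le> (\<Sum>n. norm (c n))"
        by (rule sum_le_suminf[OF sc]) auto
      finally show ?thesis by (simp add: power_mono)
    qed
    show "(\<lambda>N. (cmod (\<Sum>n<N. c n * cis (of_nat n * t)))\<^sup>2) \<longlonglongrightarrow> (cmod (f (of_real r * cis t)))\<^sup>2" for t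
      by (intro tendsto_intros lim)
  qed
  then have "(\<lambda>N. 2 * pi * (\<Sum>n<N. (cmod (c n))\<^sup>2)) \<longlonglongrightarrow> 2 * pi * circle_mean f r"
    by (simp add: integral_unique[OF has_integral_trig_poly] circle_mean_def)
  then have "(\<lambda>N. (\<Sum>n<N. (cmod (c n))\<^sup>2)) \<longlonglongrightarrow> circle_mean f r"
    using tendsto_mult_left[of "\<lambda>N. 2 * pi * (\<Sum>n<N. (cmod (c n))\<^sup>2)" _ _ "1/(2*pi)"] by simp
  then show ?thesis
    using assms(2) by (simp add: sums_def c_def norm_mult norm_power power_mult_distrib power_mult[symmetric] mult_ac)
qed

lemma partial_sums_le_circle_means:
  assumes hol: "f holomorphic_on ball 0 1"
    and M: "\<And>r. 0 < r \<Longrightarrow> r < 1 \<Longrightarrow> circle_mean f r \<le> M"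
  shows "(\<Sum>n<N. (cmod (taylor_coeff f n))\<^sup>2) \<le> M"
proof -
  have ev: "\<forall>\<^sub>F r in at_left (1::real). 0 < r \<and> r < 1"
    using eventually_at_left_real[of 0 1] by simp
  have "((\<lambda>r::real. \<Sum>n<N. (cmod (taylor_coeff f n))\<^sup>2 * r ^ (2 * n)) \<longlongrightarrow>
      (\<Sum>n<N. (cmod (taylor_coeff f n))\<^sup>2 * 1 ^ (2 * n))) (at_left 1)"
    by (intro tendsto_intros)
  moreover have "\<forall>\<^sub>F r in at_left (1::real). (\<Sum>n<N. (cmod (taylor_coeff f n))\<^sup>2 * r ^ (2 * n)) \<le> M"
    using ev
  proof eventually_elim
    case (elim r)
    have p: "(\<lambda>n. (cmod (taylor_coeff f n))\<^sup>2 * r ^ (2 * n)) sums circle_mean f r"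
      using parseval_circle_mean[OF hol, of r] elim by simp
    have "(\<Sum>n<N. (cmod (taylor_coeff f n))\<^sup>2 * r ^ (2 * n)) \<le> (\<Sum>n. (cmod (taylor_coeff f n))\<^sup>2 * r ^ (2 * n))"
      using p elim by (intro sum_le_suminf) (auto simp: sums_iff)
    then show ?case using M[of r] elim p by (simp add: sums_iff)
  qed
  ultimately have "(\<Sum>n<N. (cmod (taylor_coeff f n))\<^sup>2 * 1 ^ (2 * n)) \<le> M"
    by (rule tendsto_upperbound) simp
  then show ?thesis by simp
qed

lemma circle_mean_le_suminf:
  assumes hol: "f holomorphic_on ball 0 1" and S: "summable (\<lambda>n. (cmod (taylor_coeff f n))\<^sup>2)"
    and r: "0 < r" "r < 1"
  shows "circle_mean f r \<le> (\<Sum>n. (cmod (taylor_coeff f n))\<^sup>2)"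
proof -
  have p: "(\<lambda>n. (cmod (taylor_coeff f n))\<^sup>2 * r ^ (2 * n)) sums circle_mean f r"
    using parseval_circle_mean[OF hol] r by simp
  then have "circle_mean f r = (\<Sum>n. (cmod (taylor_coeff f n))\<^sup>2 * r ^ (2 * n))"
    by (simp add: sums_iff)
  also have "\<dots> \<le> (\<Sum>n. (cmod (taylor_coeff f n))\<^sup>2)"
    using p r S by (intro suminf_le) (auto simp: sums_iff intro!: mult_left_le power_le_one)
  finally show ?thesis .
qed

lemma hardy_fun_iff_summable:
  "hardy_fun f \<longleftrightarrow> f holomorphic_on ball 0 1 \<and> summable (\<lambda>n. (cmod (taylor_coeff f n))\<^sup>2)"
proof (cases "f holomorphic_on ball 0 1")
  case hol: True
  have "summable (\<lambda>n. (cmod (taylor_coeff f n))\<^sup>2)"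
    if bdd: "bdd_above (circle_mean f ` {0<..<1})"
  proof -
    obtain M where "\<forall>r\<in>{0<..<1}. circle_mean f r \<le> M"
      using bdd by (auto simp: bdd_above_def)
    then have "(\<Sum>n<N. (cmod (taylor_coeff f n))\<^sup>2) \<le> M" for N
      by (intro partial_sums_le_circle_means hol) auto
    then show ?thesis by (intro summableI_nonneg_bounded) auto
  qed
  moreover have "bdd_above (circle_mean f ` {0<..<1})"
    if "summable (\<lambda>n. (cmod (taylor_coeff f n))\<^sup>2)"
    using circle_mean_le_suminf[OF hol that] by (intro bdd_aboveI2) auto
  ultimately show ?thesis using hol by (auto simp: hardy_fun_def)
qed (simp add: hardy_fun_def)

text \<open>Only the values on the disk matter; they are extended by \<open>0\<close> so that equality of
  representatives is equality on the disk.\<close>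

typedef hardy = "{f. hardy_fun f \<and> (\<forall>z. z \<notin> ball 0 1 \<longrightarrow> f z = 0)}"
  morphisms eval_hardy Abs_hardy
proof
  have "taylor_coeff (\<lambda>z. 0) n = 0" for n by (simp add: taylor_coeff_def)
  then show "(\<lambda>z. 0) \<in> {f. hardy_fun f \<and> (\<forall>z. z \<notin> ball 0 1 \<longrightarrow> f z = 0)}"
    by (simp add: hardy_fun_iff_summable)
qed

setup_lifting type_definition_hardy

definition hcoeff :: "hardy \<Rightarrow> nat \<Rightarrow> complex" where
  "hcoeff f = taylor_coeff (eval_hardy f)"

lemma holomorphic_eval_hardy: "eval_hardy f holomorphic_on ball 0 1"
  using eval_hardy[of f] by (simp add: hardy_fun_def)

lemma eval_hardy_outside: "\<not> norm z < 1 \<Longrightarrow> eval_hardy f z = 0"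
  using eval_hardy[of f] by simp

lemma summable_hcoeff: "summable (\<lambda>n. (cmod (hcoeff f n))\<^sup>2)"
  using eval_hardy[of f] by (simp add: hardy_fun_iff_summable hcoeff_def)

lemma hcoeff_sums: "norm z < 1 \<Longrightarrow> (\<lambda>n. hcoeff f n * z ^ n) sums eval_hardy f z"
  unfolding hcoeff_def by (rule taylor_sums[OF holomorphic_eval_hardy])

lemma hardy_eqI: assumes "\<And>n. hcoeff f n = hcoeff g n" shows "f = g"
proof -
  have "eval_hardy f z = eval_hardy g z" for z
  proof (cases "norm z < 1")
    case True
    have "(\<lambda>n. hcoeff f n * z ^ n) = (\<lambda>n. hcoeff g n * z ^ n)" using assms by simp
    then show ?thesis using hcoeff_sums[OF True, of f] hcoeff_sums[OF True, of g]
      by (metis sums_unique2)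
  qed (simp add: eval_hardy_outside)
  then show ?thesis by (metis eval_hardy_inject ext)
qed

lemma taylor_coeff_add:
  assumes "f holomorphic_on ball 0 1" "g holomorphic_on ball 0 1"
  shows "taylor_coeff (\<lambda>z. f z + g z) n = taylor_coeff f n + taylor_coeff g n"
  using higher_deriv_add[OF assms, of 0 n] by (simp add: taylor_coeff_def add_divide_distrib)

lemma taylor_coeff_cmult:
  assumes "f holomorphic_on ball 0 1"
  shows "taylor_coeff (\<lambda>z. c * f z) n = c * taylor_coeff f n"
  using higher_deriv_cmult[OF assms, of 0 n c] by (simp add: taylor_coeff_def)

lemma cmod_add_sq_le: "(cmod (a + b))\<^sup>2 \<le> 2 * (cmod a)\<^sup>2 + 2 * (cmod b)\<^sup>2"
proof -
  have "(cmod (a + b))\<^sup>2 \<le> (cmod a + cmod b)\<^sup>2"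
    by (simp add: norm_triangle_ineq power_mono)
  also have "\<dots> \<le> 2 * (cmod a)\<^sup>2 + 2 * (cmod b)\<^sup>2"
    using sum_squares_bound[of "cmod a" "cmod b"] by (simp add: power2_sum)
  finally show ?thesis .
qed

lemma hardy_fun_add:
  assumes "hardy_fun f" "hardy_fun g"
  shows "hardy_fun (\<lambda>z. f z + g z)"
proof -
  have h: "f holomorphic_on ball 0 1" "g holomorphic_on ball 0 1"
    using assms by (auto simp: hardy_fun_def)
  have "summable (\<lambda>n. 2 * (cmod (taylor_coeff f n))\<^sup>2 + 2 * (cmod (taylor_coeff g n))\<^sup>2)"
    using assms by (intro summable_add summable_mult) (auto simp: hardy_fun_iff_summable)
  then have "summable (\<lambda>n. (cmod (taylor_coeff (\<lambda>z. f z + g z) n))\<^sup>2)"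
    by (rule summable_comparison_test') (auto simp: taylor_coeff_add[OF h] cmod_add_sq_le)
  then show ?thesis using h by (auto simp: hardy_fun_iff_summable intro: holomorphic_intros)
qed

lemma hardy_fun_cmult:
  assumes "hardy_fun f"
  shows "hardy_fun (\<lambda>z. c * f z)"
proof -
  have h: "f holomorphic_on ball 0 1"
    using assms by (auto simp: hardy_fun_def)
  have "summable (\<lambda>n. (cmod c)\<^sup>2 * (cmod (taylor_coeff f n))\<^sup>2)"
    using assms by (intro summable_mult) (auto simp: hardy_fun_iff_summable)
  then show ?thesis using h
    by (auto simp: hardy_fun_iff_summable taylor_coeff_cmult norm_mult power_mult_distrib
        intro: holomorphic_intros)
qed

lift_definition scaleC :: "complex \<Rightarrow> hardy \<Rightarrow> hardy" (infixr "*\<^sub>C" 75) is "\<lambda>c f z. c * f z"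
  by (auto intro: hardy_fun_cmult)

definition cinner :: "hardy \<Rightarrow> hardy \<Rightarrow> complex" where
  "cinner f g = (\<Sum>n. hcoeff f n * cnj (hcoeff g n))"

lemma summable_cinner: "summable (\<lambda>n. hcoeff f n * cnj (hcoeff g n))"
proof (rule summable_comparison_test')
  show "summable (\<lambda>n. (cmod (hcoeff f n))\<^sup>2 + (cmod (hcoeff g n))\<^sup>2)"
    by (intro summable_add summable_hcoeff)
  show "norm (hcoeff f n * cnj (hcoeff g n)) \<le> (cmod (hcoeff f n))\<^sup>2 + (cmod (hcoeff g n))\<^sup>2" for n
    using sum_squares_bound[of "cmod (hcoeff f n)" "cmod (hcoeff g n)"]
      mult_nonneg_nonneg[OF norm_ge_zero[of "hcoeff f n"] norm_ge_zero[of "hcoeff g n"]]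
    unfolding norm_mult complex_mod_cnj by linarith
qed

instantiation hardy :: real_vector
begin

lift_definition zero_hardy :: hardy is "\<lambda>z. 0"
  using hardy_fun_cmult[of _ 0] eval_hardy by auto

lift_definition plus_hardy :: "hardy \<Rightarrow> hardy \<Rightarrow> hardy" is "\<lambda>f g z. f z + g z"
  by (auto intro: hardy_fun_add)

definition uminus_hardy :: "hardy \<Rightarrow> hardy" where "- f = (-1) *\<^sub>C f" for f :: hardy
definition minus_hardy :: "hardy \<Rightarrow> hardy \<Rightarrow> hardy" where "f - g = f + - g" for f g :: hardy
definition scaleR_hardy :: "real \<Rightarrow> hardy \<Rightarrow> hardy" where "r *\<^sub>R f = of_real r *\<^sub>C f" for f :: hardy

lemma hcoeff_zero [simp]: "hcoeff 0 n = 0"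
  by (simp add: hcoeff_def zero_hardy.rep_eq taylor_coeff_def)

lemma hcoeff_add [simp]: "hcoeff (f + g) n = hcoeff f n + hcoeff g n"
  by (simp add: hcoeff_def plus_hardy.rep_eq taylor_coeff_add holomorphic_eval_hardy)

lemma hcoeff_scaleC [simp]: "hcoeff (c *\<^sub>C f) n = c * hcoeff f n"
  by (simp add: hcoeff_def scaleC.rep_eq taylor_coeff_cmult holomorphic_eval_hardy)

lemma hcoeff_uminus [simp]: "hcoeff (- f) n = - hcoeff f n"
  by (simp add: uminus_hardy_def)

lemma hcoeff_minus [simp]: "hcoeff (f - g) n = hcoeff f n - hcoeff g n"
  by (simp add: minus_hardy_def)

lemma hcoeff_scaleR [simp]: "hcoeff (r *\<^sub>R f) n = of_real r * hcoeff f n"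
  by (simp add: scaleR_hardy_def)

instance
proof
  fix f g h :: hardy and a b :: real
  show "f + g + h = f + (g + h)" "f + g = g + f" "0 + f = f" "- f + f = 0" "f - g = f + - g"
    by (auto intro!: hardy_eqI)
  show "a *\<^sub>R (f + g) = a *\<^sub>R f + a *\<^sub>R g" "(a + b) *\<^sub>R f = a *\<^sub>R f + b *\<^sub>R f"
    "a *\<^sub>R b *\<^sub>R f = (a * b) *\<^sub>R f" "1 *\<^sub>R f = f"
    by (auto intro!: hardy_eqI simp: algebra_simps)
qed

end

instantiation hardy :: real_inner
begin

definition inner_hardy :: "hardy \<Rightarrow> hardy \<Rightarrow> real" where "inner f g = Re (cinner f g)" for f g :: hardy
definition norm_hardy :: "hardy \<Rightarrow> real" where "norm f = sqrt (inner f f)" for f :: hardy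
definition dist_hardy :: "hardy \<Rightarrow> hardy \<Rightarrow> real" where "dist f g = norm (f - g)" for f g :: hardy
definition sgn_hardy :: "hardy \<Rightarrow> hardy" where "sgn f = f /\<^sub>R norm f" for f :: hardy
definition uniformity_hardy :: "(hardy \<times> hardy) filter" where
  "uniformity_hardy = (INF e\<in>{0<..}. principal {(f, g). dist f g < e})"
definition open_hardy :: "hardy set \<Rightarrow> bool" where
  "open_hardy U \<longleftrightarrow> (\<forall>x\<in>U. \<forall>\<^sub>F (x', y) in uniformity. x' = x \<longrightarrow> y \<in> U)"

lemma inner_self_hardy: "inner f f = (\<Sum>n. (cmod (hcoeff f n))\<^sup>2)" for f :: hardy
proof -
  have "cinner f f = (\<Sum>n. of_real ((cmod (hcoeff f n))\<^sup>2))"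
    unfolding cinner_def complex_norm_square ..
  then show ?thesis
    unfolding inner_hardy_def suminf_of_real[OF summable_hcoeff, symmetric] by simp
qed

lemma inner_hardy_sum: "inner f g = (\<Sum>n. Re (hcoeff f n * cnj (hcoeff g n)))" for f g :: hardy
  unfolding inner_hardy_def cinner_def
  by (rule bounded_linear.suminf[OF bounded_linear_Re summable_cinner])

lemma summable_inner_hardy: "summable (\<lambda>n. Re (hcoeff f n * cnj (hcoeff g n)))"
  using summable_cinner by (rule summable_Re)

instance
proof
  fix f g h :: hardy and a b :: real
  show "dist f g = norm (f - g)" "sgn f = f /\<^sub>R norm f" "norm f = sqrt (inner f f)"
    by (simp_all add: dist_hardy_def sgn_hardy_def norm_hardy_def)
  show "inner f g = inner g f"
    by (simp add: inner_hardy_sum mult_ac)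
  show "inner (f + g) h = inner f h + inner g h"
    unfolding inner_hardy_sum suminf_add[OF summable_inner_hardy summable_inner_hardy]
    by (simp add: algebra_simps)
  show "inner (a *\<^sub>R f) g = a * inner f g"
    unfolding inner_hardy_sum suminf_mult[OF summable_inner_hardy, symmetric]
    by (simp add: algebra_simps)
  show "0 \<le> inner f f"
    by (simp add: inner_self_hardy suminf_nonneg summable_hcoeff)
  show "inner f f = 0 \<longleftrightarrow> f = 0"
    by (auto simp: inner_self_hardy suminf_eq_zero_iff summable_hcoeff intro!: hardy_eqI)
qed (simp_all add: uniformity_hardy_def open_hardy_def)

end

lemma norm_hardy_sq: "(norm f)\<^sup>2 = (\<Sum>n. (cmod (hcoeff f n))\<^sup>2)"
  using inner_self_hardy[of f] by (simp add: power2_norm_eq_inner)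

lemma norm_hardy_eq_SUP: "(norm f)\<^sup>2 = (SUP r\<in>{0<..<1}. circle_mean (eval_hardy f) r)"
proof (rule antisym)
  have bdd: "bdd_above (circle_mean (eval_hardy f) ` {0<..<1})"
    using eval_hardy[of f] by (simp add: hardy_fun_def)
  show "(norm f)\<^sup>2 \<le> (SUP r\<in>{0<..<1}. circle_mean (eval_hardy f) r)"
    unfolding norm_hardy_sq
  proof (rule suminf_le_const[OF summable_hcoeff])
    show "(\<Sum>n<N. (cmod (hcoeff f n))\<^sup>2) \<le> (SUP r\<in>{0<..<1}. circle_mean (eval_hardy f) r)" for N
      unfolding hcoeff_def using bdd
      by (intro partial_sums_le_circle_means holomorphic_eval_hardy cSUP_upper) auto
  qed
  show "(SUP r\<in>{0<..<1}. circle_mean (eval_hardy f) r) \<le> (norm f)\<^sup>2"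
    unfolding norm_hardy_sq
  proof (rule cSUP_least)
    show "{0<..<1::real} \<noteq> {}" by simp
    show "circle_mean (eval_hardy f) r \<le> (\<Sum>n. (cmod (hcoeff f n))\<^sup>2)" if "r \<in> {0<..<1}" for r
      unfolding hcoeff_def using that summable_hcoeff[of f]
      by (intro circle_mean_le_suminf holomorphic_eval_hardy) (auto simp: hcoeff_def)
  qed
qed

lemma conv_radius_square_summable:
  fixes c :: "nat \<Rightarrow> complex"
  assumes "summable (\<lambda>n. (cmod (c n))\<^sup>2)"
  shows "conv_radius c \<ge> 1"
proof (rule conv_radius_geI_ex')
  fix r :: real assume r: "0 < r" "ereal r < 1"
  have "(\<lambda>n. (cmod (c n))\<^sup>2) \<longlonglongrightarrow> 0"
    by (rule summable_LIMSEQ_zero[OF assms])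
  then have "\<forall>\<^sub>F n in sequentially. (cmod (c n))\<^sup>2 < 1"
    by (rule order_tendstoD) simp
  then have ev: "\<forall>\<^sub>F n in sequentially. norm (c n * of_real r ^ n) \<le> r ^ n"
  proof eventually_elim
    case (elim n)
    then have "cmod (c n) \<le> 1"
      by (simp add: power_less_one_iff abs_square_less_1)
    then show ?case
      using r by (simp add: norm_mult norm_power mult_left_le_one_le)
  qed
  show "summable (\<lambda>n. c n * of_real r ^ n)"
    using r by (intro summable_comparison_test_ev[OF ev] summable_geometric) (auto simp: one_ereal_def)
qed

lemma hcoeff_surj:
  assumes "summable (\<lambda>n. (cmod (c n))\<^sup>2)"
  shows "\<exists>f. \<forall>n. hcoeff f n = c n"
proof -
  define F where "F = eval_fps (Abs_fps c)"
  have R: "fps_conv_radius (Abs_fps c) \<ge> 1"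
    using conv_radius_square_summable[OF assms] by (simp add: fps_conv_radius_def)
  have hol: "F holomorphic_on ball 0 1"
    unfolding F_def
  proof (rule holomorphic_on_eval_fps, rule subsetI)
    fix z :: complex assume "z \<in> ball 0 1"
    then have "ereal (norm z) < 1" by (simp add: one_ereal_def)
    then have "ereal (norm z) < fps_conv_radius (Abs_fps c)" using R by (rule less_le_trans)
    then show "z \<in> eball 0 (fps_conv_radius (Abs_fps c))"
      by (simp add: in_eball_iff)
  qed
  define G where "G = (\<lambda>z. if norm z < 1 then F z else 0)"
  have holG: "G holomorphic_on ball 0 1"
    using hol by (rule holomorphic_transform) (simp add: G_def)
  have "taylor_coeff G n = c n" for n
  proof -
    have "(deriv ^^ n) G 0 = (deriv ^^ n) F 0"
      by (rule higher_deriv_transform_within_open[OF holG hol]) (auto simp: G_def)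
    moreover have "fps_nth (Abs_fps c) n = (deriv ^^ n) F 0 / fact n"
      unfolding F_def by (rule fps_nth_conv_deriv) (rule less_le_trans[OF _ R], simp)
    ultimately show ?thesis by (simp add: taylor_coeff_def)
  qed
  moreover from this have "hardy_fun G"
    using holG assms by (simp add: hardy_fun_iff_summable)
  then have "eval_hardy (Abs_hardy G) = G"
    by (intro Abs_hardy_inverse) (simp add: G_def)
  ultimately show ?thesis
    unfolding hcoeff_def by metis
qed

instance hardy :: banach
proof
  fix X :: "nat \<Rightarrow> hardy" assume X: "Cauchy X"
  have bound: "(\<Sum>n<N. (cmod (hcoeff f n))\<^sup>2) \<le> (norm f)\<^sup>2" for f N
    unfolding norm_hardy_sq by (intro sum_le_suminf summable_hcoeff) auto
  have le: "cmod (hcoeff f n) \<le> norm f" for f n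
  proof -
    have "(cmod (hcoeff f n))\<^sup>2 \<le> (\<Sum>k<Suc n. (cmod (hcoeff f k))\<^sup>2)"
      by (simp add: sum_nonneg)
    with bound[of f "Suc n"] show ?thesis
      by (intro power2_le_imp_le[of "cmod (hcoeff f n)" "norm f"] norm_ge_zero) linarith
  qed
  have "Cauchy (\<lambda>k. hcoeff (X k) n)" for n
  proof (rule metric_CauchyI)
    fix e :: real assume "e > 0"
    then obtain M where M: "\<And>j k. j \<ge> M \<Longrightarrow> k \<ge> M \<Longrightarrow> dist (X j) (X k) < e"
      using metric_CauchyD[OF X, of e] by blast
    have "dist (hcoeff (X j) n) (hcoeff (X k) n) < e" if "j \<ge> M" "k \<ge> M" for j k
      using M[OF that] le[of "X j - X k" n] by (simp add: dist_norm)
    then show "\<exists>M. \<forall>j\<ge>M. \<forall>k\<ge>M. dist (hcoeff (X j) n) (hcoeff (X k) n) < e" by blast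
  qed
  then have conv: "convergent (\<lambda>k. hcoeff (X k) n)" for n
    by (rule Cauchy_convergent)
  define c where "c n = lim (\<lambda>k. hcoeff (X k) n)" for n
  have c: "(\<lambda>k. hcoeff (X k) n) \<longlonglongrightarrow> c n" for n
    unfolding c_def using conv by (simp add: convergent_LIMSEQ_iff)
  have near: "\<exists>M. \<forall>j\<ge>M. \<forall>N. (\<Sum>n<N. (cmod (hcoeff (X j) n - c n))\<^sup>2) \<le> e\<^sup>2" if "e > 0" for e :: real
  proof -
    obtain M where M: "\<And>j k. j \<ge> M \<Longrightarrow> k \<ge> M \<Longrightarrow> dist (X j) (X k) < e"
      using metric_CauchyD[OF X \<open>e > 0\<close>] by blast
    have "(\<Sum>n<N. (cmod (hcoeff (X j) n - c n))\<^sup>2) \<le> e\<^sup>2" if "j \<ge> M" for j N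
    proof (rule tendsto_upperbound)
      show "((\<lambda>k. \<Sum>n<N. (cmod (hcoeff (X j) n - hcoeff (X k) n))\<^sup>2) \<longlongrightarrow>
          (\<Sum>n<N. (cmod (hcoeff (X j) n - c n))\<^sup>2)) sequentially"
        by (intro tendsto_intros c)
      show "\<forall>\<^sub>F k in sequentially. (\<Sum>n<N. (cmod (hcoeff (X j) n - hcoeff (X k) n))\<^sup>2) \<le> e\<^sup>2"
        using eventually_ge_at_top[of M]
      proof eventually_elim
        case (elim k)
        have "(norm (X j - X k))\<^sup>2 \<le> e\<^sup>2"
          using M[OF \<open>j \<ge> M\<close> elim] by (intro power_mono) (auto simp: dist_norm)
        then show ?case using bound[of "X j - X k" N] by simp
      qed
    qed simp
    then show ?thesis by blast
  qed
  obtain M where M: "\<And>N. (\<Sum>n<N. (cmod (hcoeff (X M) n - c n))\<^sup>2) \<le> 1\<^sup>2"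
    using near[OF zero_less_one] by blast
  have "summable (\<lambda>n. (cmod (hcoeff (X M) n - c n))\<^sup>2)"
    using M by (intro summableI_nonneg_bounded) auto
  then have "summable (\<lambda>n. 2 * (cmod (hcoeff (X M) n))\<^sup>2 + 2 * (cmod (hcoeff (X M) n - c n))\<^sup>2)"
    by (intro summable_add summable_mult summable_hcoeff)
  then have "summable (\<lambda>n. (cmod (c n))\<^sup>2)"
  proof (rule summable_comparison_test')
    show "norm ((cmod (c n))\<^sup>2) \<le> 2 * (cmod (hcoeff (X M) n))\<^sup>2 + 2 * (cmod (hcoeff (X M) n - c n))\<^sup>2" for n
      using cmod_add_sq_le[of "hcoeff (X M) n" "c n - hcoeff (X M) n"] by (simp add: norm_minus_commute)
  qed
  then obtain f where f: "\<And>n. hcoeff f n = c n" using hcoeff_surj by blast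
  have "X \<longlonglongrightarrow> f"
  proof (rule metric_LIMSEQ_I)
    fix e :: real assume "e > 0"
    then obtain M where M: "\<And>j N. j \<ge> M \<Longrightarrow> (\<Sum>n<N. (cmod (hcoeff (X j) n - c n))\<^sup>2) \<le> (e/2)\<^sup>2"
      using near[of "e/2"] half_gt_zero[OF \<open>e > 0\<close>] by blast
    have "dist (X j) f < e" if "j \<ge> M" for j
    proof -
      have "(norm (X j - f))\<^sup>2 \<le> (e/2)\<^sup>2"
        unfolding norm_hardy_sq using M[OF that]
        by (intro suminf_le_const summable_hcoeff) (simp add: f)
      then have "norm (X j - f) \<le> e/2"
        by (rule power2_le_imp_le) (use \<open>e > 0\<close> in simp)
      then show ?thesis using \<open>e > 0\<close> by (simp add: dist_norm)
    qed
    then show "\<exists>M. \<forall>j\<ge>M. dist (X j) f < e" by blast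
  qed
  then show "convergent X" by (auto simp: convergent_def)
qed

global_interpretation hardy: vector_space scaleC
  defines hardy_span = hardy.span and hardy_dependent = hardy.dependent
    and hardy_subspace = hardy.subspace
  by unfold_locales (auto intro!: hardy_eqI simp: algebra_simps)

text \<open>Dimension over the complex numbers. The library's \<open>dim\<close> of an infinite-dimensional
  space is \<open>0\<close>, hence a predicate.\<close>

definition has_hardy_dim :: "hardy set \<Rightarrow> nat \<Rightarrow> bool" where
  "has_hardy_dim S m \<longleftrightarrow>
     (\<exists>B. finite B \<and> card B = m \<and> \<not> hardy_dependent B \<and> hardy_span B = S)"

definition orth :: "hardy set \<Rightarrow> hardy set" where
  "orth S = {f. \<forall>g\<in>S. cinner f g = 0}"

definition Zspace :: "complex set \<Rightarrow> hardy set" where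
  "Zspace a = {f. \<forall>z\<in>a. eval_hardy f z = 0}"

definition Gr :: "hardy set set" where
  "Gr = {S. hardy_subspace S \<and> closed S}"

definition bounded_op :: "(hardy \<Rightarrow> hardy) \<Rightarrow> bool" where
  "bounded_op X \<longleftrightarrow> bounded_linear X \<and> (\<forall>c f. X (c *\<^sub>C f) = c *\<^sub>C X f)"

definition selfadjoint_op :: "(hardy \<Rightarrow> hardy) \<Rightarrow> bool" where
  "selfadjoint_op X \<longleftrightarrow> (\<forall>f g. cinner (X f) g = cinner f (X g))"

text \<open>The exponential series of an operator, summed in the norm of the Hardy space at each vector.\<close>

definition exp_op :: "(hardy \<Rightarrow> hardy) \<Rightarrow> hardy \<Rightarrow> hardy" where
  "exp_op Y f = (\<Sum>n. (Y ^^ n) f /\<^sub>R fact n)"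

definition geodesic_joining :: "(real \<Rightarrow> hardy set) \<Rightarrow> hardy set \<Rightarrow> hardy set \<Rightarrow> bool" where
  "geodesic_joining \<delta> S T \<longleftrightarrow> S \<in> Gr \<and> T \<in> Gr \<and>
     (\<exists>X. bounded_op X \<and> selfadjoint_op X \<and> X ` S \<subseteq> orth S \<and> X ` orth S \<subseteq> S \<and>
        (\<forall>t\<in>{0..1}. \<delta> t = exp_op (\<lambda>f. (\<i> * of_real t) *\<^sub>C X f) ` S) \<and>
        exp_op (\<lambda>f. \<i> *\<^sub>C X f) ` S = T)"

text \<open>An unordered sum over the set itself: each point counts once.\<close>

definition blaschke_condition :: "complex set \<Rightarrow> bool" where
  "blaschke_condition a \<longleftrightarrow> (\<lambda>z. 1 - cmod z) summable_on a"

text \<open>The closure is taken in the complex plane, so limit points on the unit circle count.\<close>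

definition limit_set :: "complex set \<Rightarrow> complex set" where
  "limit_set a = closure a - a"

definition admissible_pair :: "nat \<Rightarrow> complex set \<Rightarrow> complex set \<Rightarrow> bool" where
  "admissible_pair m a b \<longleftrightarrow>
     a \<subseteq> ball 0 1 \<and> b \<subseteq> ball 0 1 \<and> infinite a \<and> infinite b \<and> a \<inter> b = {} \<and>
     blaschke_condition a \<and> blaschke_condition b \<and>
     limit_set a = {1} \<and> limit_set b = {1} \<and>
     has_hardy_dim (orth (Zspace a) \<inter> Zspace b) 0 \<and>
     has_hardy_dim (Zspace a \<inter> orth (Zspace b)) m"

end

theory Submission
  imports Defs
begin

text \<open>
  Let \<open>P\<close>, \<open>Q\<close> be the projections onto \<open>S\<close>, \<open>T\<close> and \<open>e = 2P - 1\<close>. If \<open>U = exp (iX)\<close> is the end of a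
  geodesic from \<open>S\<close> to \<open>T\<close>, then \<open>eUe = U\<^sup>-\<^sup>1\<close>, so \<open>U\<close> embeds \<open>S \<inter> T\<^sup>\<bottom>\<close> into
  \<open>S\<^sup>\<bottom> \<inter> T\<close>; hence \<open>m = 0\<close> when the latter is trivial. If both intersections are trivial, then
  \<open>C = sqrt (1 - (P - Q)\<^sup>2)\<close> is injective with dense range, and \<open>QP + (1 - Q)(1 - P) = VC\<close> for a
  unitary \<open>V\<close> with \<open>VP = QV\<close>, \<open>eVe = V\<^sup>-\<^sup>1\<close> and real part \<open>C\<close>. As \<open>C \<ge> 0\<close>, the segment from \<open>1\<close>
  to \<open>V\<close> stays invertible, and integrating the logarithmic derivative along it gives a skew-adjoint
  \<open>L\<close> with \<open>exp L = V\<close> and \<open>eLe = -L\<close>.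

  For the existence part, points of \<open>(0, 1)\<close> tending to \<open>1\<close> fast enough have almost orthonormal
  Szego kernels. Take such a sequence for \<open>b\<close>, and for \<open>a\<close> a sequence close to \<open>b\<close> without its first
  \<open>m\<close> points. The cross Gram matrix of \<open>a\<close> with these remaining points is a small perturbation of
  the identity, hence invertible, so the intersections have dimensions \<open>0\<close> and \<open>m\<close>; no Blaschke
  products are needed.
\<close>

section \<open>Orthogonal projections in the Hardy space\<close>

lemma cinner_add_left: "cinner (f + g) h = cinner f h + cinner g h"
  unfolding cinner_def suminf_add[OF summable_cinner summable_cinner]
  by (simp add: algebra_simps)

lemma cinner_scaleC_left: "cinner (c *\<^sub>C f) g = c * cinner f g"
  unfolding cinner_def suminf_mult[OF summable_cinner, symmetric] by (simp add: mult_ac)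

lemma cinner_commute: "cinner g f = cnj (cinner f g)"
  using bounded_linear.suminf[OF bounded_linear_cnj summable_cinner[of f g]]
  by (simp add: cinner_def mult_ac)

lemma cinner_add_right: "cinner f (g + h) = cinner f g + cinner f h"
  by (metis cinner_add_left cinner_commute complex_cnj_add)

lemma cinner_scaleC_right: "cinner f (c *\<^sub>C g) = cnj c * cinner f g"
  by (metis cinner_scaleC_left cinner_commute complex_cnj_mult)

lemma cinner_zero_left [simp]: "cinner 0 g = 0"
  by (simp add: cinner_def)

lemma cinner_zero_right [simp]: "cinner g 0 = 0"
  by (simp add: cinner_def)

lemma cinner_minus_left: "cinner (- f) g = - cinner f g"
  unfolding uminus_hardy_def cinner_scaleC_left by simp

lemma cinner_minus_right: "cinner f (- g) = - cinner f g"
  unfolding uminus_hardy_def cinner_scaleC_right by simp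

lemma cinner_diff_left: "cinner (f - g) h = cinner f h - cinner g h"
  unfolding minus_hardy_def cinner_add_left cinner_minus_left by simp

lemma cinner_diff_right: "cinner f (g - h) = cinner f g - cinner f h"
  unfolding minus_hardy_def cinner_add_right cinner_minus_right by simp

lemma cinner_scaleR_left: "cinner (r *\<^sub>R f) g = r *\<^sub>R cinner f g"
  unfolding scaleR_hardy_def cinner_scaleC_left scaleR_conv_of_real ..

lemma cinner_scaleR_right: "cinner f (r *\<^sub>R g) = r *\<^sub>R cinner f g"
  unfolding scaleR_hardy_def cinner_scaleC_right scaleR_conv_of_real by simp

lemmas cinner_simps = cinner_add_left cinner_add_right cinner_diff_left cinner_diff_right
  cinner_minus_left cinner_minus_right cinner_scaleC_left cinner_scaleC_right
  cinner_scaleR_left cinner_scaleR_right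

lemma cinner_sum_left: "cinner (\<Sum>i\<in>A. f i) g = (\<Sum>i\<in>A. cinner (f i) g)"
  by (induction A rule: infinite_finite_induct) (auto simp: cinner_add_left)

lemma cinner_self: "cinner f f = of_real ((norm f)\<^sup>2)"
proof -
  have "Im (cinner f f) = 0"
    using cinner_commute[of f f] by (metis Reals_cnj_iff complex_is_Real_iff)
  then show ?thesis
    using inner_hardy_def[of f f] by (simp add: complex_eq_iff power2_norm_eq_inner)
qed

lemma cinner_self_eq_0: "cinner f f = 0 \<longleftrightarrow> f = 0"
  by (simp add: cinner_self)

lemma norm_scaleC [simp]: "norm (c *\<^sub>C f) = cmod c * norm f"
proof -
  have "complex_of_real ((norm (c *\<^sub>C f))\<^sup>2) = of_real ((cmod c * norm f)\<^sup>2)"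
    by (simp only: cinner_self[symmetric] cinner_simps power_mult_distrib of_real_mult
        complex_norm_square mult_ac)
  then have "(norm (c *\<^sub>C f))\<^sup>2 = (cmod c * norm f)\<^sup>2"
    by (simp only: of_real_eq_iff)
  then show ?thesis by (simp add: power2_eq_iff_nonneg)
qed

lemma norm_cinner_le: "norm (cinner f g) \<le> norm f * norm g"
proof (cases "cinner f g = 0")
  case False
  define r where "r = cmod (cinner f g)"
  define c where "c = cnj (cinner f g) / of_real r"
  have r: "r > 0" using False by (simp add: r_def)
  have c: "cmod c = 1" using r by (simp add: c_def norm_divide flip: r_def)
  have "cinner f g * cnj (cinner f g) = of_real (r\<^sup>2)"
    unfolding r_def by (rule complex_norm_square[symmetric])
  then have "c * cinner f g = of_real r"
    using r by (simp add: c_def field_simps power2_eq_square)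
  then have "r = Re (cinner (c *\<^sub>C f) g)"
    by (simp add: cinner_simps)
  also have "\<dots> \<le> norm (c *\<^sub>C f) * norm g"
    using norm_cauchy_schwarz[of "c *\<^sub>C f" g] by (simp add: inner_hardy_def)
  finally show ?thesis using c by (simp add: r_def)
qed simp

lemma bounded_bilinear_cinner: "bounded_bilinear cinner"
  by unfold_locales (auto simp: cinner_simps intro!: exI[of _ 1] norm_cinner_le)

lemmas bounded_linear_cinner_left = bounded_bilinear.bounded_linear_left[OF bounded_bilinear_cinner]
lemmas bounded_linear_cinner_right = bounded_bilinear.bounded_linear_right[OF bounded_bilinear_cinner]

lemma bounded_linear_scaleC: "bounded_linear (\<lambda>f. c *\<^sub>C f)"
  by (rule bounded_linear_intro[where K = "cmod c"])
     (auto intro!: hardy_eqI simp: algebra_simps)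

lemma in_orth_iff: "f \<in> orth S \<longleftrightarrow> (\<forall>g\<in>S. cinner f g = 0)"
  by (simp add: orth_def)

lemma in_orth_iff': "f \<in> orth S \<longleftrightarrow> (\<forall>g\<in>S. cinner g f = 0)"
  by (metis in_orth_iff cinner_commute complex_cnj_zero)

lemma hardy_subspace_orth: "hardy_subspace (orth S)"
  by (auto simp: hardy.subspace_def in_orth_iff cinner_simps)

lemma closed_orth: "closed (orth S)"
proof -
  have "orth S = (\<Inter>g\<in>S. {f. cinner f g = 0})"
    by (auto simp: in_orth_iff)
  moreover have "closed {f. cinner f g = 0}" for g
    by (intro closed_Collect_eq linear_continuous_on bounded_linear_cinner_left continuous_on_const)
  ultimately show ?thesis by auto
qed

lemma orth_in_Gr: "orth S \<in> Gr"
  by (simp add: Gr_def hardy_subspace_orth closed_orth)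

lemma orth_Int_eq_0: "f \<in> S \<Longrightarrow> f \<in> orth S \<Longrightarrow> f = 0"
  using in_orth_iff cinner_self_eq_0 by blast

lemma subset_orth_orth: "S \<subseteq> orth (orth S)"
  unfolding in_orth_iff'[abs_def] subset_iff by (simp add: in_orth_iff)

lemma closest_point_orthogonal:
  assumes S: "hardy_subspace S" and "p \<in> S" and min: "\<And>g. g \<in> S \<Longrightarrow> norm (f - p) \<le> norm (f - g)"
  shows "f - p \<in> orth S"
proof -
  have "cinner (f - p) g = 0" if "g \<in> S" for g
  proof (cases "g = 0")
    case False
    define c where "c = cinner (f - p) g / of_real ((norm g)\<^sup>2)"
    define h where "h = f - p - c *\<^sub>C g"
    have "p + c *\<^sub>C g \<in> S"
      using S \<open>p \<in> S\<close> that by (auto simp: hardy.subspace_def)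
    then have "norm (f - p) \<le> norm h"
      using min by (simp add: h_def diff_diff_eq)
    have "cinner h g = 0"
      using False by (simp add: h_def c_def cinner_simps cinner_self)
    then have "cinner g h = 0" by (metis cinner_commute complex_cnj_zero)
    have "f - p = h + c *\<^sub>C g" by (simp add: h_def)
    then have "cinner (f - p) (f - p) = cinner h h + cinner (c *\<^sub>C g) (c *\<^sub>C g)"
      using \<open>cinner h g = 0\<close> \<open>cinner g h = 0\<close> by (simp add: cinner_simps)
    then have "(norm (f - p))\<^sup>2 = (norm h)\<^sup>2 + (cmod c * norm g)\<^sup>2"
      unfolding cinner_self of_real_add[symmetric] of_real_eq_iff by simp
    moreover have "(norm (f - p))\<^sup>2 \<le> (norm h)\<^sup>2"
      using \<open>norm (f - p) \<le> norm h\<close> by (simp add: power_mono)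
    ultimately have "(cmod c * norm g)\<^sup>2 \<le> 0" by linarith
    then have "c = 0" using False by simp
    then show ?thesis using False by (simp add: c_def)
  qed simp
  then show ?thesis by (simp add: in_orth_iff)
qed

lemma projection_exists:
  assumes "S \<in> Gr"
  shows "\<exists>p\<in>S. f - p \<in> orth S"
proof -
  have S: "hardy_subspace S" "closed S" using assms by (auto simp: Gr_def)
  then have ne: "S \<noteq> {}" by (auto simp: hardy.subspace_def)
  define d where "d = (INF g\<in>S. norm (f - g))"
  have d_le: "d \<le> norm (f - g)" if "g \<in> S" for g
    unfolding d_def using that by (intro cINF_lower bdd_belowI2[where m = 0]) auto
  have "d \<ge> 0" unfolding d_def using ne by (intro cINF_greatest) auto
  have "\<exists>g\<in>S. norm (f - g) < d + 1 / Suc n" for n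
  proof -
    have "bdd_below ((\<lambda>g. norm (f - g)) ` S)" by (rule bdd_belowI2[where m = 0]) simp
    then show ?thesis
      using cINF_less_iff[OF ne, of "\<lambda>g. norm (f - g)" "d + 1 / Suc n"] by (simp add: d_def[symmetric])
  qed
  then obtain X where X: "\<And>n. X n \<in> S" "\<And>n. norm (f - X n) < d + 1 / Suc n"
    by metis
  have close: "(norm (X i - X j))\<^sup>2 \<le> (4 * d + 2) * (1 / Suc i + 1 / Suc j)" for i j
  proof -
    have "(1/2) *\<^sub>R (X i + X j) \<in> S"
      using S(1) X(1) by (simp add: scaleR_hardy_def hardy.subspace_def)
    from d_le[OF this] have "2 * d \<le> 2 * norm (f - (1/2) *\<^sub>R (X i + X j))" by simp
    also have "\<dots> = norm (2 *\<^sub>R (f - (1/2) *\<^sub>R (X i + X j)))" by simp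
    also have "2 *\<^sub>R (f - (1/2) *\<^sub>R (X i + X j)) = (f - X i) + (f - X j)"
      by (simp add: scaleR_diff_right scaleR_2)
    finally have 1: "(2 * d)\<^sup>2 \<le> (norm ((f - X i) + (f - X j)))\<^sup>2"
      using \<open>d \<ge> 0\<close> by (intro power_mono) auto
    have 2: "(norm ((f - X i) + (f - X j)))\<^sup>2 + (norm (X i - X j))\<^sup>2
        = 2 * (norm (f - X i))\<^sup>2 + 2 * (norm (f - X j))\<^sup>2"
    proof -
      have "(norm (u + v))\<^sup>2 + (norm (v - u))\<^sup>2 = 2 * (norm u)\<^sup>2 + 2 * (norm v)\<^sup>2" for u v :: hardy
        by (simp add: power2_norm_eq_inner inner_add_left inner_add_right inner_diff_left
            inner_diff_right inner_commute)
      from this[of "f - X i" "f - X j"] show ?thesis by simp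
    qed
    have 3: "(norm (f - X k))\<^sup>2 \<le> d\<^sup>2 + (2 * d + 1) * (1 / Suc k)" for k
    proof -
      have "(norm (f - X k))\<^sup>2 \<le> (d + 1 / Suc k)\<^sup>2"
        using X(2)[of k] by (intro power_mono) auto
      also have "\<dots> = d\<^sup>2 + (2 * d + 1 / Suc k) * (1 / Suc k)"
        by (simp add: power2_eq_square algebra_simps)
      also have "\<dots> \<le> d\<^sup>2 + (2 * d + 1) * (1 / Suc k)"
        by (intro add_left_mono mult_right_mono) auto
      finally show ?thesis .
    qed
    have "(2 * d)\<^sup>2 = 4 * d\<^sup>2" by (simp add: power_mult_distrib)
    then have "(norm (X i - X j))\<^sup>2 \<le> 2 * ((2 * d + 1) * (1 / Suc i)) + 2 * ((2 * d + 1) * (1 / Suc j))"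
      using 1 2 3[of i] 3[of j] by linarith
    then show ?thesis by (simp add: algebra_simps)
  qed
  have "Cauchy X"
  proof (rule CauchyI)
    fix e :: real assume "e > 0"
    have "(\<lambda>n. (4 * d + 2) * (1 / real (Suc n))) \<longlonglongrightarrow> (4 * d + 2) * 0"
      by (intro tendsto_intros LIMSEQ_Suc lim_inverse_n')
    then have "\<forall>\<^sub>F n in sequentially. (4 * d + 2) * (1 / real (Suc n)) < e\<^sup>2 / 2"
      by (rule order_tendstoD) (use \<open>e > 0\<close> in simp)
    then obtain N where N: "\<And>n. n \<ge> N \<Longrightarrow> (4 * d + 2) * (1 / real (Suc n)) < e\<^sup>2 / 2"
      by (auto simp: eventually_sequentially)
    have "norm (X i - X j) < e" if "i \<ge> N" "j \<ge> N" for i j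
    proof -
      have "(norm (X i - X j))\<^sup>2 < e\<^sup>2"
        using close[of i j] N[OF that(1)] N[OF that(2)] unfolding distrib_left by linarith
      then show ?thesis using \<open>e > 0\<close> by (simp add: power2_less_imp_less)
    qed
    then show "\<exists>M. \<forall>i\<ge>M. \<forall>j\<ge>M. norm (X i - X j) < e" by blast
  qed
  then obtain p where p: "X \<longlonglongrightarrow> p" using Cauchy_convergent convergent_def by blast
  have "p \<in> S" using S(2) X(1) p closed_sequentially by blast
  have "norm (f - p) \<le> d"
  proof (rule LIMSEQ_le)
    show "(\<lambda>n. norm (f - X n)) \<longlonglongrightarrow> norm (f - p)" by (intro tendsto_intros p)
    have "(\<lambda>n. d + 1 / real (Suc n)) \<longlonglongrightarrow> d + 0"
      by (intro tendsto_intros LIMSEQ_Suc lim_inverse_n')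
    then show "(\<lambda>n. d + 1 / real (Suc n)) \<longlonglongrightarrow> d" by simp
    show "\<exists>N. \<forall>n\<ge>N. norm (f - X n) \<le> d + 1 / real (Suc n)"
      using X(2) less_imp_le by blast
  qed
  then show ?thesis
    using closest_point_orthogonal[OF S(1) \<open>p \<in> S\<close>] \<open>p \<in> S\<close> d_le by (meson order_trans)
qed

lemma orth_orth:
  assumes "S \<in> Gr"
  shows "orth (orth S) = S"
proof
  show "orth (orth S) \<subseteq> S"
  proof
    fix f assume f: "f \<in> orth (orth S)"
    obtain p where p: "p \<in> S" "f - p \<in> orth S" using projection_exists[OF assms] by blast
    have "f - p \<in> orth (orth S)"
      using f p(1) subset_orth_orth hardy_subspace_orth hardy.subspace_diff by blast
    then have "f - p = 0" using p(2) orth_Int_eq_0 by blast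
    then show "f \<in> S" using p(1) by simp
  qed
qed (rule subset_orth_orth)

lemma dense_if_orth_trivial:
  assumes "hardy_subspace S" "orth S = {0}"
  shows "closure S = UNIV"
proof -
  have "hardy_subspace (closure S)"
    unfolding hardy.subspace_def
  proof (intro conjI ballI allI)
    show "0 \<in> closure S" using assms(1) closure_subset by (auto simp: hardy.subspace_def)
    fix x y c assume x: "x \<in> closure S" and y: "y \<in> closure S"
    obtain X where X: "\<And>n::nat. X n \<in> S" "X \<longlonglongrightarrow> x" using x by (auto simp: closure_sequential)
    obtain Y where Y: "\<And>n::nat. Y n \<in> S" "Y \<longlonglongrightarrow> y" using y by (auto simp: closure_sequential)
    have "X n + Y n \<in> S" for n :: nat using X Y assms(1) by (auto simp: hardy.subspace_def)
    moreover have "(\<lambda>n. X n + Y n) \<longlonglongrightarrow> x + y" by (intro tendsto_intros X Y)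
    ultimately show "x + y \<in> closure S"
      unfolding closure_sequential by (intro exI[of _ "\<lambda>n. X n + Y n"]) simp
  next
    fix c x assume x: "x \<in> closure S"
    obtain X where X: "\<And>n::nat. X n \<in> S" "X \<longlonglongrightarrow> x" using x by (auto simp: closure_sequential)
    have "c *\<^sub>C X n \<in> S" for n :: nat using X assms(1) by (auto simp: hardy.subspace_def)
    moreover have "(\<lambda>n. c *\<^sub>C X n) \<longlonglongrightarrow> c *\<^sub>C x"
      by (rule bounded_linear.tendsto[OF bounded_linear_scaleC X(2)])
    ultimately show "c *\<^sub>C x \<in> closure S"
      unfolding closure_sequential by (intro exI[of _ "\<lambda>n. c *\<^sub>C X n"]) simp
  qed
  then have Gr: "closure S \<in> Gr" by (simp add: Gr_def)
  have "orth (closure S) \<subseteq> orth S" by (simp add: in_orth_iff subset_iff closure_subset[THEN subsetD])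
  then have "orth (closure S) = {0}" using assms(2) by (auto simp: in_orth_iff)
  then have "closure S = orth {0}" by (metis orth_orth[OF Gr])
  also have "\<dots> = UNIV" by (simp add: orth_def)
  finally show ?thesis .
qed

section \<open>The Banach algebra of bounded complex-linear operators\<close>

typedef hop = "{X :: hardy \<Rightarrow>\<^sub>L hardy. \<forall>c f. blinfun_apply X (c *\<^sub>C f) = c *\<^sub>C blinfun_apply X f}"
  morphisms blinfun_of_hop Abs_hop
  by (rule exI[of _ 0]) simp

setup_lifting type_definition_hop

definition app :: "hop \<Rightarrow> hardy \<Rightarrow> hardy" where
  "app X = blinfun_apply (blinfun_of_hop X)"

lemma hop_eqI: "(\<And>f. app X f = app Y f) \<Longrightarrow> X = Y"
  by (metis app_def blinfun_eqI blinfun_of_hop_inject)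

lemma scaleC_scaleR_commute: "c *\<^sub>C (r *\<^sub>R f) = r *\<^sub>R (c *\<^sub>C f)"
  by (auto intro!: hardy_eqI)

lemma hardy_nontrivial: "\<exists>f::hardy. f \<noteq> 0"
proof -
  have "summable (\<lambda>n. (cmod (if n = 0 then 1 else 0))\<^sup>2)"
    by (rule summable_finite[of "{0}"]) auto
  then obtain f where "\<forall>n. hcoeff f n = (if n = 0 then 1 else 0)"
    using hcoeff_surj[of "\<lambda>n. if n = 0 then 1 else 0"] by auto
  then have "f \<noteq> 0" by (metis hcoeff_zero zero_neq_one)
  then show ?thesis ..
qed

instantiation hop :: real_algebra_1
begin

lift_definition zero_hop :: hop is 0 by simp
lift_definition one_hop :: hop is id_blinfun by simp
lift_definition plus_hop :: "hop \<Rightarrow> hop \<Rightarrow> hop" is "(+)"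
  by (simp add: blinfun.add_left hardy.scale_right_distrib)
lift_definition minus_hop :: "hop \<Rightarrow> hop \<Rightarrow> hop" is "(-)"
  by (simp add: blinfun.diff_left hardy.scale_right_diff_distrib)
lift_definition uminus_hop :: "hop \<Rightarrow> hop" is uminus
  by (simp add: blinfun.minus_left)
lift_definition times_hop :: "hop \<Rightarrow> hop \<Rightarrow> hop" is "(o\<^sub>L)"
  by simp
lift_definition scaleR_hop :: "real \<Rightarrow> hop \<Rightarrow> hop" is scaleR
  by (simp add: blinfun.scaleR_left scaleC_scaleR_commute)
instance
proof
  fix X Y Z :: hop and a b :: real
  show "X + Y + Z = X + (Y + Z)" "X + Y = Y + X" "0 + X = X" "- X + X = 0" "X - Y = X + - Y"
    by (transfer; simp)+
  show "a *\<^sub>R (X + Y) = a *\<^sub>R X + a *\<^sub>R Y" "(a + b) *\<^sub>R X = a *\<^sub>R X + b *\<^sub>R X"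
    "a *\<^sub>R b *\<^sub>R X = (a * b) *\<^sub>R X" "1 *\<^sub>R X = X"
    by (transfer; simp add: algebra_simps)+
  show "X * Y * Z = X * (Y * Z)" "(X + Y) * Z = X * Z + Y * Z" "X * (Y + Z) = X * Y + X * Z"
    "a *\<^sub>R X * Y = a *\<^sub>R (X * Y)" "X * a *\<^sub>R Y = a *\<^sub>R (X * Y)" "1 * X = X" "X * 1 = X"
    by (transfer; auto intro!: blinfun_eqI simp: blinfun.bilinear_simps)+
  show "(0::hop) \<noteq> 1"
  proof
    assume "(0::hop) = 1"
    then have "(0::hardy \<Rightarrow>\<^sub>L hardy) = id_blinfun" by transfer
    then have "blinfun_apply 0 f = blinfun_apply id_blinfun f" for f :: hardy by (rule arg_cong)
    then show False using hardy_nontrivial by simp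
  qed
qed

end

instantiation hop :: real_normed_algebra_1
begin

lift_definition norm_hop :: "hop \<Rightarrow> real" is norm .

definition dist_hop :: "hop \<Rightarrow> hop \<Rightarrow> real" where "dist X Y = norm (X - Y)" for X Y :: hop
definition sgn_hop :: "hop \<Rightarrow> hop" where "sgn X = X /\<^sub>R norm X" for X :: hop
definition uniformity_hop :: "(hop \<times> hop) filter" where
  "uniformity_hop = (INF e\<in>{0<..}. principal {(X, Y). dist X Y < e})"
definition open_hop :: "hop set \<Rightarrow> bool" where
  "open_hop U \<longleftrightarrow> (\<forall>x\<in>U. \<forall>\<^sub>F (x', y) in uniformity. x' = x \<longrightarrow> y \<in> U)"

instance
proof
  fix X Y :: hop and a :: real
  show "dist X Y = norm (X - Y)" "sgn X = X /\<^sub>R norm X" by (simp_all add: dist_hop_def sgn_hop_def)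
  show "norm X = 0 \<longleftrightarrow> X = 0" "norm (X + Y) \<le> norm X + norm Y" "norm (a *\<^sub>R X) = \<bar>a\<bar> * norm X"
    "norm (X * Y) \<le> norm X * norm Y"
    by (transfer; simp add: norm_triangle_ineq norm_blinfun_compose)+
  obtain f :: hardy where f: "f \<noteq> 0" using hardy_nontrivial by blast
  have "norm f \<le> norm (id_blinfun :: hardy \<Rightarrow>\<^sub>L hardy) * norm f"
    using norm_blinfun[of id_blinfun f] by simp
  then have "norm (id_blinfun :: hardy \<Rightarrow>\<^sub>L hardy) = 1"
    using f norm_blinfun_id_le[where 'a = hardy] by (intro antisym) simp_all
  then show "norm (1::hop) = 1" by transfer
qed (simp_all add: uniformity_hop_def open_hop_def)

end

lemma app_simps:
  "app 0 f = 0" "app 1 f = f" "app (X + Y) f = app X f + app Y f" "app (X - Y) f = app X f - app Y f"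
  "app (- X) f = - app X f" "app (X * Y) f = app X (app Y f)" "app (r *\<^sub>R X) f = r *\<^sub>R app X f"
  "app X (c *\<^sub>C f) = c *\<^sub>C app X f"
  using blinfun_of_hop[of X]
  by (simp_all add: app_def zero_hop.rep_eq one_hop.rep_eq plus_hop.rep_eq minus_hop.rep_eq
      uminus_hop.rep_eq times_hop.rep_eq scaleR_hop.rep_eq blinfun.bilinear_simps)

lemma norm_app_le: "norm (app X f) \<le> norm X * norm f"
  unfolding app_def norm_hop.rep_eq by (rule norm_blinfun)

lemma bounded_bilinear_app: "bounded_bilinear app"
  by unfold_locales
    (auto simp: app_simps intro!: exI[of _ 1] norm_app_le, auto simp: app_def blinfun.bilinear_simps)

lemmas bounded_linear_app = bounded_bilinear.bounded_linear_right[OF bounded_bilinear_app]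
lemmas bounded_linear_app_left = bounded_bilinear.bounded_linear_left[OF bounded_bilinear_app]
lemmas app_right_simps =
  bounded_bilinear.zero_right[OF bounded_bilinear_app]
  bounded_bilinear.add_right[OF bounded_bilinear_app]
  bounded_bilinear.diff_right[OF bounded_bilinear_app]
  bounded_bilinear.minus_right[OF bounded_bilinear_app]
  bounded_bilinear.scaleR_right[OF bounded_bilinear_app]

lemma norm_hop_le:
  assumes "\<And>f. norm (app X f) \<le> b * norm f" "0 \<le> b"
  shows "norm X \<le> b"
  using assms unfolding app_def norm_hop.rep_eq by (intro norm_blinfun_bound)

lemma bounded_op_obtains_hop:
  assumes "bounded_op T"
  obtains X where "app X = T"
proof -
  have T: "bounded_linear T" "\<And>c f. T (c *\<^sub>C f) = c *\<^sub>C T f"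
    using assms by (auto simp: bounded_op_def)
  have "app (Abs_hop (Blinfun T)) = T"
    unfolding app_def
    by (subst Abs_hop_inverse) (simp_all add: bounded_linear_Blinfun_apply T)
  then show thesis by (rule that)
qed

lemma hop_obtain:
  assumes "\<And>f g. T (f + g) = T f + T g" "\<And>c f. T (c *\<^sub>C f) = c *\<^sub>C T f"
    "\<And>f. norm (T f) \<le> K * norm f"
  obtains X where "app X = T"
proof -
  have "bounded_linear T"
    by (rule bounded_linear_intro[where K = K]) (use assms in \<open>auto simp: scaleR_hardy_def mult_ac\<close>)
  then have "bounded_op T" using assms(2) by (simp add: bounded_op_def)
  then show thesis using that by (rule bounded_op_obtains_hop)
qed

lemma dist_blinfun_of_hop: "dist (blinfun_of_hop A) (blinfun_of_hop B) = dist A B"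
  unfolding dist_norm norm_hop.rep_eq minus_hop.rep_eq ..

lemma blinfun_of_hop_limit:
  assumes "(\<lambda>n::nat. blinfun_of_hop (X n)) \<longlonglongrightarrow> L"
  shows "X \<longlonglongrightarrow> Abs_hop L"
proof -
  have lim: "(\<lambda>n. app (X n) f) \<longlonglongrightarrow> blinfun_apply L f" for f
    unfolding app_def by (rule bounded_linear.tendsto[OF blinfun.bounded_linear_left assms])
  have "blinfun_apply L (c *\<^sub>C f) = c *\<^sub>C blinfun_apply L f" for c f
  proof (rule LIMSEQ_unique[OF lim])
    show "(\<lambda>n. app (X n) (c *\<^sub>C f)) \<longlonglongrightarrow> c *\<^sub>C blinfun_apply L f"
      unfolding app_simps(8) by (rule bounded_linear.tendsto[OF bounded_linear_scaleC lim])
  qed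
  then have "blinfun_of_hop (Abs_hop L) = L" by (intro Abs_hop_inverse) blast
  then have "dist (blinfun_of_hop (X n)) L = dist (X n) (Abs_hop L)" for n
    by (metis dist_blinfun_of_hop)
  then show ?thesis using assms unfolding tendsto_iff by presburger
qed

instance hop :: banach
proof
  fix X :: "nat \<Rightarrow> hop" assume "Cauchy X"
  then have "Cauchy (\<lambda>n. blinfun_of_hop (X n))"
    unfolding Cauchy_def dist_blinfun_of_hop .
  then obtain L where "(\<lambda>n. blinfun_of_hop (X n)) \<longlonglongrightarrow> L"
    using Cauchy_convergent convergent_def by blast
  then show "convergent X" using blinfun_of_hop_limit convergent_def by blast
qed

lemma app_power: "app (X ^ n) f = (app X ^^ n) f"
  by (induction n arbitrary: f) (simp_all add: app_simps)

lemma exp_op_app: "exp_op (app X) = app (exp X)"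
proof
  fix f
  have "summable (\<lambda>n. X ^ n /\<^sub>R fact n)" by (rule summable_exp_generic)
  from bounded_linear.suminf[OF bounded_linear_app_left this, of f]
  show "exp_op (app X) f = app (exp X) f"
    by (simp add: exp_op_def exp_def app_simps app_power)
qed

definition adjoint_pair :: "hop \<Rightarrow> hop \<Rightarrow> bool" where
  "adjoint_pair X Y \<longleftrightarrow> (\<forall>f g. cinner (app X f) g = cinner f (app Y g))"

lemma adjoint_pairD: "adjoint_pair X Y \<Longrightarrow> cinner (app X f) g = cinner f (app Y g)"
  by (simp add: adjoint_pair_def)

lemma adjoint_pair_sym: "adjoint_pair X Y \<Longrightarrow> adjoint_pair Y X"
  unfolding adjoint_pair_def by (subst (1 2) cinner_commute) simp

lemma adjoint_pair_1 [intro]: "adjoint_pair 1 1"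
  by (simp add: adjoint_pair_def app_simps)

lemma adjoint_pair_add [intro]: "adjoint_pair X X' \<Longrightarrow> adjoint_pair Y Y' \<Longrightarrow> adjoint_pair (X + Y) (X' + Y')"
  by (simp add: adjoint_pair_def app_simps cinner_simps)

lemma adjoint_pair_diff [intro]: "adjoint_pair X X' \<Longrightarrow> adjoint_pair Y Y' \<Longrightarrow> adjoint_pair (X - Y) (X' - Y')"
  by (simp add: adjoint_pair_def app_simps cinner_simps)

lemma adjoint_pair_scaleR [intro]: "adjoint_pair X X' \<Longrightarrow> adjoint_pair (r *\<^sub>R X) (r *\<^sub>R X')"
  by (simp add: adjoint_pair_def app_simps cinner_simps)

lemma adjoint_pair_mult [intro]: "adjoint_pair X X' \<Longrightarrow> adjoint_pair Y Y' \<Longrightarrow> adjoint_pair (X * Y) (Y' * X')"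
  by (simp add: adjoint_pair_def app_simps)

lemma adjoint_pair_power [intro]: "adjoint_pair X X' \<Longrightarrow> adjoint_pair (X ^ n) (X' ^ n)"
proof (induction n)
  case (Suc n)
  then show ?case using adjoint_pair_mult[of X X' "X ^ n" "X' ^ n"] by (simp add: power_commutes)
qed (simp add: adjoint_pair_1)

lemma adjoint_pair_sums:
  assumes "X sums A" "Y sums B" "\<And>n. adjoint_pair (X n) (Y n)"
  shows "adjoint_pair A B"
proof -
  have "cinner (app A f) g = cinner f (app B g)" for f g
  proof (rule sums_unique2)
    have "bounded_linear (\<lambda>X. cinner (app X f) g)"
      by (rule bounded_linear_compose[OF bounded_linear_cinner_left bounded_linear_app_left])
    from bounded_linear.sums[OF this assms(1)]
    show "(\<lambda>n. cinner (app (X n) f) g) sums cinner (app A f) g" .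
    have "bounded_linear (\<lambda>X. cinner f (app X g))"
      by (rule bounded_linear_compose[OF bounded_linear_cinner_right bounded_linear_app_left])
    from bounded_linear.sums[OF this assms(2)]
    show "(\<lambda>n. cinner (app (X n) f) g) sums cinner f (app B g)"
      using assms(3) by (simp add: adjoint_pair_def)
  qed
  then show ?thesis by (simp add: adjoint_pair_def)
qed

lemma norm_app_sq_eq: "adjoint_pair X Y \<Longrightarrow> complex_of_real ((norm (app X f))\<^sup>2) = cinner (app (Y * X) f) f"
  unfolding cinner_self[symmetric] app_simps by (rule adjoint_pairD[OF adjoint_pair_sym, symmetric])

lemma orth_projection_exists:
  assumes "S \<in> Gr"
  shows "\<exists>P. adjoint_pair P P \<and> P * P = P \<and> (\<forall>f. app P f = f \<longleftrightarrow> f \<in> S) \<and> (\<forall>f. app P f = 0 \<longleftrightarrow> f \<in> orth S)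
    \<and> (\<forall>f. app P f \<in> S)"
proof -
  have S: "hardy_subspace S" using assms by (simp add: Gr_def)
  have O: "hardy_subspace (orth S)" by (rule hardy_subspace_orth)
  obtain p where p: "\<And>f. p f \<in> S" "\<And>f. f - p f \<in> orth S"
    using projection_exists[OF assms] by metis
  have uniq: "p f = g" if "g \<in> S" "f - g \<in> orth S" for f g
  proof -
    have "g - p f \<in> S" using hardy.subspace_diff[OF S that(1) p(1)] .
    moreover have "g - p f = (f - p f) - (f - g)" by simp
    then have "g - p f \<in> orth S" using hardy.subspace_diff[OF O p(2) that(2)] by metis
    ultimately show ?thesis using orth_Int_eq_0 by fastforce
  qed
  have add: "p (f + g) = p f + p g" for f g
  proof (rule uniq)
    show "p f + p g \<in> S" using hardy.subspace_add[OF S] p by blast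
    have "(f - p f) + (g - p g) \<in> orth S" using hardy.subspace_add[OF O] p by blast
    then show "f + g - (p f + p g) \<in> orth S" by (simp add: add_diff_add)
  qed
  have scale: "p (c *\<^sub>C f) = c *\<^sub>C p f" for c f
  proof (rule uniq)
    show "c *\<^sub>C p f \<in> S" using hardy.subspace_scale[OF S] p by blast
    have "c *\<^sub>C (f - p f) \<in> orth S" using hardy.subspace_scale[OF O] p by blast
    then show "c *\<^sub>C f - c *\<^sub>C p f \<in> orth S" by (simp add: hardy.scale_right_diff_distrib)
  qed
  have sa: "cinner (p f) g = cinner f (p g)" for f g
  proof -
    have "cinner (p f) (g - p g) = 0" "cinner (f - p f) (p g) = 0"
      using p in_orth_iff in_orth_iff' by blast+
    then show ?thesis by (simp add: cinner_simps)
  qed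
  have idem: "p f = f \<longleftrightarrow> f \<in> S" for f
  proof
    assume "f \<in> S"
    then show "p f = f" using O by (intro uniq) (auto simp: hardy.subspace_0)
  qed (metis p(1))
  have le: "norm (p f) \<le> 1 * norm f" for f
  proof (cases "p f = 0")
    case False
    have "cinner (p f) (p f) = cinner (p f) f" using sa[of "p f" f] idem p(1) by metis
    then have "(norm (p f))\<^sup>2 = Re (cinner (p f) f)"
      by (metis cinner_self Re_complex_of_real)
    also have "\<dots> \<le> norm (p f) * norm f"
      using complex_Re_le_cmod norm_cinner_le order_trans by blast
    finally show ?thesis using False by (simp add: power2_eq_square)
  qed simp
  obtain P where P: "app P = p" using hop_obtain[of p, OF add scale le] .
  have "p f = 0 \<longleftrightarrow> f \<in> orth S" for f
    using uniq[of 0 f] p(2)[of f] S by (auto simp: hardy.subspace_0)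
  then show ?thesis
    using idem sa p(1) by (intro exI[of _ P]) (auto simp: adjoint_pair_def P app_simps intro!: hop_eqI)
qed

section \<open>Square roots and exponentials in Banach algebras\<close>

lemma Neumann_inverse:
  fixes Y :: "'a::{real_normed_algebra_1,banach}"
  assumes "norm Y \<le> 1 / 2"
  shows "\<exists>G. (1 - Y) * G = 1 \<and> G * (1 - Y) = 1 \<and> norm G \<le> 2"
proof -
  have "\<exists>!G. 1 + Y * G = G"
  proof (rule banach_fix_type[of "1/2"], safe)
    fix A B
    have "norm (Y * (A - B)) \<le> 1/2 * norm (A - B)"
      using norm_mult_ineq[of Y "A - B"] mult_right_mono[OF assms, of "norm (A - B)"] by simp
    then show "dist (1 + Y * A) (1 + Y * B) \<le> 1/2 * dist A B"
      by (simp add: dist_norm right_diff_distrib)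
  qed simp_all
  then obtain G where G: "1 + Y * G = G" by blast
  have "\<exists>!G. 1 + G * Y = G"
  proof (rule banach_fix_type[of "1/2"], safe)
    fix A B
    have "norm ((A - B) * Y) \<le> norm (A - B) * (1/2)"
      using norm_mult_ineq[of "A - B" Y] mult_left_mono[OF assms, of "norm (A - B)"] by simp
    then show "dist (1 + A * Y) (1 + B * Y) \<le> 1/2 * dist A B"
      by (simp add: dist_norm left_diff_distrib)
  qed simp_all
  then obtain H where H: "1 + H * Y = H" by blast
  have 1: "(1 - Y) * G = 1" using G by (simp add: left_diff_distrib diff_eq_eq)
  have "H * (1 - Y) = 1" using H by (simp add: right_diff_distrib diff_eq_eq)
  then have "H = G" using 1 by (metis mult.assoc mult_1 mult.right_neutral)
  have "norm G \<le> norm (1::'a) + norm (Y * G)" using norm_triangle_ineq[of 1 "Y * G"] G by simp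
  also have "\<dots> \<le> 1 + 1/2 * norm G"
    using norm_mult_ineq[of Y G] mult_right_mono[OF assms, of "norm G"] by simp
  finally show ?thesis using 1 \<open>H = G\<close> \<open>H * (1 - Y) = 1\<close> by auto
qed

lemma inverse_commute:
  fixes D :: "'a::monoid_mult"
  assumes "D * G = 1" "G * D = 1" "X * D = D * X"
  shows "X * G = G * X"
proof -
  have "X * G = G * D * (X * G)" using assms(2) by simp
  also have "\<dots> = G * (X * D) * G" using assms(3) by (simp add: mult.assoc)
  also have "\<dots> = G * X" using assms(1) by (simp add: mult.assoc)
  finally show ?thesis .
qed

definition sqrt_coeff :: "nat \<Rightarrow> real" where
  "sqrt_coeff n = (-1) ^ n * (1/2 gchoose n)"

lemma sqrt_coeff_0 [simp]: "sqrt_coeff 0 = 1"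
  by (simp add: sqrt_coeff_def)

lemma sqrt_coeff_Suc: "sqrt_coeff (Suc n) = sqrt_coeff n * (real n - 1/2) / (real n + 1)"
  by (simp add: sqrt_coeff_def gbinomial_mult_1 gbinomial_Suc_rec field_simps)

lemma sqrt_coeff_Suc_nonpos: "sqrt_coeff (Suc n) \<le> 0"
proof (induction n)
  case (Suc n)
  then show ?case
    unfolding sqrt_coeff_Suc[of "Suc n"]
    by (intro divide_nonpos_pos mult_nonpos_nonneg) auto
qed (simp add: sqrt_coeff_Suc)

lemma sum_sqrt_coeff: "(\<Sum>k\<le>n. sqrt_coeff k) = - 2 * (real n + 1) * sqrt_coeff (Suc n)"
proof (induction n)
  case (Suc n)
  have "(\<Sum>k\<le>Suc n. sqrt_coeff k) = - (2 * real n + 1) * sqrt_coeff (Suc n)"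
    by (simp add: Suc algebra_simps)
  also have "\<dots> = - 2 * (real (Suc n) + 1) * sqrt_coeff (Suc (Suc n))"
    by (simp add: sqrt_coeff_Suc[of "Suc n"] divide_simps) (simp add: algebra_simps)
  finally show ?case .
qed (simp add: sqrt_coeff_Suc)

lemma sum_abs_sqrt_coeff_le: "(\<Sum>k<n. \<bar>sqrt_coeff (Suc k)\<bar>) \<le> 1"
proof -
  have "(\<Sum>k<n. \<bar>sqrt_coeff (Suc k)\<bar>) = (\<Sum>k<n. - sqrt_coeff (Suc k))"
    by (intro sum.cong) (auto simp: sqrt_coeff_Suc_nonpos)
  also have "\<dots> = 1 - (\<Sum>k\<le>n. sqrt_coeff k)"
    by (simp add: sum.atMost_shift sum_negf)
  also have "\<dots> \<le> 1"
    using sqrt_coeff_Suc_nonpos[of n] by (simp add: sum_sqrt_coeff mult_nonpos_nonpos)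
  finally show ?thesis .
qed

lemma summable_abs_sqrt_coeff: "summable (\<lambda>n. \<bar>sqrt_coeff n\<bar>)"
proof (subst summable_Suc_iff[symmetric], rule summableI_nonneg_bounded[where x = 1])
qed (use sum_abs_sqrt_coeff_le in auto)

lemma suminf_abs_sqrt_coeff_le: "(\<Sum>n. \<bar>sqrt_coeff (Suc n)\<bar>) \<le> 1"
  using sum_abs_sqrt_coeff_le summable_abs_sqrt_coeff
  by (intro suminf_le_const) (auto simp: summable_Suc_iff[of "\<lambda>n. \<bar>sqrt_coeff n\<bar>"])

lemma sum_sqrt_coeff_conv:
  "(\<Sum>i\<le>n. sqrt_coeff i * sqrt_coeff (n - i)) = (if n = 0 then 1 else if n = 1 then -1 else 0)"
proof -
  have "(\<Sum>i\<le>n. sqrt_coeff i * sqrt_coeff (n - i))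
      = (-1) ^ n * (\<Sum>i\<le>n. (1/2 gchoose i) * (1/2 gchoose (n - i)))"
    unfolding sum_distrib_left
    by (intro sum.cong refl) (auto simp: sqrt_coeff_def mult_ac simp flip: power_add)
  also have "(\<Sum>i\<le>n. (1/2 gchoose i) * (1/2 gchoose (n - i))) = ((1::real) gchoose n)"
    using gbinomial_Vandermonde[of "1/2::real" "1/2" n] by (simp add: atMost_atLeast0)
  also have "((1::real) gchoose n) = real (1 choose n)"
    by (metis binomial_gbinomial of_nat_1)
  finally show ?thesis by (auto simp: binomial_eq_0)
qed

definition sqrt_series :: "'a::{real_normed_algebra_1,banach} \<Rightarrow> 'a" where
  "sqrt_series x = (\<Sum>n. sqrt_coeff n *\<^sub>R x ^ n)"

context
  fixes x :: "'a::{real_normed_algebra_1,banach}"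
  assumes x: "norm x \<le> 1"
begin

lemma norm_sqrt_term_le: "norm (sqrt_coeff n *\<^sub>R x ^ n) \<le> \<bar>sqrt_coeff n\<bar>"
proof -
  have "norm (x ^ n) \<le> 1"
    using norm_power_ineq[of x n] power_le_one[OF norm_ge_zero x, of n] by linarith
  then have "\<bar>sqrt_coeff n\<bar> * norm (x ^ n) \<le> \<bar>sqrt_coeff n\<bar> * 1"
    by (intro mult_left_mono) auto
  then show ?thesis by simp
qed

lemma summable_norm_sqrt_series: "summable (\<lambda>n. norm (sqrt_coeff n *\<^sub>R x ^ n))"
  by (rule summable_comparison_test'[OF summable_abs_sqrt_coeff])
     (use norm_sqrt_term_le in simp)

lemma sqrt_series_sums: "(\<lambda>n. sqrt_coeff n *\<^sub>R x ^ n) sums sqrt_series x"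
  unfolding sqrt_series_def
  by (rule summable_sums[OF summable_norm_cancel[OF summable_norm_sqrt_series]])

lemma sqrt_series_square: "sqrt_series x * sqrt_series x = 1 - x"
proof -
  have "(\<Sum>i\<le>n. (sqrt_coeff i *\<^sub>R x ^ i) * (sqrt_coeff (n - i) *\<^sub>R x ^ (n - i)))
      = (\<Sum>i\<le>n. sqrt_coeff i * sqrt_coeff (n - i)) *\<^sub>R x ^ n" for n
    unfolding scaleR_left.sum
    by (intro sum.cong refl) (auto simp flip: power_add)
  then have "(\<lambda>n. (if n = 0 then 1 else if n = 1 then -1 else 0) *\<^sub>R x ^ n) sums (sqrt_series x * sqrt_series x)"
    using Cauchy_product_sums[OF summable_norm_sqrt_series summable_norm_sqrt_series]
    unfolding sum_sqrt_coeff_conv sqrt_series_def by simp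
  moreover have "(\<lambda>n. (if n = 0 then 1 else if n = 1 then -1 else 0) *\<^sub>R x ^ n) sums
      (\<Sum>n\<in>{0,1}. (if n = 0 then 1 else if n = 1 then -1 else 0) *\<^sub>R x ^ n)"
    by (rule sums_finite) auto
  ultimately show ?thesis using sums_unique2 by fastforce
qed

lemma norm_1_minus_sqrt_series_le: "norm (1 - sqrt_series x) \<le> 1"
proof -
  let ?f = "\<lambda>n. sqrt_coeff (Suc n) *\<^sub>R x ^ Suc n"
  have s: "summable (\<lambda>n. norm (?f n))"
    using summable_norm_sqrt_series by (subst summable_Suc_iff)
  have "?f sums (sqrt_series x - 1)"
    using sqrt_series_sums sums_Suc_iff[of "\<lambda>n. sqrt_coeff n *\<^sub>R x ^ n" "sqrt_series x - 1"] by simp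
  then have "norm (sqrt_series x - 1) = norm (\<Sum>n. ?f n)" by (simp add: sums_iff)
  also have "\<dots> \<le> (\<Sum>n. norm (?f n))" by (rule summable_norm[OF s])
  also have "\<dots> \<le> (\<Sum>n. \<bar>sqrt_coeff (Suc n)\<bar>)"
    using s summable_abs_sqrt_coeff norm_sqrt_term_le
    by (intro suminf_le) (auto simp: summable_Suc_iff[of "\<lambda>n. \<bar>sqrt_coeff n\<bar>"] simp del: power_Suc)
  also have "\<dots> \<le> 1" by (rule suminf_abs_sqrt_coeff_le)
  finally show ?thesis by (simp add: norm_minus_commute)
qed

lemma sqrt_series_commute:
  assumes "y * x = x * y"
  shows "y * sqrt_series x = sqrt_series x * y"
proof (rule sums_unique2)
  have "y * x ^ n = x ^ n * y" for n
    by (metis assms power_commuting_commutes)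
  then have eq: "sqrt_coeff n *\<^sub>R x ^ n * y = y * (sqrt_coeff n *\<^sub>R x ^ n)" for n by simp
  show "(\<lambda>n. sqrt_coeff n *\<^sub>R x ^ n * y) sums (y * sqrt_series x)"
    unfolding eq by (rule bounded_linear.sums[OF bounded_linear_mult_right sqrt_series_sums])
  show "(\<lambda>n. sqrt_coeff n *\<^sub>R x ^ n * y) sums (sqrt_series x * y)"
    by (rule bounded_linear.sums[OF bounded_linear_mult_left sqrt_series_sums])
qed

end

lemma norm_exp_minus_1_minus_le:
  fixes h :: "'a::{real_normed_algebra_1,banach}"
  shows "norm (exp h - 1 - h) \<le> (norm h)\<^sup>2 * exp (norm h)"
proof -
  let ?f = "\<lambda>n. h ^ (n + 2) /\<^sub>R fact (n + 2)"
  have s: "(\<lambda>n. norm h ^ n /\<^sub>R fact n) sums exp (norm h)" by (rule exp_converges)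
  have le: "norm (?f n) \<le> (norm h)\<^sup>2 * (norm h ^ n /\<^sub>R fact n)" for n
  proof -
    have "norm (?f n) \<le> norm h ^ (n + 2) / fact (n + 2)"
      using norm_power_ineq[of h "n + 2"] by (simp add: divide_inverse mult_left_mono mult.commute del: power_Suc fact_Suc)
    also have "\<dots> \<le> norm h ^ (n + 2) / fact n"
      by (intro divide_left_mono fact_mono) auto
    also have "\<dots> = (norm h)\<^sup>2 * (norm h ^ n /\<^sub>R fact n)"
      by (simp add: power_add divide_inverse power2_eq_square)
    finally show ?thesis .
  qed
  have "?f sums (exp h - (\<Sum>n<2. h ^ n /\<^sub>R fact n))"
    by (rule sums_split_initial_segment[OF exp_converges])
  then have "exp h - 1 - h = (\<Sum>n. ?f n)" by (simp add: sums_iff numeral_2_eq_2 algebra_simps)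
  also have "norm \<dots> \<le> (\<Sum>n. (norm h)\<^sup>2 * (norm h ^ n /\<^sub>R fact n))"
    using s by (intro norm_suminf_le le summable_mult) (simp add: sums_iff)
  also have "\<dots> = (norm h)\<^sup>2 * exp (norm h)"
    using s suminf_mult[of "\<lambda>n. norm h ^ n /\<^sub>R fact n"] by (simp add: sums_iff)
  finally show ?thesis .
qed

lemma exp_has_derivative_at_0:
  "((exp :: 'a::{real_normed_algebra_1,banach} \<Rightarrow> 'a) has_derivative (\<lambda>h. h)) (at 0)"
  unfolding has_derivative_at_alt
proof (intro conjI allI impI)
  show "bounded_linear (\<lambda>h::'a. h)" by (rule bounded_linear_ident)
  fix e :: real assume e: "e > 0"
  define d where "d = min 1 (e / exp 1)"
  have d: "d > 0" using e by (simp add: d_def)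
  have "norm (exp y - exp 0 - (y - 0)) \<le> e * norm (y - 0)" if "norm (y - 0) < d" for y :: 'a
  proof -
    have y: "norm y \<le> 1" "norm y \<le> e / exp 1" using that by (auto simp: d_def)
    have "norm y * exp (norm y) \<le> (e / exp 1) * exp 1"
      using y e by (intro mult_mono) auto
    then have "norm y * (norm y * exp (norm y)) \<le> norm y * e"
      by (intro mult_left_mono) auto
    then show ?thesis
      using norm_exp_minus_1_minus_le[of y] by (simp add: power2_eq_square mult_ac)
  qed
  then show "\<exists>d>0. \<forall>y::'a. norm (y - 0) < d \<longrightarrow> norm (exp y - exp 0 - (y - 0)) \<le> e * norm (y - 0)"
    using d by blast
qed

lemma exp_has_vector_derivative:
  fixes F :: "real \<Rightarrow> 'a::{real_normed_algebra_1,banach}"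
  assumes F: "(F has_vector_derivative D) (at x within S)" and "x \<in> S"
    and comm: "\<And>y. y \<in> S \<Longrightarrow> F y * F x = F x * F y"
  shows "((\<lambda>y. exp (F y)) has_vector_derivative exp (F x) * D) (at x within S)"
proof -
  have "((\<lambda>y. F y - F x) has_derivative (\<lambda>h. h *\<^sub>R D)) (at x within S)"
    using has_derivative_diff[OF F[unfolded has_vector_derivative_def] has_derivative_const] by simp
  then have "((\<lambda>y. exp (F y - F x)) has_derivative (\<lambda>h. h *\<^sub>R D)) (at x within S)"
    by (rule has_derivative_compose[where g = exp and g' = "\<lambda>h. h"]) (simp add: exp_has_derivative_at_0)
  from bounded_linear.has_derivative[OF bounded_linear_mult_right this, of "exp (F x)"]
  have "((\<lambda>y. exp (F x) * exp (F y - F x)) has_vector_derivative exp (F x) * D) (at x within S)"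
    by (simp add: has_vector_derivative_def)
  moreover have "exp (F x) * exp (F y - F x) = exp (F y)" if "y \<in> S" for y
    using exp_add_commuting[of "F x" "F y - F x"] comm[OF that] by (simp add: algebra_simps)
  ultimately show ?thesis
    using \<open>x \<in> S\<close> has_vector_derivative_transform by (metis (no_types, lifting))
qed

section \<open>The logarithm of a unitary operator with nonnegative real part\<close>

lemma adjoint_pair_inverse:
  assumes "adjoint_pair M N" "M * W = 1" "N * Z = 1"
  shows "adjoint_pair W Z"
proof -
  have "cinner (app W f) g = cinner f (app Z g)" for f g
  proof -
    have "app N (app Z g) = g" "app M (app W f) = f"
      using assms(2,3) by (metis app_simps(2,6))+
    then show ?thesis using adjoint_pairD[OF assms(1), of "app W f" "app Z g"] by simp
  qed
  then show ?thesis by (simp add: adjoint_pair_def)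
qed

lemma left_right_inverse_eq:
  fixes M :: "'a::monoid_mult"
  shows "A * M = 1 \<Longrightarrow> M * B = 1 \<Longrightarrow> A = B"
  by (metis mult.assoc mult_1 mult.right_neutral)

locale unitary_real_part =
  fixes V V' C :: hop
  assumes VV': "V * V' = 1" and V'V: "V' * V = 1"
    and real_part: "V + V' = C + C" and norm_C: "norm (1 - C) \<le> 1"
    and norm_V: "norm V \<le> 1" and norm_V': "norm V' \<le> 1"
begin

text \<open>For \<open>t\<close> in \<open>[-1, 1]\<close>, \<open>M\<close> runs along the segment from \<open>1\<close> to \<open>V\<close> and \<open>N\<close> along its adjoint; this
  parametrisation turns the symmetry \<open>M (- t) = V * N t\<close> into a reflection of the integral.\<close>

definition M :: "real \<Rightarrow> hop" where "M t = (1/2) *\<^sub>R ((1 + V) + t *\<^sub>R (V - 1))"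
definition N :: "real \<Rightarrow> hop" where "N t = (1/2) *\<^sub>R ((1 + V') + t *\<^sub>R (V' - 1))"

lemma M_mult_N: "M t * N t = 1 - ((1 - t\<^sup>2) / 2) *\<^sub>R (1 - C)"
  and N_mult_M: "N t * M t = 1 - ((1 - t\<^sup>2) / 2) *\<^sub>R (1 - C)"
proof -
  have 1: "(1 + A) * (1 + B) = (1 + 1 - (1 - C)) + (1 + 1 - (1 - C))"
    and 2: "(A - 1) * (1 + B) + (1 + A) * (B - 1) = 0"
    and 3: "(A - 1) * (B - 1) = (1 - C) + (1 - C)"
    if AB: "A * B = 1" "A + B = C + C" for A B
  proof -
    have "(1 + A) * (1 + B) = 1 + A * B + (A + B)"
      "(A - 1) * (1 + B) + (1 + A) * (B - 1) = (A * B - 1) + (A * B - 1)"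
      "(A - 1) * (B - 1) = 1 + A * B - (A + B)"
      by (simp_all add: algebra_simps)
    then show "(1 + A) * (1 + B) = (1 + 1 - (1 - C)) + (1 + 1 - (1 - C))"
      "(A - 1) * (1 + B) + (1 + A) * (B - 1) = 0" "(A - 1) * (B - 1) = (1 - C) + (1 - C)"
      unfolding AB by simp_all
  qed
  have quarter: "(1/4) *\<^sub>R ((I + I - D) + (I + I - D) + r *\<^sub>R (D + D)) = I - ((1 - r) / 2) *\<^sub>R D"
    for I D :: hop and r
  proof -
    have "I = (1/4) *\<^sub>R (2 *\<^sub>R (2 *\<^sub>R I))" by simp
    then have "I = (1/4) *\<^sub>R (I + I + I + I)" by (simp only: scaleR_2 add.assoc)
    then have "I - ((1 - r) / 2) *\<^sub>R D = (1/4) *\<^sub>R (I + I + I + I - (2 * (1 - r)) *\<^sub>R D)"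
      by (simp add: scaleR_diff_right)
    also have "I + I + I + I - (2 * (1 - r)) *\<^sub>R D = (I + I - D) + (I + I - D) + r *\<^sub>R (D + D)"
      by (simp add: algebra_simps scaleR_2 flip: scaleR_scaleR)
    finally show ?thesis by simp
  qed
  have prod: "(1/2) *\<^sub>R ((1 + A) + t *\<^sub>R (A - 1)) * ((1/2) *\<^sub>R ((1 + B) + t *\<^sub>R (B - 1)))
      = 1 - ((1 - t\<^sup>2) / 2) *\<^sub>R (1 - C)"
    if AB: "A * B = 1" "A + B = C + C" for A B
  proof -
    have "((1 + A) + t *\<^sub>R (A - 1)) * ((1 + B) + t *\<^sub>R (B - 1)) = (1 + A) * (1 + B)
      + t *\<^sub>R ((A - 1) * (1 + B) + (1 + A) * (B - 1)) + (t * t) *\<^sub>R ((A - 1) * (B - 1))"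
      unfolding distrib_left distrib_right mult_scaleR_left mult_scaleR_right scaleR_add_right scaleR_scaleR
      by (simp only: ac_simps)
    then have "((1 + A) + t *\<^sub>R (A - 1)) * ((1 + B) + t *\<^sub>R (B - 1)) =
      (1 + 1 - (1 - C)) + (1 + 1 - (1 - C)) + t\<^sup>2 *\<^sub>R ((1 - C) + (1 - C))"
      unfolding 1[OF AB] 2[OF AB] 3[OF AB] power2_eq_square scaleR_zero_right add_0_right .
    then show ?thesis
      using quarter[of 1 "1 - C" "t\<^sup>2"] by simp
  qed
  show "M t * N t = 1 - ((1 - t\<^sup>2) / 2) *\<^sub>R (1 - C)"
    unfolding M_def N_def by (rule prod[OF VV' real_part])
  show "N t * M t = 1 - ((1 - t\<^sup>2) / 2) *\<^sub>R (1 - C)"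
    unfolding M_def N_def using prod[OF V'V] real_part by (simp only: add.commute)
qed

lemma abs_le_1_if_Icc: "t \<in> {-1..1} \<Longrightarrow> \<bar>t\<bar> \<le> (1::real)"
  unfolding atLeastAtMost_iff by arith

lemma norm_N_le:
  assumes "t \<in> {-1..1}" shows "norm (N t) \<le> 2"
proof -
  have "norm (1 + V') \<le> 2" "norm (V' - 1) \<le> 2"
    using norm_triangle_ineq[of 1 V'] norm_triangle_ineq4[of V' 1] norm_V' by auto
  moreover have "norm (t *\<^sub>R (V' - 1)) \<le> 1 * norm (V' - 1)"
    unfolding norm_scaleR using abs_le_1_if_Icc[OF assms] by (intro mult_right_mono) simp_all
  ultimately have "norm ((1 + V') + t *\<^sub>R (V' - 1)) \<le> 4"
    using norm_triangle_ineq[of "1 + V'" "t *\<^sub>R (V' - 1)"] by linarith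
  then show ?thesis by (simp add: N_def)
qed

lemma M_invertible:
  assumes "t \<in> {-1..1}"
  shows "\<exists>W. M t * W = 1 \<and> W * M t = 1 \<and> norm W \<le> 4"
proof -
  have "t\<^sup>2 \<le> 1" using abs_le_1_if_Icc[OF assms] by (simp only: abs_square_le_1)
  then have "norm (((1 - t\<^sup>2) / 2) *\<^sub>R (1 - C)) \<le> 1/2 * 1"
    unfolding norm_scaleR using norm_C by (intro mult_mono) auto
  then obtain G where G: "M t * N t * G = 1" "G * (N t * M t) = 1" "norm G \<le> 2"
    using Neumann_inverse[of "((1 - t\<^sup>2) / 2) *\<^sub>R (1 - C)"] by (auto simp: M_mult_N N_mult_M)
  have 1: "M t * (N t * G) = 1" using G(1) by (simp add: mult.assoc)
  have 2: "G * N t * M t = 1" using G(2) by (simp add: mult.assoc)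
  have "G * N t = N t * G" by (rule left_right_inverse_eq[OF 2 1])
  moreover have "norm (N t * G) \<le> 2 * 2"
    using norm_mult_ineq[of "N t" G] norm_N_le[OF assms] G(3)
    by (meson mult_mono norm_ge_zero order_trans zero_le_numeral)
  ultimately show ?thesis using 1 2 by (intro exI[of _ "N t * G"]) auto
qed

definition W :: "real \<Rightarrow> hop" where "W t = (SOME W. M t * W = 1 \<and> W * M t = 1 \<and> norm W \<le> 4)"

lemma W_inverse:
  assumes "t \<in> {-1..1}" shows "M t * W t = 1" "W t * M t = 1" "norm (W t) \<le> 4"
  using someI_ex[OF M_invertible[OF assms]] by (auto simp: W_def)

lemma M_commute: "X * V = V * X \<Longrightarrow> X * M t = M t * X"
  by (simp add: M_def algebra_simps)

lemma W_commute:
  assumes "X * V = V * X" "t \<in> {-1..1}" shows "X * W t = W t * X"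
  using inverse_commute W_inverse(1,2) M_commute assms by blast

lemma V_W_commute: "t \<in> {-1..1} \<Longrightarrow> V * W t = W t * V"
  by (rule W_commute) simp_all

lemma V'_W_commute: "t \<in> {-1..1} \<Longrightarrow> V' * W t = W t * V'"
  by (rule W_commute) (simp_all add: VV' V'V)

definition l :: "real \<Rightarrow> hop" where "l t = (1/2) *\<^sub>R ((V - 1) * W t)"

lemma M_diff: "M t - M s = ((t - s) / 2) *\<^sub>R (V - 1)"
proof -
  have "(1/2) *\<^sub>R (A + t *\<^sub>R B) - (1/2) *\<^sub>R (A + s *\<^sub>R B) = ((t - s) / 2) *\<^sub>R B" for A B :: hop
    by (simp add: scaleR_add_right scaleR_diff_left diff_divide_distrib)
  then show ?thesis by (simp only: M_def)
qed

lemma W_lipschitz: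
  assumes "s \<in> {-1..1}" "t \<in> {-1..1}"
  shows "norm (W t - W s) \<le> 16 * \<bar>t - s\<bar>"
proof -
  have "W s * (M s - M t) * W t = (W s * M s) * W t - W s * (M t * W t)"
    by (simp add: algebra_simps)
  then have "W t - W s = W s * (M s - M t) * W t"
    using W_inverse(1)[OF assms(2)] W_inverse(2)[OF assms(1)] by simp
  then have "norm (W t - W s) \<le> norm (W s) * norm (M s - M t) * norm (W t)"
    by (simp only: order_trans[OF norm_mult_ineq mult_right_mono[OF norm_mult_ineq norm_ge_zero]])
  also have "\<dots> \<le> 4 * \<bar>t - s\<bar> * 4"
  proof (intro mult_mono)
    have "norm (V - 1) \<le> 2" using norm_triangle_ineq4[of V 1] norm_V by simp
    then have "\<bar>s - t\<bar> / 2 * norm (V - 1) \<le> \<bar>s - t\<bar> / 2 * 2" by (intro mult_left_mono) auto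
    then show "norm (M s - M t) \<le> \<bar>t - s\<bar>" by (simp add: M_diff abs_minus_commute)
  qed (use W_inverse(3) assms in auto)
  finally show ?thesis by simp
qed

lemma continuous_on_l: "continuous_on {-1..1} l"
proof -
  have "16-lipschitz_on {-1..1} W"
    by (rule lipschitz_onI) (use W_lipschitz in \<open>auto simp: dist_norm\<close>)
  then have "continuous_on {-1..1} W" by (rule lipschitz_on_continuous_on)
  then show ?thesis unfolding l_def by (intro continuous_intros)
qed

lemma l_integrable: "x \<le> 1 \<Longrightarrow> l integrable_on {-1..x}"
  by (rule integrable_continuous_real) (rule continuous_on_subset[OF continuous_on_l], auto)

definition L :: hop where "L = integral {-1..1} l"

lemma integral_l_commute:
  assumes "X * V = V * X" "x \<le> 1"
  shows "X * integral {-1..x} l = integral {-1..x} l * X"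
proof -
  have "X * integral {-1..x} l = integral {-1..x} ((\<lambda>A. X * A) \<circ> l)"
    by (rule integral_linear[OF l_integrable[OF assms(2)] bounded_linear_mult_right, symmetric])
  also have "\<dots> = integral {-1..x} ((\<lambda>A. A * X) \<circ> l)"
  proof (rule Henstock_Kurzweil_Integration.integral_cong)
    fix t assume "t \<in> {-1..x}"
    then have "X * W t = W t * X" using assms by (intro W_commute) auto
    then have "X * ((V - 1) * W t) = ((V - 1) * W t) * X"
      using assms(1) by (metis (no_types, lifting) left_diff_distrib mult.assoc mult_1 mult_1_right right_diff_distrib)
    then show "((\<lambda>A. X * A) \<circ> l) t = ((\<lambda>A. A * X) \<circ> l) t" by (simp add: l_def)
  qed
  also have "\<dots> = integral {-1..x} l * X"
    by (rule integral_linear[OF l_integrable[OF assms(2)] bounded_linear_mult_left])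
  finally show ?thesis .
qed

lemma exp_L: "exp L = V"
proof -
  define F where "F x = integral {-1..x} l" for x
  have F_V: "V * F x = F x * V" if "x \<le> 1" for x
    unfolding F_def using that by (intro integral_l_commute) auto
  have comm: "F y * F x = F x * F y" if "x \<in> {-1..1}" "y \<in> {-1..1}" for x y
    using that F_V[of y] integral_l_commute[of "F y" x] by (auto simp: F_def)
  have "((\<lambda>x. exp (- F x) * M x) has_derivative (\<lambda>h. 0)) (at x within {-1..1})"
    if x: "x \<in> {-1..1}" for x
  proof -
    have "(F has_vector_derivative l x) (at x within {-1..1})"
      unfolding F_def by (rule integral_has_vector_derivative[OF continuous_on_l x])
    then have "((\<lambda>x. - F x) has_vector_derivative - l x) (at x within {-1..1})"
      by (rule has_vector_derivative_minus)
    then have 1: "((\<lambda>x. exp (- F x)) has_vector_derivative exp (- F x) * (- l x)) (at x within {-1..1})"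
      using x comm by (intro exp_has_vector_derivative) auto
    have 2: "(M has_vector_derivative (1/2) *\<^sub>R (V - 1)) (at x within {-1..1})"
      unfolding M_def by (auto intro!: derivative_eq_intros)
    have "exp (- F x) * ((1/2) *\<^sub>R (V - 1)) + exp (- F x) * (- l x) * M x = 0"
      using W_inverse(2)[OF x] by (simp add: l_def mult.assoc)
    then show ?thesis
      using has_vector_derivative_mult[OF 1 2] by (simp add: has_vector_derivative_def)
  qed
  then obtain c where c: "\<And>x. x \<in> {-1..1} \<Longrightarrow> exp (- F x) * M x = c"
    using has_derivative_zero_constant[of "{-1..1::real}" "\<lambda>x. exp (- F x) * M x"] by auto
  have "M (-1) = 1" by (simp add: M_def flip: scaleR_2)
  have "M 1 = V" by (simp add: M_def flip: scaleR_2)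
  have "c = 1" using c[of "-1"] \<open>M (-1) = 1\<close> by (simp add: F_def)
  then have "exp (- L) * V = 1" using c[of 1] \<open>M 1 = V\<close> by (simp add: F_def L_def)
  then show ?thesis
    using exp_minus_inverse[of L] left_right_inverse_eq[of "exp L" "exp (- L)" V] by simp
qed

lemma N_eq: "N t = V' * M (- t)"
  by (simp add: M_def N_def algebra_simps V'V)

lemma N_inverse: "t \<in> {-1..1} \<Longrightarrow> N t * (W (- t) * V) = 1"
proof -
  assume t: "t \<in> {-1..1}"
  have "N t * (W (- t) * V) = V' * (M (- t) * W (- t)) * V" by (simp add: N_eq mult.assoc)
  then show ?thesis using W_inverse(1)[of "- t"] t by (simp add: V'V)
qed

lemma l_reflect:
  assumes "t \<in> {-1..1}"
  shows "(1/2) *\<^sub>R ((V' - 1) * (W (- t) * V)) = - l (- t)"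
    and "(1/2) *\<^sub>R (W (- t) * V * (V' - 1)) = - l (- t)"
proof -
  have t: "- t \<in> {-1..1}" using assms by auto
  have c: "V * W (- t) = W (- t) * V" "V' * W (- t) = W (- t) * V'"
    using V_W_commute[OF t] V'_W_commute[OF t] by auto
  have "(V' - 1) * (W (- t) * V) = (V' - 1) * V * W (- t)" by (simp add: c(1) mult.assoc)
  also have "\<dots> = - ((V - 1) * W (- t))" by (simp add: algebra_simps V'V)
  finally show "(1/2) *\<^sub>R ((V' - 1) * (W (- t) * V)) = - l (- t)" by (simp add: l_def)
  have "W (- t) * V * (V' - 1) = W (- t) - W (- t) * V" by (simp add: algebra_simps VV')
  also have "\<dots> = - ((V - 1) * W (- t))" by (simp add: algebra_simps c(1))
  finally show "(1/2) *\<^sub>R (W (- t) * V * (V' - 1)) = - l (- t)" by (simp add: l_def)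
qed

lemma integral_l_reflect: "integral {-1..1} (\<lambda>t. l (- t)) = L"
  unfolding L_def using l_integrable[of 1] has_integral_reflect_real[of l L 1 "-1"]
  by (intro integral_unique) (simp add: L_def has_integral_iff)

lemma l_integrable': "l integrable_on {-1..1}"
  by (rule l_integrable) simp

lemma l_reflect_integrable: "(\<lambda>t. - l (- t)) integrable_on {-1..1}"
proof -
  have "(\<lambda>t. l (- t)) integrable_on {-1..1}"
    using l_integrable' has_integral_reflect_real[of l L 1 "-1"] by (auto simp: integrable_on_def L_def)
  then show ?thesis by (rule integrable_neg)
qed

lemma conj_L:
  assumes "e * e = 1" "e * V * e = V'"
  shows "e * L * e = - L"
proof -
  have bl: "bounded_linear (\<lambda>A. e * A * e)"
    using bounded_linear_compose[OF bounded_linear_mult_left bounded_linear_mult_right] .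
  have eq: "e * l t * e = - l (- t)" if t: "t \<in> {-1..1}" for t
  proof -
    have ee: "e * (e * A) = A" for A using assms(1) by (simp flip: mult.assoc)
    have "e * M t * e = N t"
      using assms by (simp add: M_def N_def algebra_simps)
    then have "N t * (e * W t * e) = e * (M t * W t) * e"
      by (metis (no_types, lifting) ee mult.assoc)
    then have 1: "N t * (e * W t * e) = 1" using W_inverse(1)[OF t] assms by simp
    have "(W (- t) * V) * N t = 1"
    proof -
      have t': "- t \<in> {-1..1}" using t by auto
      have "(W (- t) * V) * N t = W (- t) * (V * V') * M (- t)" by (simp add: N_eq mult.assoc)
      then show ?thesis using W_inverse(2)[OF t'] by (simp add: VV')
    qed
    then have "e * W t * e = W (- t) * V" using left_right_inverse_eq 1 by metis
    moreover have "e * l t * e = (1/2) *\<^sub>R ((e * (V - 1) * e) * (e * W t * e))"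
      by (simp add: l_def mult.assoc ee)
    moreover have "e * (V - 1) * e = V' - 1" using assms by (simp add: algebra_simps)
    ultimately show ?thesis using l_reflect(1)[OF t] by simp
  qed
  have "e * L * e = integral {-1..1} ((\<lambda>A. e * A * e) \<circ> l)"
    unfolding L_def by (rule integral_linear[OF l_integrable' bl, symmetric])
  also have "\<dots> = integral {-1..1} (\<lambda>t. - l (- t))"
    by (rule Henstock_Kurzweil_Integration.integral_cong) (simp add: eq)
  also have "\<dots> = - L" by (simp add: integral_l_reflect)
  finally show ?thesis .
qed

lemma adjoint_L:
  assumes "adjoint_pair V V'"
  shows "adjoint_pair L (- L)"
proof -
  have adj: "adjoint_pair (l t) (- l (- t))" if t: "t \<in> {-1..1}" for t
  proof -
    have "adjoint_pair (M t) (N t)" unfolding M_def N_def using assms by blast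
    then have "adjoint_pair (W t) (W (- t) * V)"
      using adjoint_pair_inverse W_inverse(1)[OF t] N_inverse[OF t] by blast
    then have "adjoint_pair (l t) ((1/2) *\<^sub>R (W (- t) * V * (V' - 1)))"
      unfolding l_def using assms by blast
    then show ?thesis using l_reflect(2)[OF t] by simp
  qed
  have "cinner (app L f) g = cinner f (app (- L) g)" for f g
  proof -
    have b1: "bounded_linear (\<lambda>X. cinner (app X f) g)"
      by (rule bounded_linear_compose[OF bounded_linear_cinner_left bounded_linear_app_left])
    have b2: "bounded_linear (\<lambda>X. cinner f (app X g))"
      by (rule bounded_linear_compose[OF bounded_linear_cinner_right bounded_linear_app_left])
    have "cinner (app L f) g = integral {-1..1} ((\<lambda>X. cinner (app X f) g) \<circ> l)"
      unfolding L_def by (rule integral_linear[OF l_integrable' b1, symmetric])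
    also have "\<dots> = integral {-1..1} ((\<lambda>X. cinner f (app X g)) \<circ> (\<lambda>t. - l (- t)))"
      by (rule Henstock_Kurzweil_Integration.integral_cong) (use adj adjoint_pairD in auto)
    also have "\<dots> = cinner f (app (integral {-1..1} (\<lambda>t. - l (- t))) g)"
      by (rule integral_linear[OF l_reflect_integrable b2])
    also have "integral {-1..1} (\<lambda>t. - l (- t)) = - L" by (simp add: integral_l_reflect)
    finally show ?thesis .
  qed
  then show ?thesis by (simp add: adjoint_pair_def)
qed

end

section \<open>Geodesics between subspaces\<close>

lemma hop_eq_if_eq_on_dense_range:
  assumes "closure (range (app C)) = UNIV" "X * C = Y * C"
  shows "X = Y"
proof (rule hop_eqI)
  fix f
  have "closed {f. app X f = app Y f}"
    by (intro closed_Collect_eq linear_continuous_on bounded_linear_app)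
  moreover have "range (app C) \<subseteq> {f. app X f = app Y f}"
    using assms(2) by (auto simp flip: app_simps(6))
  ultimately show "app X f = app Y f"
    using assms(1) closure_minimal by blast
qed

lemma dense_range_if_injective_selfadjoint:
  assumes "adjoint_pair C C" "\<And>f. app C f = 0 \<Longrightarrow> f = 0"
  shows "closure (range (app C)) = UNIV"
proof (rule dense_if_orth_trivial)
  show "hardy_subspace (range (app C))"
    unfolding hardy.subspace_def
    by (auto intro: rev_image_eqI[of 0] rev_image_eqI simp: app_right_simps app_simps(8)[symmetric]
        simp flip: bounded_bilinear.add_right[OF bounded_bilinear_app])
  have "app C f = 0" if "f \<in> orth (range (app C))" for f
  proof -
    have "cinner f (app C (app C f)) = 0" using that by (auto simp: in_orth_iff)
    then have "cinner (app C f) (app C f) = 0" using adjoint_pairD[OF assms(1)] by simp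
    then show ?thesis by (simp only: cinner_self_eq_0)
  qed
  then show "orth (range (app C)) = {0}"
    using assms(2) by (auto simp: in_orth_iff)
qed

lemma isometric_factor_exists:
  assumes dense: "closure (range (app C)) = UNIV" and iso: "\<And>f. norm (app D f) = norm (app C f)"
  shows "\<exists>V. V * C = D \<and> norm V \<le> 1"
proof -
  have "\<exists>h. (\<lambda>n::nat. app C (h n)) \<longlonglongrightarrow> x" for x
  proof -
    have "x \<in> closure (range (app C))" using dense by simp
    then obtain y where y: "\<And>n::nat. y n \<in> range (app C)" "y \<longlonglongrightarrow> x"
      unfolding closure_sequential by blast
    have "\<forall>n. \<exists>f. y n = app C f" using y(1) by blast
    then obtain h where "\<forall>n. y n = app C (h n)" by (rule choice[THEN exE])
    then have "y = (\<lambda>n. app C (h n))" by blast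
    then show ?thesis using y(2) by blast
  qed
  then obtain F where F: "\<And>x. (\<lambda>n::nat. app C (F x n)) \<longlonglongrightarrow> x" by metis
  define T where "T x = lim (\<lambda>n. app D (F x n))" for x
  have dist_D: "dist (app D f) (app D g) = dist (app C f) (app C g)" for f g
    unfolding dist_norm using iso[of "f - g"] by (simp add: app_right_simps)
  have T0: "(\<lambda>n. app D (F x n)) \<longlonglongrightarrow> T x" for x
  proof -
    have "Cauchy (\<lambda>n. app D (F x n))"
      using LIMSEQ_imp_Cauchy[OF F[of x]] unfolding Cauchy_def dist_D .
    then show ?thesis unfolding T_def by (simp add: Cauchy_convergent_iff convergent_LIMSEQ_iff)
  qed
  have T: "(\<lambda>n. app D (h n)) \<longlonglongrightarrow> T x" if h: "(\<lambda>n. app C (h n)) \<longlonglongrightarrow> x" for h x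
  proof -
    have "(\<lambda>n. dist (app C (h n)) (app C (F x n))) \<longlonglongrightarrow> dist x x"
      by (intro tendsto_dist h F)
    then have "(\<lambda>n. app D (h n) - app D (F x n)) \<longlonglongrightarrow> 0"
      unfolding dist_D[symmetric] by (simp add: dist_norm tendsto_norm_zero_iff)
    from tendsto_add[OF this T0[of x]] show ?thesis by simp
  qed
  have add: "T (x + y) = T x + T y" for x y
  proof -
    have "(\<lambda>n. app C (F x n + F y n)) \<longlonglongrightarrow> x + y"
      unfolding app_right_simps by (intro tendsto_add F)
    from T[OF this] have "(\<lambda>n. app D (F x n) + app D (F y n)) \<longlonglongrightarrow> T (x + y)"
      unfolding app_right_simps .
    then show ?thesis using tendsto_add[OF T0 T0] LIMSEQ_unique by blast
  qed
  have scale: "T (c *\<^sub>C x) = c *\<^sub>C T x" for c x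
  proof -
    have "(\<lambda>n. app C (c *\<^sub>C F x n)) \<longlonglongrightarrow> c *\<^sub>C x"
      unfolding app_simps(8) by (rule bounded_linear.tendsto[OF bounded_linear_scaleC F])
    from T[OF this] have "(\<lambda>n. c *\<^sub>C app D (F x n)) \<longlonglongrightarrow> T (c *\<^sub>C x)"
      unfolding app_simps(8) .
    then show ?thesis
      using bounded_linear.tendsto[OF bounded_linear_scaleC T0] LIMSEQ_unique by blast
  qed
  have norm_T: "norm (T x) \<le> 1 * norm x" for x
    using LIMSEQ_unique[OF tendsto_norm[OF T0, unfolded iso] tendsto_norm[OF F]] by simp
  obtain V where V: "app V = T" using hop_obtain[of T, OF add scale norm_T] .
  have "app (V * C) f = app D f" for f
    using LIMSEQ_unique[OF T[of "\<lambda>_. f" "app C f"] tendsto_const] by (simp add: V app_simps)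
  then have "V * C = D" by (rule hop_eqI)
  moreover have "norm V \<le> 1" using norm_T by (intro norm_hop_le) (auto simp: V)
  ultimately show ?thesis by blast
qed

text \<open>With \<open>\<theta>\<close> the angle operator of the pair, \<open>(P - Q)\<^sup>2\<close> is \<open>sin\<^sup>2 \<theta>\<close> and \<open>(1 - P - Q)\<^sup>2\<close> is \<open>cos\<^sup>2 \<theta>\<close>.\<close>

lemma projection_pair_sin_cos:
  fixes P Q :: "'a::ring_1"
  assumes "P * P = P" "Q * Q = Q"
  shows "(P - Q) * (P - Q) + (1 - P - Q) * (1 - P - Q) = 1"
    and "P * ((P - Q) * (P - Q)) = ((P - Q) * (P - Q)) * P"
    and "Q * ((P - Q) * (P - Q)) = ((P - Q) * (P - Q)) * Q"
    and "(Q * P + (1 - Q) * (1 - P)) * (P * Q + (1 - P) * (1 - Q)) = 1 - (P - Q) * (P - Q)"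
    and "(P * Q + (1 - P) * (1 - Q)) * (Q * P + (1 - Q) * (1 - P)) = 1 - (P - Q) * (P - Q)"
    and "(Q * P + (1 - Q) * (1 - P)) + (P * Q + (1 - P) * (1 - Q))
      = (1 - (P - Q) * (P - Q)) + (1 - (P - Q) * (P - Q))"
    and "(Q * P + (1 - Q) * (1 - P)) * P = Q * (Q * P + (1 - Q) * (1 - P))"
    and "(P + P - 1) * (Q * P + (1 - Q) * (1 - P)) * (P + P - 1) = P * Q + (1 - P) * (1 - Q)"
    and "(P + P - 1) * (P + P - 1) = 1"
proof -
  have [simp]: "P * (P * X) = P * X" "Q * (Q * X) = Q * X" for X
    using assms by (simp_all flip: mult.assoc)
  note [simp] = assms
  show "(P - Q) * (P - Q) + (1 - P - Q) * (1 - P - Q) = 1"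
    "P * ((P - Q) * (P - Q)) = ((P - Q) * (P - Q)) * P"
    "Q * ((P - Q) * (P - Q)) = ((P - Q) * (P - Q)) * Q"
    "(Q * P + (1 - Q) * (1 - P)) * (P * Q + (1 - P) * (1 - Q)) = 1 - (P - Q) * (P - Q)"
    "(P * Q + (1 - P) * (1 - Q)) * (Q * P + (1 - Q) * (1 - P)) = 1 - (P - Q) * (P - Q)"
    "(Q * P + (1 - Q) * (1 - P)) + (P * Q + (1 - P) * (1 - Q))
      = (1 - (P - Q) * (P - Q)) + (1 - (P - Q) * (P - Q))"
    "(Q * P + (1 - Q) * (1 - P)) * P = Q * (Q * P + (1 - Q) * (1 - P))"
    "(P + P - 1) * (Q * P + (1 - Q) * (1 - P)) * (P + P - 1) = P * Q + (1 - P) * (1 - Q)"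
    "(P + P - 1) * (P + P - 1) = 1"
    by (simp_all add: algebra_simps)
qed

lemma norm_projection_diff_le:
  assumes P: "adjoint_pair P P" "P * P = P" and Q: "adjoint_pair Q Q" "Q * Q = Q"
  shows "norm (P - Q) \<le> 1"
proof (rule norm_hop_le)
  fix f
  have 1: "complex_of_real ((norm (app (P - Q) f))\<^sup>2) = cinner (app ((P - Q) * (P - Q)) f) f"
    by (intro norm_app_sq_eq adjoint_pair_diff P Q)
  have "complex_of_real ((norm (app (1 - P - Q) f))\<^sup>2) = cinner (app ((1 - P - Q) * (1 - P - Q)) f) f"
    by (intro norm_app_sq_eq adjoint_pair_diff adjoint_pair_1 P Q)
  with 1 have "complex_of_real ((norm (app (P - Q) f))\<^sup>2 + (norm (app (1 - P - Q) f))\<^sup>2)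
      = cinner (app ((P - Q) * (P - Q) + (1 - P - Q) * (1 - P - Q)) f) f"
    unfolding app_simps(3) cinner_add_left by simp
  also have "\<dots> = of_real ((norm f)\<^sup>2)"
    unfolding projection_pair_sin_cos(1)[OF P(2) Q(2)] app_simps cinner_self ..
  finally have "(norm (app (P - Q) f))\<^sup>2 + (norm (app (1 - P - Q) f))\<^sup>2 = (norm f)\<^sup>2"
    by (simp only: of_real_eq_iff)
  then have "(norm (app (P - Q) f))\<^sup>2 \<le> (norm f)\<^sup>2"
    using zero_le_power2[of "norm (app (1 - P - Q) f)"] by linarith
  then show "norm (app (P - Q) f) \<le> 1 * norm f"
    by (simp add: power2_le_iff_abs_le)
qed simp

text \<open>Halmos' direct rotation \<open>V\<close>, the unitary factor in the polar decomposition of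
  \<open>QP + (1 - Q)(1 - P)\<close>.\<close>

lemma direct_rotation_exists:
  assumes P: "adjoint_pair P P" "P * P = P" and Q: "adjoint_pair Q Q" "Q * Q = Q"
    and gen: "\<And>f. app P f + app Q f = f \<Longrightarrow> f = 0"
  shows "\<exists>V V' C. unitary_real_part V V' C \<and> adjoint_pair V V' \<and> V * P = Q * V \<and>
    (P + P - 1) * V * (P + P - 1) = V'"
proof -
  define B where "B = (P - Q) * (P - Q)"
  define D0 where "D0 = Q * P + (1 - Q) * (1 - P)"
  define D1 where "D1 = P * Q + (1 - P) * (1 - Q)"
  define e where "e = P + P - 1"
  note alg = projection_pair_sin_cos[OF P(2) Q(2), folded B_def D0_def D1_def e_def]
  define C where "C = sqrt_series B"
  have normB: "norm B \<le> 1"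
    using norm_mult_ineq[of "P - Q" "P - Q"] norm_projection_diff_le[OF P Q]
      mult_mono[OF norm_projection_diff_le[OF P Q] norm_projection_diff_le[OF P Q]]
    by (simp add: B_def)
  have CC: "C * C = 1 - B" unfolding C_def by (rule sqrt_series_square[OF normB])
  have adjB: "adjoint_pair B B" unfolding B_def by (intro adjoint_pair_mult adjoint_pair_diff P Q)
  have adjC: "adjoint_pair C C"
    unfolding C_def
    by (rule adjoint_pair_sums[OF sqrt_series_sums[OF normB] sqrt_series_sums[OF normB]])
       (intro adjoint_pair_scaleR adjoint_pair_power adjB)
  have commP: "P * C = C * P" and commQ: "Q * C = C * Q"
    unfolding C_def by (intro sqrt_series_commute normB alg)+
  have comm_e: "e * C = C * e" using commP by (simp add: e_def algebra_simps)
  have comm_D0: "D0 * C = C * D0"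
    using commP commQ by (simp add: D0_def algebra_simps) (metis mult.assoc)
  have comm_D1: "D1 * C = C * D1"
    using commP commQ by (simp add: D1_def algebra_simps) (metis mult.assoc)
  have inj: "f = 0" if "app C f = 0" for f
  proof -
    have "app (1 - B) f = 0" using that by (simp add: CC[symmetric] app_simps app_right_simps)
    also have "1 - B = (1 - P - Q) * (1 - P - Q)" using alg(1) by (simp add: algebra_simps)
    finally have "complex_of_real ((norm (app (1 - P - Q) f))\<^sup>2) = 0"
      by (subst norm_app_sq_eq[of _ "1 - P - Q"]) (auto intro!: adjoint_pair_diff adjoint_pair_1 P Q)
    then have "app (1 - P - Q) f = 0" by simp
    then have "app P f + app Q f = f" by (simp add: app_simps algebra_simps)
    then show ?thesis by (rule gen)
  qed
  have dense: "closure (range (app C)) = UNIV"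
    by (rule dense_range_if_injective_selfadjoint[OF adjC inj])
  have cancel: "X = Y" if "X * C = Y * C" for X Y
    using hop_eq_if_eq_on_dense_range[OF dense that] .
  have adjD: "adjoint_pair D0 D1"
    unfolding D0_def D1_def by (intro adjoint_pair_add adjoint_pair_mult adjoint_pair_diff adjoint_pair_1 P Q)
  have iso: "norm (app D f) = norm (app C f)" if "adjoint_pair D D'" "D' * D = C * C" for D D' f
  proof -
    have "complex_of_real ((norm (app D f))\<^sup>2) = of_real ((norm (app C f))\<^sup>2)"
      unfolding norm_app_sq_eq[OF that(1)] norm_app_sq_eq[OF adjC] that(2) ..
    then show ?thesis by (simp only: of_real_eq_iff power2_eq_iff_nonneg norm_ge_zero)
  qed
  obtain V where V: "V * C = D0" "norm V \<le> 1"
    using isometric_factor_exists[OF dense iso[OF adjD]] alg(5) CC by auto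
  obtain V' where V': "V' * C = D1" "norm V' \<le> 1"
    using isometric_factor_exists[OF dense iso[OF adjoint_pair_sym[OF adjD]]] alg(4) CC by auto
  have CV: "C * V = V * C" and CV': "C * V' = V' * C"
    by (rule cancel; simp add: mult.assoc V V' comm_D0 comm_D1)+
  have VV': "V * V' = 1"
  proof (rule cancel, rule cancel)
    have "V * V' * C * C = V * C * D1" by (simp add: mult.assoc V' comm_D1)
    then show "V * V' * C * C = 1 * C * C" using alg(4) CC by (simp add: V)
  qed
  have V'V: "V' * V = 1"
  proof (rule cancel, rule cancel)
    have "V' * V * C * C = V' * C * D0" by (simp add: mult.assoc V comm_D0)
    then show "V' * V * C * C = 1 * C * C" using alg(5) CC by (simp add: V')
  qed
  have real_part: "V + V' = C + C"
    by (rule cancel) (simp add: distrib_right V V' CC alg(6))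
  have "unitary_real_part V V' C"
    by unfold_locales
      (use VV' V'V real_part V(2) V'(2) norm_1_minus_sqrt_series_le[OF normB] in \<open>auto simp: C_def\<close>)
  moreover have "adjoint_pair V V'"
  proof -
    have "cinner (app V f) g = cinner f (app V' g)" for f g
    proof -
      have "closed {g. cinner (app V f) g = cinner f (app V' g)}"
        by (intro closed_Collect_eq linear_continuous_on bounded_linear_cinner_right
            bounded_linear_compose[OF bounded_linear_cinner_right bounded_linear_app])
      moreover have "range (app C) \<subseteq> {g. cinner (app V f) g = cinner f (app V' g)}"
      proof safe
        fix g
        have "cinner (app V f) (app C g) = cinner (app (C * V) f) g"
          using adjoint_pairD[OF adjC] by (simp add: app_simps)
        also have "\<dots> = cinner f (app D1 g)" unfolding CV V by (rule adjoint_pairD[OF adjD])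
        also have "\<dots> = cinner f (app V' (app C g))" by (simp add: app_simps flip: V'(1))
        finally show "cinner (app V f) (app C g) = cinner f (app V' (app C g))" .
      qed
      ultimately show ?thesis using dense closure_minimal by blast
    qed
    then show ?thesis by (simp add: adjoint_pair_def)
  qed
  moreover have "V * P = Q * V"
  proof (rule cancel)
    have "V * P * C = V * C * P" by (simp add: mult.assoc commP)
    then show "V * P * C = Q * V * C" using alg(7) by (simp add: mult.assoc V)
  qed
  moreover have "e * V * e = V'"
  proof (rule cancel)
    have "e * V * e * C = e * (V * C) * e" by (simp add: mult.assoc comm_e)
    then show "e * V * e * C = V' * C" using alg(8) by (simp add: V V')
  qed
  ultimately show ?thesis unfolding e_def by blast
qed

lemma codiagonal_iff_reflection:
  fixes P L :: "'a::ring_1"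
  assumes "P * L * P = 0" "(1 - P) * L * (1 - P) = 0"
  shows "(P + P - 1) * L * (P + P - 1) = - L"
proof -
  have "(P + P - 1) * L * (P + P - 1) = (P * L * P + P * L * P) + ((1 - P) * L * (1 - P) + (1 - P) * L * (1 - P)) - L"
    by (simp add: algebra_simps)
  then show ?thesis using assms by simp
qed

theorem geodesic_exists:
  assumes S: "S \<in> Gr" and T: "T \<in> Gr" and ST: "S \<inter> orth T = {0}" "orth S \<inter> T = {0}"
  shows "\<exists>\<delta>. geodesic_joining \<delta> S T"
proof -
  obtain P where P: "adjoint_pair P P" "P * P = P" "\<And>f. app P f = f \<longleftrightarrow> f \<in> S"
    "\<And>f. app P f = 0 \<longleftrightarrow> f \<in> orth S" "\<And>f. app P f \<in> S"
    using orth_projection_exists[OF S] by blast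
  obtain Q where Q: "adjoint_pair Q Q" "Q * Q = Q" "\<And>f. app Q f = f \<longleftrightarrow> f \<in> T"
    "\<And>f. app Q f = 0 \<longleftrightarrow> f \<in> orth T" "\<And>f. app Q f \<in> T"
    using orth_projection_exists[OF T] by blast
  have gen: "f = 0" if f: "app P f + app Q f = f" for f
  proof -
    have "app P (app P f) = app P f" "app Q (app Q f) = app Q f"
      using P(2) Q(2) by (simp_all flip: app_simps(6))
    then have "app P (app Q f) = 0" "app Q (app P f) = 0"
      using arg_cong[OF f, of "app P"] arg_cong[OF f, of "app Q"] by (simp_all add: app_right_simps)
    then have "app Q f = 0" "app P f = 0" using P(4,5) Q(4,5) ST by blast+
    then show ?thesis using f by simp
  qed
  obtain V V' C where V: "unitary_real_part V V' C" "adjoint_pair V V'" "V * P = Q * V"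
    "(P + P - 1) * V * (P + P - 1) = V'"
    using direct_rotation_exists[OF P(1,2) Q(1,2) gen] by blast
  interpret unitary_real_part V V' C by fact
  define e where "e = P + P - 1"
  have eLe: "e * L * e = - L"
    using conj_L[of e] V(4) projection_pair_sin_cos(9)[OF P(2) Q(2)] by (simp add: e_def)
  have adjL: "cinner (app L f) g = - cinner f (app L g)" for f g
    using adjoint_pairD[OF adjoint_L[OF V(2)]] by (simp add: app_simps cinner_simps)
  define X where "X f = (- \<i>) *\<^sub>C app L f" for f
  have X: "bounded_op X"
    unfolding bounded_op_def X_def
    using bounded_linear_compose[OF bounded_linear_scaleC bounded_linear_app]
    by (auto simp: app_simps mult_ac simp del: hardy.scale_minus_left)
  have sa: "selfadjoint_op X"
    unfolding selfadjoint_op_def X_def cinner_scaleC_left cinner_scaleC_right by (simp add: adjL)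
  have orthS: "X ` S \<subseteq> orth S"
  proof safe
    fix f assume "f \<in> S"
    then have ef: "app e f = f" using P(3)[of f] by (simp add: e_def app_simps)
    have "app e (app L f) = app (e * L * e) f" by (simp add: app_simps ef)
    then have "app P (app L f) + app P (app L f) = 0" unfolding eLe by (simp add: e_def app_simps)
    then have "app P (app L f) = 0" by (metis double_eq_0_iff scaleR_2 scaleR_eq_0_iff zero_neq_numeral)
    then show "X f \<in> orth S" using P(4) hardy_subspace_orth hardy.subspace_scale unfolding X_def by blast
  qed
  have orthS': "X ` orth S \<subseteq> S"
  proof safe
    fix f assume "f \<in> orth S"
    then have ef: "app e f = - f" using P(4)[of f] by (simp add: e_def app_simps)
    have "app e (app L f) = - app (e * L * e) f" by (simp add: app_simps ef app_right_simps)
    then have "app P (app L f) + app P (app L f) = app L f + app L f"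
      unfolding eLe by (simp add: e_def app_simps algebra_simps)
    then have "app P (app L f) = app L f" unfolding scaleR_2[symmetric] by simp
    then show "X f \<in> S" using P(3) S hardy.subspace_scale unfolding X_def Gr_def by blast
  qed
  have "(\<lambda>f. \<i> *\<^sub>C X f) = app L" by (auto simp: X_def fun_eq_iff simp del: hardy.scale_minus_left)
  then have exp: "exp_op (\<lambda>f. \<i> *\<^sub>C X f) = app V" by (simp add: exp_op_app exp_L)
  have "app V ` S = T"
  proof safe
    fix f assume "f \<in> S"
    then have "app V f = app (V * P) f" using P(3)[of f] by (simp add: app_simps)
    also have "\<dots> = app Q (app V f)" unfolding V(3) by (simp add: app_simps)
    finally show "app V f \<in> T" using Q(3) by metis
  next
    fix g assume g: "g \<in> T"
    have "V' * Q = V' * (Q * V) * V'" by (simp add: mult.assoc VV')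
    also have "\<dots> = V' * V * P * V'" by (simp add: mult.assoc flip: V(3))
    finally have "V' * Q = P * V'" by (simp add: V'V)
    then have "app V' (app Q g) = app P (app V' g)" by (simp flip: app_simps(6))
    then have "app V' g \<in> S" using Q(3)[of g] g P(3)[of "app V' g"] by simp
    moreover have "g = app V (app V' g)" by (simp add: VV' app_simps flip: app_simps(6))
    ultimately show "g \<in> app V ` S" by blast
  qed
  then have "geodesic_joining (\<lambda>t. exp_op (\<lambda>f. (\<i> * of_real t) *\<^sub>C X f) ` S) S T"
    unfolding geodesic_joining_def using S T X sa orthS orthS' exp by auto
  then show ?thesis by blast
qed

theorem geodesic_imp_intersection_trivial:
  assumes "geodesic_joining \<delta> S T" "orth S \<inter> T = {0}"
  shows "S \<inter> orth T = {0}"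
proof -
  obtain X where S: "S \<in> Gr" and X: "bounded_op X" "selfadjoint_op X" "X ` S \<subseteq> orth S" "X ` orth S \<subseteq> S"
    and T: "exp_op (\<lambda>f. \<i> *\<^sub>C X f) ` S = T"
    using assms(1) by (auto simp: geodesic_joining_def)
  obtain P where P: "adjoint_pair P P" "P * P = P" "\<And>f. app P f = f \<longleftrightarrow> f \<in> S"
    "\<And>f. app P f = 0 \<longleftrightarrow> f \<in> orth S" "\<And>f. app P f \<in> S"
    using orth_projection_exists[OF S] by blast
  have "bounded_op (\<lambda>f. \<i> *\<^sub>C X f)"
    using X(1) bounded_linear_compose[OF bounded_linear_scaleC, of X] by (auto simp: bounded_op_def mult_ac)
  then obtain Y where Y: "app Y = (\<lambda>f. \<i> *\<^sub>C X f)" using bounded_op_obtains_hop by blast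
  define U U' where "U = exp Y" and "U' = exp (- Y)"
  have UT: "app U ` S = T" using T by (simp add: U_def exp_op_app flip: Y)
  have "adjoint_pair Y (- Y)"
    using X(2) by (auto simp: adjoint_pair_def selfadjoint_op_def Y app_simps cinner_simps)
  then have "adjoint_pair (Y ^ n /\<^sub>R fact n) ((- Y) ^ n /\<^sub>R fact n)" for n
    by (intro adjoint_pair_scaleR adjoint_pair_power)
  from adjoint_pair_sums[OF exp_converges exp_converges this]
  have adjU: "adjoint_pair U U'" by (simp add: U_def U'_def)
  define e where "e = P + P - 1"
  have ee: "e * e = 1" unfolding e_def by (rule projection_pair_sin_cos(9)[OF P(2) P(2)])
  have "app (P * Y * P) f = app 0 f" for f
  proof -
    have "X (app P f) \<in> orth S" using X(3) P(5) by blast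
    then have "app Y (app P f) \<in> orth S" unfolding Y using hardy_subspace_orth hardy.subspace_scale by blast
    then show ?thesis using P(4) by (simp add: app_simps)
  qed
  then have 1: "P * Y * P = 0" by (rule hop_eqI)
  have "app ((1 - P) * Y * (1 - P)) f = app 0 f" for f
  proof -
    have "app P (app (1 - P) f) = 0" by (simp add: app_simps app_right_simps P(2) flip: app_simps(6))
    then have "X (app (1 - P) f) \<in> S" using X(4) P(4) by blast
    then have "app Y (app (1 - P) f) \<in> S" unfolding Y using S hardy.subspace_scale by (auto simp: Gr_def)
    then have "app P (app Y (app (1 - P) f)) = app Y (app (1 - P) f)" using P(3) by blast
    then show ?thesis by (simp add: app_simps)
  qed
  then have 2: "(1 - P) * Y * (1 - P) = 0" by (rule hop_eqI)
  have eYe: "e * Y * e = - Y" unfolding e_def by (rule codiagonal_iff_reflection[OF 1 2])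
  have bl: "bounded_linear (\<lambda>A. e * A * e)"
    using bounded_linear_compose[OF bounded_linear_mult_left bounded_linear_mult_right] .
  have "e * Y ^ n * e = (- Y) ^ n" for n
  proof (induction n)
    case (Suc n)
    have "e * Y ^ Suc n * e = (e * Y * e) * (e * Y ^ n * e)"
      using ee by (simp add: mult.assoc) (simp flip: mult.assoc)
    then show ?case using Suc eYe by simp
  qed (simp add: ee)
  then have "e * (Y ^ n /\<^sub>R fact n) * e = (- Y) ^ n /\<^sub>R fact n" for n by simp
  then have "e * U * e = U'"
    using bounded_linear.sums[OF bl exp_converges[of Y]] sums_unique2[OF _ exp_converges[of "- Y"]]
    by (simp add: U_def U'_def)
  then have Ue: "U * e = e * U'" using ee by (metis mult.assoc mult_1_left)
  have "f = 0" if f: "f \<in> S" "f \<in> orth T" for f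
  proof -
    have "cinner (app U' f) g = 0" if "g \<in> S" for g
      using f(2) UT that adjoint_pairD[OF adjoint_pair_sym[OF adjU], of f g] by (auto simp: in_orth_iff)
    then have U'f: "app U' f \<in> orth S" by (simp add: in_orth_iff)
    have "app e f = f" using f P(3)[of f] by (simp add: e_def app_simps)
    then have "app U f = app e (app U' f)" by (metis Ue app_simps(6))
    also have "\<dots> = - app U' f" using U'f P(4)[of "app U' f"] by (simp add: e_def app_simps)
    finally have "app U f \<in> orth S"
      using U'f hardy_subspace_orth hardy.subspace_neg by metis
    then have "app U f = 0" using f(1) UT assms(2) by blast
    then have "app (U' * U) f = 0" by (simp add: app_simps app_right_simps)
    moreover have "U' * U = 1" using exp_minus_inverse[of "- Y"] by (simp add: U_def U'_def)
    ultimately show ?thesis by (simp add: app_simps)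
  qed
  moreover have "0 \<in> S" "0 \<in> orth T"
    using S hardy_subspace_orth by (auto simp: Gr_def hardy.subspace_0)
  ultimately show ?thesis by blast
qed

section \<open>Almost biorthogonal families\<close>

definition szego :: "complex \<Rightarrow> hardy" where
  "szego z = (SOME k. \<forall>n. hcoeff k n = cnj z ^ n)"

lemma hcoeff_szego:
  assumes "norm z < 1" shows "hcoeff (szego z) n = cnj z ^ n"
proof -
  have "summable (\<lambda>n. ((cmod z)\<^sup>2) ^ n)"
    using assms by (intro summable_geometric) (simp add: abs_square_less_1)
  then have "summable (\<lambda>n. (cmod (cnj z ^ n))\<^sup>2)"
    by (simp add: norm_power power2_eq_square power_mult_distrib)
  from someI_ex[OF hcoeff_surj[OF this]] show ?thesis by (simp add: szego_def)
qed

lemma cinner_szego: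
  assumes "norm z < 1" shows "cinner f (szego z) = eval_hardy f z"
  using hcoeff_sums[OF assms, of f] by (simp add: cinner_def hcoeff_szego[OF assms] sums_iff)

lemma cinner_szego_szego:
  assumes "norm z < 1" "norm w < 1" shows "cinner (szego z) (szego w) = 1 / (1 - cnj z * w)"
proof -
  have "norm (cnj z * w) < 1"
    using assms mult_left_le[of "cmod w" "cmod z"] by (simp add: norm_mult)
  then have "(\<lambda>n. (cnj z * w) ^ n) sums (1 / (1 - cnj z * w))" by (rule geometric_sums)
  moreover have "(\<lambda>n. (cnj z * w) ^ n) sums cinner (szego z) (szego w)"
    using hcoeff_sums[OF assms(2), of "szego z"]
    by (simp add: cinner_szego[OF assms(2)] hcoeff_szego[OF assms(1)] power_mult_distrib)
  ultimately show ?thesis by (rule sums_unique2[symmetric])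
qed

lemma Zspace_eq_orth:
  assumes "a \<subseteq> ball 0 1" shows "Zspace a = orth (szego ` a)"
  using assms by (auto simp: Zspace_def in_orth_iff cinner_szego subset_iff)

lemma Zspace_in_Gr: "a \<subseteq> ball 0 1 \<Longrightarrow> Zspace a \<in> Gr"
  by (simp add: Zspace_eq_orth orth_in_Gr)

definition near_dual :: "(nat \<Rightarrow> hardy) \<Rightarrow> (nat \<Rightarrow> hardy) \<Rightarrow> bool" where
  "near_dual x y \<longleftrightarrow>
    (\<forall>i j. cmod (cinner (x j) (y i) - (if i = j then 1 else 0)) \<le> (1/2) ^ (i + j + 4))"

lemma cmod_hcoeff_le: "cmod (hcoeff f n) \<le> norm f"
proof -
  have "(cmod (hcoeff f n))\<^sup>2 \<le> (\<Sum>n. (cmod (hcoeff f n))\<^sup>2)"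
    using sum_le_suminf[OF summable_hcoeff, of "{n}" f] by simp
  then show ?thesis
    unfolding norm_hardy_sq[symmetric] by (simp add: power2_le_iff_abs_le)
qed

lemma near_dualD:
  "near_dual x y \<Longrightarrow> cmod (cinner (x j) (y i) - (if i = j then 1 else 0)) \<le> (1/2) ^ (i + j + 4)"
  by (simp add: near_dual_def)

lemma near_dual_sym: "near_dual x y \<Longrightarrow> near_dual y x"
  unfolding near_dual_def
proof safe
  fix i j
  assume *: "\<forall>i j. cmod (cinner (x j) (y i) - (if i = j then 1 else 0)) \<le> (1/2) ^ (i + j + 4)"
  have "cinner (y j) (x i) - (if i = j then 1 else 0) = cnj (cinner (x i) (y j) - (if j = i then 1 else 0))"
    by (subst cinner_commute) auto
  then have "cmod (cinner (y j) (x i) - (if i = j then 1 else 0)) = cmod (cinner (x i) (y j) - (if j = i then 1 else 0))"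
    by (simp only: complex_mod_cnj)
  then show "cmod (cinner (y j) (x i) - (if i = j then 1 else 0)) \<le> (1/2) ^ (i + j + 4)"
    using *[rule_format, of i j] by (simp only: add.commute)
qed

lemma near_dual_shift: "near_dual x x \<Longrightarrow> near_dual (\<lambda>i. x (i + m)) (\<lambda>i. x (i + m))"
  unfolding near_dual_def
proof safe
  fix i j
  assume *: "\<forall>i j. cmod (cinner (x j) (x i) - (if i = j then 1 else 0)) \<le> (1/2) ^ (i + j + 4)"
  have "((1/2)::real) ^ (i + m + (j + m) + 4) \<le> (1/2) ^ (i + j + 4)"
    by (rule power_decreasing) auto
  then show "cmod (cinner (x (j + m)) (x (i + m)) - (if i = j then 1 else 0)) \<le> (1/2) ^ (i + j + 4)"
    using *[rule_format, where i = "i + m" and j = "j + m"] unfolding add_right_cancel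
    by (rule order_trans[rotated])
qed

lemma power_half_add_4: "((1/2)::real) ^ (i + 4) = (1/2) ^ i / 16"
  unfolding power_add by (simp add: power4_eq_xxxx)

lemma sum_half_power_le: "finite F \<Longrightarrow> (\<Sum>j\<in>F. ((1/2)::real) ^ j) \<le> 2"
  using sum_le_suminf[of "\<lambda>j. ((1/2)::real) ^ j" F] suminf_geometric[of "(1/2)::real"] by simp

lemma norm_sum_near_dual_le:
  assumes nd: "near_dual x x" and F: "finite F"
  shows "(norm (\<Sum>j\<in>F. c j *\<^sub>C x j))\<^sup>2 \<le> 2 * (\<Sum>j\<in>F. (cmod (c j))\<^sup>2)"
proof -
  define r where "r = (\<Sum>j\<in>F. (cmod (c j))\<^sup>2)"
  define M where "M i j = cinner (x j) (x i) - (if i = j then 1 else 0)" for i j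
  have r: "r \<ge> 0" by (simp add: r_def sum_nonneg)
  have c: "cmod (c j) \<le> sqrt r" if "j \<in> F" for j
    unfolding r_def using F that by (intro real_le_rsqrt member_le_sum) auto
  let ?s = "\<Sum>j\<in>F. c j *\<^sub>C x j"
  have right: "cinner f ?s = (\<Sum>i\<in>F. cnj (c i) * cinner f (x i))" for f
    by (subst cinner_commute) (simp add: cinner_sum_left cinner_scaleC_left flip: cinner_commute)
  have diag: "(\<Sum>i\<in>F. c j * cnj (c i) * (if i = j then 1 else 0)) = of_real ((cmod (c j))\<^sup>2)"
    if "j \<in> F" for j
  proof -
    have "(\<Sum>i\<in>F. c j * cnj (c i) * (if i = j then 1 else 0)) = (\<Sum>i\<in>F. if i = j then c j * cnj (c j) else 0)"
      by (intro sum.cong) auto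
    then show ?thesis using F that by (simp add: complex_norm_square flip: of_real_power)
  qed
  have "complex_of_real ((norm ?s)\<^sup>2) = (\<Sum>j\<in>F. \<Sum>i\<in>F. c j * cnj (c i) * cinner (x j) (x i))"
    unfolding cinner_self[symmetric] cinner_sum_left cinner_scaleC_left
    unfolding right by (simp add: sum_distrib_left mult.assoc)
  also have "\<dots> = (\<Sum>j\<in>F. \<Sum>i\<in>F. c j * cnj (c i) * (if i = j then 1 else 0) + c j * cnj (c i) * M i j)"
    by (intro sum.cong refl) (simp add: M_def algebra_simps)
  also have "\<dots> = of_real r + (\<Sum>j\<in>F. \<Sum>i\<in>F. c j * cnj (c i) * M i j)"
    unfolding sum.distrib r_def by (simp add: diag)
  finally have "(norm ?s)\<^sup>2 = r + Re (\<Sum>j\<in>F. \<Sum>i\<in>F. c j * cnj (c i) * M i j)"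
    by (auto dest: arg_cong[where f = Re])
  also have "Re (\<Sum>j\<in>F. \<Sum>i\<in>F. c j * cnj (c i) * M i j) \<le> cmod (\<Sum>j\<in>F. \<Sum>i\<in>F. c j * cnj (c i) * M i j)"
    by (rule complex_Re_le_cmod)
  also have "\<dots> \<le> (\<Sum>j\<in>F. \<Sum>i\<in>F. (r / 16) * ((1/2) ^ j * (1/2) ^ i))"
  proof (intro sum_norm_le)
    fix i j assume ij: "j \<in> F" "i \<in> F"
    have "cmod (c j) * cmod (c i) * cmod (M i j) \<le> sqrt r * sqrt r * (1/2) ^ (i + j + 4)"
      using c[OF ij(1)] c[OF ij(2)] near_dualD[OF nd, of j i] r
      by (intro mult_mono) (auto simp: M_def)
    also have "sqrt r * sqrt r * (1/2) ^ (i + j + 4) = (r / 16) * ((1/2) ^ j * (1/2) ^ i)"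
      using r unfolding power_half_add_4 unfolding power_add by simp
    finally show "cmod (c j * cnj (c i) * M i j) \<le> (r / 16) * ((1/2) ^ j * (1/2) ^ i)"
      by (simp add: norm_mult)
  qed
  also have "\<dots> = (r / 16) * ((\<Sum>j\<in>F. (1/2) ^ j) * (\<Sum>i\<in>F. (1/2) ^ i))"
    unfolding sum_product by (simp only: sum_distrib_left)
  also have "\<dots> \<le> (r / 16) * (2 * 2)"
    using r sum_half_power_le[OF F] by (intro mult_left_mono mult_mono) (auto intro!: sum_nonneg)
  finally show ?thesis using r by (simp add: r_def[symmetric])
qed

lemma synthesis_exists:
  assumes nd: "near_dual x x"
  shows "\<exists>T. \<forall>f. (\<lambda>j. hcoeff f j *\<^sub>C x j) sums app T f"
proof -
  have sm: "summable (\<lambda>j. hcoeff f j *\<^sub>C x j)" for f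
    unfolding summable_Cauchy
  proof (intro allI impI)
    fix e :: real assume e: "e > 0"
    have "e\<^sup>2 / 2 > 0" using e by simp
    then obtain N where N: "\<And>m n. m \<ge> N \<Longrightarrow> norm (\<Sum>j=m..<n. (cmod (hcoeff f j))\<^sup>2) < e\<^sup>2 / 2"
      using summable_hcoeff[of f] unfolding summable_Cauchy by blast
    have "norm (\<Sum>j=m..<n. hcoeff f j *\<^sub>C x j) < e" if "m \<ge> N" for m n
    proof -
      have "(norm (\<Sum>j=m..<n. hcoeff f j *\<^sub>C x j))\<^sup>2 < e\<^sup>2"
        using norm_sum_near_dual_le[OF nd, of "{m..<n}" "hcoeff f"] N[OF that, of n] by simp
      then show ?thesis using e by (simp add: power2_less_imp_less)
    qed
    then show "\<exists>N. \<forall>m\<ge>N. \<forall>n. norm (\<Sum>j=m..<n. hcoeff f j *\<^sub>C x j) < e" by blast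
  qed
  define S where "S f = (\<Sum>j. hcoeff f j *\<^sub>C x j)" for f
  have S: "(\<lambda>j. hcoeff f j *\<^sub>C x j) sums S f" for f
    unfolding S_def by (rule summable_sums[OF sm])
  have add: "S (f + g) = S f + S g" for f g
    using sums_add[OF S S, of f g] S[of "f + g"] sums_unique2 by (simp add: hardy.scale_left_distrib)
  have scale: "S (c *\<^sub>C f) = c *\<^sub>C S f" for c f
  proof (rule sums_unique2[OF S])
    show "(\<lambda>j. hcoeff (c *\<^sub>C f) j *\<^sub>C x j) sums (c *\<^sub>C S f)"
      using bounded_linear.sums[OF bounded_linear_scaleC S, of c f] by simp
  qed
  have "norm (S f) \<le> sqrt 2 * norm f" for f
  proof (rule LIMSEQ_le_const2)
    show "(\<lambda>n. norm (\<Sum>j<n. hcoeff f j *\<^sub>C x j)) \<longlonglongrightarrow> norm (S f)"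
      using S[of f] unfolding sums_def by (rule tendsto_norm)
    have "norm (\<Sum>j<n. hcoeff f j *\<^sub>C x j) \<le> sqrt 2 * norm f" for n
    proof -
      have "(\<Sum>j<n. (cmod (hcoeff f j))\<^sup>2) \<le> (norm f)\<^sup>2"
        unfolding norm_hardy_sq by (intro sum_le_suminf summable_hcoeff) auto
      then have "(norm (\<Sum>j<n. hcoeff f j *\<^sub>C x j))\<^sup>2 \<le> (sqrt 2 * norm f)\<^sup>2"
        using norm_sum_near_dual_le[OF nd, of "{..<n}" "hcoeff f"] by (simp add: power_mult_distrib)
      then show ?thesis by (rule power2_le_imp_le) simp
    qed
    then show "\<exists>N. \<forall>n\<ge>N. norm (\<Sum>j<n. hcoeff f j *\<^sub>C x j) \<le> sqrt 2 * norm f" by blast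
  qed
  then obtain T where "app T = S" using hop_obtain[of S, OF add scale] by blast
  then show ?thesis using S by auto
qed

lemma analysis_exists:
  assumes nd: "near_dual x x"
  shows "\<exists>A. \<forall>f i. hcoeff (app A f) i = cinner f (x i)"
proof -
  have bessel: "(\<Sum>i<n. (cmod (cinner f (x i)))\<^sup>2) \<le> 2 * (norm f)\<^sup>2" for f n
  proof -
    let ?s = "\<Sum>i<n. cinner f (x i) *\<^sub>C x i" and ?r = "\<Sum>i<n. (cmod (cinner f (x i)))\<^sup>2"
    have r: "?r \<ge> 0" by (simp add: sum_nonneg)
    have "cinner ?s f = (\<Sum>i<n. of_real ((cmod (cinner f (x i)))\<^sup>2))"
      unfolding cinner_sum_left cinner_scaleC_left complex_norm_square
      by (intro sum.cong refl arg_cong2[where f = times] cinner_commute)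
    then have "?r = cmod (cinner ?s f)" using r by (simp flip: of_real_sum of_real_power)
    also have "\<dots> \<le> norm ?s * norm f" by (rule norm_cinner_le)
    finally have "?r\<^sup>2 \<le> (norm ?s * norm f)\<^sup>2" using r by (intro power_mono)
    also have "\<dots> \<le> 2 * ?r * (norm f)\<^sup>2"
      unfolding power_mult_distrib
      using norm_sum_near_dual_le[OF nd, of "{..<n}"] by (intro mult_right_mono) auto
    finally have "?r * ?r \<le> ?r * (2 * (norm f)\<^sup>2)" by (simp add: power2_eq_square mult_ac)
    then show ?thesis using r by (cases "?r = 0") (auto simp: mult_le_cancel_left)
  qed
  have sm: "summable (\<lambda>i. (cmod (cinner f (x i)))\<^sup>2)" for f
    using bessel[of f] by (intro summableI_nonneg_bounded) auto
  then obtain A where A: "\<And>f i. hcoeff (A f) i = cinner f (x i)"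
    using hcoeff_surj[OF sm] by metis
  have "norm (A f) \<le> sqrt 2 * norm f" for f
  proof (rule power2_le_imp_le)
    show "(norm (A f))\<^sup>2 \<le> (sqrt 2 * norm f)\<^sup>2"
      unfolding norm_hardy_sq[of "A f"] A power_mult_distrib
      using suminf_le_const[OF sm bessel] by simp
  qed simp
  then obtain T where "app T = A"
    using hop_obtain[of A] by (metis (mono_tags, lifting) A cinner_add_left cinner_scaleC_left hardy_eqI hcoeff_add hcoeff_scaleC)
  then show ?thesis using A by auto
qed

lemma cinner_synthesis:
  assumes "(\<lambda>j. hcoeff f j *\<^sub>C x j) sums s"
  shows "(\<lambda>j. hcoeff f j * cinner (x j) g) sums cinner s g"
  using bounded_linear.sums[OF bounded_linear_cinner_left assms, of g] by (simp add: cinner_scaleC_left)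

lemma analysis_synthesis_near_identity:
  assumes nd: "near_dual x y"
    and T: "\<And>f. (\<lambda>j. hcoeff f j *\<^sub>C x j) sums app T f"
    and A: "\<And>f i. hcoeff (app A f) i = cinner f (y i)"
  shows "norm (1 - A * T) \<le> 1 / 2"
proof (rule norm_hop_le)
  fix f
  define M where "M i j = cinner (x j) (y i) - (if i = j then 1 else 0)" for i j
  have coeff: "cmod (hcoeff (app (1 - A * T) f) i) \<le> (1/8) * norm f * (1/2) ^ i" for i
  proof -
    have "(\<lambda>j. if j = i then hcoeff f j else 0) sums hcoeff f i"
      by (rule sums_single)
    from sums_diff[OF cinner_synthesis[OF T, of f "y i"] this]
    have "(\<lambda>j. hcoeff f j * M i j) sums (cinner (app T f) (y i) - hcoeff f i)"
      by (rule sums_cong[THEN iffD1, rotated]) (auto simp: M_def algebra_simps)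
    then have s: "(\<lambda>j. hcoeff f j * M i j) sums - hcoeff (app (1 - A * T) f) i"
      by (simp add: app_simps A)
    have le: "norm (hcoeff f j * M i j) \<le> norm f * (1/2) ^ (i + 4) * (1/2) ^ j" for j
    proof -
      have "cmod (hcoeff f j) * cmod (M i j) \<le> norm f * (1/2) ^ (i + j + 4)"
        using near_dualD[OF nd, of j i] cmod_hcoeff_le[of f j]
        by (intro mult_mono) (auto simp: M_def)
      then show ?thesis by (simp add: norm_mult power_add mult_ac)
    qed
    have g: "(\<lambda>j. norm f * (1/2) ^ (i + 4) * (1/2) ^ j) sums (norm f * (1/2) ^ (i + 4) * 2)"
      using sums_mult[OF geometric_sums[of "1/2::real"], of "norm f * (1/2) ^ (i + 4)"] by simp
    have "norm (\<Sum>j. hcoeff f j * M i j) \<le> (\<Sum>j. norm f * (1/2) ^ (i + 4) * (1/2) ^ j)"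
      using g le by (intro norm_suminf_le) (auto simp: sums_iff)
    then show ?thesis using s g by (simp add: sums_iff power_half_add_4)
  qed
  have g: "(\<lambda>i. ((1/8) * norm f)\<^sup>2 * (1/4) ^ i) sums (((1/8) * norm f)\<^sup>2 * (4/3))"
    using sums_mult[OF geometric_sums[of "1/4::real"], of "((1/8) * norm f)\<^sup>2"] by simp
  have "(norm (app (1 - A * T) f))\<^sup>2 \<le> (\<Sum>i. ((1/8) * norm f)\<^sup>2 * (1/4) ^ i)"
    unfolding norm_hardy_sq
  proof (intro suminf_le summable_hcoeff)
    show "(cmod (hcoeff (app (1 - A * T) f) i))\<^sup>2 \<le> ((1/8) * norm f)\<^sup>2 * (1/4) ^ i" for i
    proof -
      have "(cmod (hcoeff (app (1 - A * T) f) i))\<^sup>2 \<le> ((1/8) * norm f * (1/2) ^ i)\<^sup>2"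
        by (intro power_mono coeff) auto
      also have "((1/2) ^ i)\<^sup>2 = ((1/4)::real) ^ i"
        by (simp add: power2_eq_square flip: power_mult_distrib)
      then have "((1/8) * norm f * (1/2) ^ i)\<^sup>2 = ((1/8) * norm f)\<^sup>2 * (1/4) ^ i"
        by (simp only: power_mult_distrib)
      finally show ?thesis .
    qed
    show "summable (\<lambda>i. ((1/8) * norm f)\<^sup>2 * (1/4) ^ i)" using g by (simp add: sums_iff)
  qed
  also have "\<dots> = (1/48) * (norm f)\<^sup>2" using g by (simp add: sums_iff power2_eq_square)
  also have "\<dots> \<le> (1/2 * norm f)\<^sup>2" by (simp add: power_mult_distrib power2_eq_square)
  finally show "norm (app (1 - A * T) f) \<le> 1/2 * norm f"
    by (rule power2_le_imp_le) simp
qed simp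

lemma has_hardy_dim_0_iff: "has_hardy_dim S 0 \<longleftrightarrow> S = {0}"
  by (auto simp: has_hardy_dim_def hardy.independent_empty)

lemma has_hardy_dim_of_zero: "has_hardy_dim {0} m \<Longrightarrow> m = 0"
proof -
  assume "has_hardy_dim {0} m"
  then obtain B where B: "finite B" "card B = m" "\<not> hardy_dependent B" "hardy_span B = {0}"
    by (auto simp: has_hardy_dim_def)
  have "B \<subseteq> {0}" using hardy.span_superset[of B] B(4) by simp
  then have "B = {}" using B(3) hardy.dependent_zero[of B] by blast
  then show "m = 0" using B(2) by simp
qed

lemma has_hardy_dim_family:
  assumes span: "hardy_span (u ` {..<m}) = S"
    and indep: "\<And>c. (\<Sum>i<m. c i *\<^sub>C u i) = 0 \<Longrightarrow> \<forall>i<m. c i = 0"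
  shows "has_hardy_dim S m"
proof -
  have inj: "inj_on u {..<m}"
  proof (rule inj_onI, rule ccontr)
    fix i j assume ij: "i \<in> {..<m}" "j \<in> {..<m}" "u i = u j" "i \<noteq> j"
    define c where "c k = (if k = i then 1 else if k = j then -1 else 0 :: complex)" for k
    have "(\<Sum>k<m. c k *\<^sub>C u k) = (\<Sum>k\<in>{i, j}. c k *\<^sub>C u k)"
      using ij by (intro sum.mono_neutral_right) (auto simp: c_def)
    also have "\<dots> = 0" using ij by (simp add: c_def)
    finally show False using indep[of c] ij by (auto simp: c_def)
  qed
  have "\<not> hardy_dependent (u ` {..<m})"
  proof
    assume "hardy_dependent (u ` {..<m})"
    then obtain d v where d: "v \<in> u ` {..<m}" "d v \<noteq> 0" "(\<Sum>v\<in>u ` {..<m}. d v *\<^sub>C v) = 0"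
      by (subst (asm) hardy.dependent_finite) auto
    then have "(\<Sum>i<m. d (u i) *\<^sub>C u i) = 0" by (simp add: sum.reindex[OF inj])
    then show False using indep[of "\<lambda>i. d (u i)"] d(1,2) by auto
  qed
  then show ?thesis
    using span card_image[OF inj] by (auto simp: has_hardy_dim_def intro!: exI[of _ "u ` {..<m}"])
qed

lemma near_dual_biorthogonal:
  assumes xy: "near_dual x y"
    and T: "\<And>f. (\<lambda>j. hcoeff f j *\<^sub>C x j) sums app T f"
    and A: "\<And>f i. hcoeff (app A f) i = cinner f (y i)"
  obtains G where "A * T * G = 1" "G * (A * T) = 1"
proof -
  have "norm (1 - A * T) \<le> 1 / 2"
    using analysis_synthesis_near_identity[OF xy] T A by blast
  from Neumann_inverse[OF this] show thesis using that by auto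
qed

lemma orth_orth_near_dual:
  assumes nd: "near_dual x x" and T: "\<And>f. (\<lambda>j. hcoeff f j *\<^sub>C x j) sums app T f"
  shows "orth (orth (range x)) = range (app T)"
proof -
  obtain A where A: "\<And>f i. hcoeff (app A f) i = cinner f (x i)" using analysis_exists[OF nd] by blast
  obtain G where G: "G * (A * T) = 1" using near_dual_biorthogonal[OF nd T A] by blast
  have adj: "cinner (app T f) g = cinner f (app A g)" for f g
  proof (rule sums_unique2)
    show "(\<lambda>j. hcoeff f j * cinner (x j) g) sums cinner (app T f) g" by (rule cinner_synthesis[OF T])
    have "cnj (hcoeff (app A g) j) = cinner (x j) g" for j by (metis A cinner_commute)
    then show "(\<lambda>j. hcoeff f j * cinner (x j) g) sums cinner f (app A g)"
      unfolding cinner_def[of f] using summable_sums[OF summable_cinner[of f "app A g"]] by simp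
  qed
  have "range (app T) = {f. app (T * G * A) f = f}"
  proof safe
    fix f
    have "T * G * A * T = T" using G by (simp add: mult.assoc)
    then show "app (T * G * A) (app T f) = app T f" by (metis app_simps(6))
  next
    fix f assume "app (T * G * A) f = f"
    then show "f \<in> range (app T)" by (metis app_simps(6) mult.assoc rangeI)
  qed
  moreover have "closed {f. app (T * G * A) f = f}"
    by (intro closed_Collect_eq linear_continuous_on bounded_linear_app continuous_on_id)
  moreover have "hardy_subspace {f. app (T * G * A) f = f}"
    by (simp add: hardy.subspace_def app_right_simps app_simps(8))
  ultimately have "range (app T) \<in> Gr" by (simp add: Gr_def)
  moreover have "orth (range x) = orth (range (app T))"
  proof -
    have "f \<in> orth (range x) \<longleftrightarrow> app A f = 0" for f
      using hardy_eqI[of "app A f" 0] by (auto simp: in_orth_iff A[symmetric])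
    moreover have "f \<in> orth (range (app T)) \<longleftrightarrow> app A f = 0" for f
      by (auto simp: in_orth_iff' adj) (metis cinner_self_eq_0)
    ultimately show ?thesis by blast
  qed
  ultimately show ?thesis by (simp add: orth_orth)
qed

lemma hcoeff_prepend:
  "\<exists>g. (\<forall>n<m. hcoeff g n = c n) \<and> (\<forall>n. hcoeff g (n + m) = hcoeff h n)"
proof -
  let ?d = "\<lambda>n. if n < m then c n else hcoeff h (n - m)"
  have "summable (\<lambda>n. (cmod (?d (n + m)))\<^sup>2)" using summable_hcoeff[of h] by simp
  then have "summable (\<lambda>n. (cmod (?d n))\<^sup>2)"
    using summable_iff_shift[of "\<lambda>n. (cmod (?d n))\<^sup>2" m] by blast
  from hcoeff_surj[OF this] obtain g where "\<forall>n. hcoeff g n = ?d n" by blast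
  then show ?thesis by (intro exI[of _ g]) simp
qed

lemma hcoeff_drop: "\<exists>h. \<forall>n. hcoeff h n = hcoeff g (n + m)"
  by (rule hcoeff_surj) (use summable_hcoeff[of g] in \<open>simp add: summable_iff_shift[of "\<lambda>n. (cmod (hcoeff g n))\<^sup>2"]\<close>)

text \<open>If \<open>x\<close> is nearly biorthogonal to \<open>y\<close> without its first \<open>m\<close> vectors, then those \<open>m\<close>
  vectors, corrected by combinations of the others, span the intersection.\<close>

theorem near_dual_intersections:
  assumes xx: "near_dual x x" and yy: "near_dual y y" and xy: "near_dual x (\<lambda>i. y (i + m))"
  shows "orth (orth (range x)) \<inter> orth (range y) = {0}"
    and "has_hardy_dim (orth (range x) \<inter> orth (orth (range y))) m"
proof -
  let ?z = "\<lambda>i. y (i + m)"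
  have zz: "near_dual ?z ?z" by (rule near_dual_shift[OF yy])
  obtain Tx where Tx: "\<And>f. (\<lambda>j. hcoeff f j *\<^sub>C x j) sums app Tx f"
    using synthesis_exists[OF xx] by blast
  obtain Ty where Ty: "\<And>f. (\<lambda>j. hcoeff f j *\<^sub>C y j) sums app Ty f"
    using synthesis_exists[OF yy] by blast
  obtain Tz where Tz: "\<And>f. (\<lambda>j. hcoeff f j *\<^sub>C ?z j) sums app Tz f"
    using synthesis_exists[OF zz] by blast
  obtain Ax where Ax: "\<And>f i. hcoeff (app Ax f) i = cinner f (x i)" using analysis_exists[OF xx] by blast
  obtain Ay where Ay: "\<And>f i. hcoeff (app Ay f) i = cinner f (y i)" using analysis_exists[OF yy] by blast
  obtain Az where Az: "\<And>f i. hcoeff (app Az f) i = cinner f (?z i)" using analysis_exists[OF zz] by blast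
  note Ox = orth_orth_near_dual[OF xx Tx] and Oy = orth_orth_near_dual[OF yy Ty]
  show "orth (orth (range x)) \<inter> orth (range y) = {0}"
  proof safe
    fix f assume f: "f \<in> orth (orth (range x))" "f \<in> orth (range y)"
    obtain G where G: "G * (Az * Tx) = 1" using near_dual_biorthogonal[OF xy Tx Az] by blast
    obtain g where g: "f = app Tx g" using f(1) Ox by blast
    have "app Az f = 0" using f(2) by (intro hardy_eqI) (auto simp: Az in_orth_iff)
    then have "app (G * (Az * Tx)) g = 0" by (simp add: app_simps app_right_simps g)
    then show "f = 0" by (simp add: G app_simps g app_right_simps)
  qed (auto simp: in_orth_iff)
  show "has_hardy_dim (orth (range x) \<inter> orth (orth (range y))) m"
  proof -
    obtain G where G: "Ax * Tz * G = 1" "G * (Ax * Tz) = 1"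
      using near_dual_biorthogonal[OF near_dual_sym[OF xy] Tz Ax] by blast
    obtain H where H: "H * (Ay * Ty) = 1" using near_dual_biorthogonal[OF yy Ty Ay] by blast
    have split: "app Ty g = (\<Sum>i<m. hcoeff g i *\<^sub>C y i) + app Tz h"
      if "\<And>n. hcoeff h n = hcoeff g (n + m)" for g h
    proof -
      have "(\<lambda>n. hcoeff g (n + m) *\<^sub>C y (n + m)) sums (app Ty g - (\<Sum>i<m. hcoeff g i *\<^sub>C y i))"
        by (rule sums_split_initial_segment[OF Ty])
      then have "app Ty g - (\<Sum>i<m. hcoeff g i *\<^sub>C y i) = app Tz h"
        using Tz[of h] unfolding that by (rule sums_unique2)
      then show ?thesis by (simp add: algebra_simps)
    qed
    define u where "u i = y i - app (Tz * G * Ax) (y i)" for i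
    have sum_u: "(\<Sum>i<m. c i *\<^sub>C u i) = (\<Sum>i<m. c i *\<^sub>C y i) - app (Tz * G * Ax) (\<Sum>i<m. c i *\<^sub>C y i)" for c
      unfolding linear_sum[OF bounded_linear.linear[OF bounded_linear_app]]
      by (simp add: u_def hardy.scale_right_diff_distrib sum_subtractf app_simps(8))
    have S: "hardy_subspace (orth (range x) \<inter> orth (orth (range y)))"
      by (intro hardy.subspace_inter hardy_subspace_orth)
    show ?thesis
    proof (rule has_hardy_dim_family[of u])
      show "\<forall>i<m. c i = 0" if c: "(\<Sum>i<m. c i *\<^sub>C u i) = 0" for c
      proof -
        define h where "h = - app (G * Ax) (\<Sum>i<m. c i *\<^sub>C y i)"
        obtain g where g: "\<And>n. n < m \<Longrightarrow> hcoeff g n = c n" "\<And>n. hcoeff g (n + m) = hcoeff h n"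
          using hcoeff_prepend[of m c h] by blast
        have "app Ty g = (\<Sum>i<m. c i *\<^sub>C y i) + app Tz h"
          using split[of h g] g by simp
        also have "\<dots> = 0" using c unfolding sum_u h_def app_right_simps app_simps by simp
        finally have "app (H * (Ay * Ty)) g = 0" by (simp add: app_simps app_right_simps)
        then have "g = 0" by (simp add: H app_simps)
        then show ?thesis using g(1) by auto
      qed
      show "hardy_span (u ` {..<m}) = orth (range x) \<inter> orth (orth (range y))"
      proof (rule antisym)
        have "u i \<in> orth (range x) \<inter> orth (orth (range y))" for i
        proof
          have "Ax - Ax * (Tz * G * Ax) = 0" using G(1) by (simp flip: mult.assoc)
          then have "app (Ax - Ax * (Tz * G * Ax)) (y i) = 0" by (simp only: app_simps(1))
          then have "app Ax (u i) = 0" by (simp add: u_def app_simps app_right_simps)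
          then show "u i \<in> orth (range x)" by (auto simp: in_orth_iff Ax[symmetric])
          have "y i \<in> orth (orth (range y))" using subset_orth_orth[of "range y"] by blast
          moreover have "app Tz f \<in> orth (orth (range y))" for f
            unfolding in_orth_iff
          proof
            fix g assume g: "g \<in> orth (range y)"
            then have "(\<lambda>j. hcoeff f j * cinner (?z j) g) = (\<lambda>j. 0)" by (auto simp: in_orth_iff')
            then show "cinner (app Tz f) g = 0"
              using cinner_synthesis[OF Tz, of f g] sums_unique2[OF _ sums_zero] by metis
          qed
          ultimately show "u i \<in> orth (orth (range y))"
            unfolding u_def app_simps(6) using hardy.subspace_diff[OF hardy_subspace_orth] by blast
        qed
        then show "hardy_span (u ` {..<m}) \<subseteq> orth (range x) \<inter> orth (orth (range y))"
          by (intro hardy.span_minimal S) auto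
        show "orth (range x) \<inter> orth (orth (range y)) \<subseteq> hardy_span (u ` {..<m})"
        proof
          fix f assume f: "f \<in> orth (range x) \<inter> orth (orth (range y))"
          then obtain g where g: "f = app Ty g" using Oy by blast
          obtain h where h: "\<And>n. hcoeff h n = hcoeff g (n + m)" using hcoeff_drop by blast
          let ?s = "\<Sum>i<m. hcoeff g i *\<^sub>C y i"
          have fs: "f = ?s + app Tz h" using split[OF h] g by simp
          have "app Ax f = 0" using f by (intro hardy_eqI) (auto simp: Ax in_orth_iff)
          then have "app Ax ?s + app (Ax * Tz) h = 0" by (simp add: fs app_simps app_right_simps)
          then have "app G (app Ax ?s + app (Ax * Tz) h) = 0" by (simp only: app_right_simps)
          then have "app (G * Ax) ?s + app (G * (Ax * Tz)) h = 0" by (simp add: app_simps app_right_simps)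
          then have "h = - app (G * Ax) ?s" unfolding G(2) app_simps(2) by (simp add: eq_neg_iff_add_eq_0 add.commute)
          then have "f = (\<Sum>i<m. hcoeff g i *\<^sub>C u i)"
            unfolding sum_u fs by (simp add: app_simps app_right_simps)
          also have "\<dots> \<in> hardy_span (u ` {..<m})"
            by (intro hardy.span_sum hardy.span_scale hardy.span_base) auto
          finally show "f \<in> hardy_span (u ` {..<m})" .
        qed
      qed
    qed
  qed
qed


section \<open>Rapidly converging real points\<close>

definition unit_szego :: "real \<Rightarrow> hardy" where
  "unit_szego r = sqrt (1 - r\<^sup>2) *\<^sub>R szego (of_real r)"

definition szego_gram :: "real \<Rightarrow> real \<Rightarrow> real" where
  "szego_gram r s = sqrt (1 - r\<^sup>2) * sqrt (1 - s\<^sup>2) / (1 - r * s)"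

lemma cinner_unit_szego:
  assumes "\<bar>r\<bar> < 1" "\<bar>s\<bar> < 1"
  shows "cinner (unit_szego r) (unit_szego s) = of_real (szego_gram r s)"
  using assms
  by (simp add: unit_szego_def szego_gram_def cinner_simps cinner_szego_szego scaleR_conv_of_real)

lemma szego_gram_sym: "szego_gram r s = szego_gram s r"
  by (simp add: szego_gram_def mult.commute)

lemma szego_gram_self: "\<bar>r\<bar> < 1 \<Longrightarrow> szego_gram r r = 1"
  using abs_square_less_1[of r] by (simp add: szego_gram_def power2_eq_square)

lemma szego_gram_nonneg: "\<bar>r\<bar> < 1 \<Longrightarrow> \<bar>s\<bar> < 1 \<Longrightarrow> szego_gram r s \<ge> 0"
  using abs_mult_less[of r 1 s 1] abs_ge_self[of "r * s"] abs_square_less_1[of r] abs_square_less_1[of s]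
  unfolding szego_gram_def by (intro divide_nonneg_nonneg mult_nonneg_nonneg) (auto simp: abs_mult)

lemma szego_gram_square:
  fixes u v :: real
  assumes "0 < u" "u < 1" "0 < v" "v < 1"
  shows "(szego_gram (1 - u) (1 - v))\<^sup>2 = u * (2 - u) * (v * (2 - v)) / (u + v - u * v)\<^sup>2"
proof -
  have 1: "1 - (1 - u)\<^sup>2 = u * (2 - u)" "1 - (1 - v)\<^sup>2 = v * (2 - v)" "1 - (1 - u) * (1 - v) = u + v - u * v"
    by (simp_all add: power2_eq_square algebra_simps)
  show ?thesis
    unfolding szego_gram_def 1 power_divide power_mult_distrib using assms by simp
qed

lemma szego_gram_far_le:
  fixes u v :: real
  assumes "0 < u" "u < 1" "0 < v" "v < 1" "4 * v / u \<le> e\<^sup>2" "0 \<le> e"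
  shows "szego_gram (1 - u) (1 - v) \<le> e"
proof (rule power2_le_imp_le)
  have "u * v \<le> 1 * v" using assms by (intro mult_right_mono) auto
  then have "u \<le> u + v - u * v" by simp
  then have "u\<^sup>2 \<le> (u + v - u * v)\<^sup>2" using assms by (intro power_mono) auto
  moreover have "u * (2 - u) * (v * (2 - v)) \<le> (u * 2) * (v * 2)"
    using assms by (intro mult_mono) auto
  ultimately have "u * (2 - u) * (v * (2 - v)) / (u + v - u * v)\<^sup>2 \<le> (u * 2) * (v * 2) / u\<^sup>2"
    using assms by (intro frac_le) auto
  also have "\<dots> = 4 * v / u" using assms by (simp add: power2_eq_square)
  finally show "(szego_gram (1 - u) (1 - v))\<^sup>2 \<le> e\<^sup>2"
    using assms szego_gram_square[of u v] by simp
qed fact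

lemma szego_gram_near_le:
  fixes u v :: real
  assumes "0 < u" "u < 1" "0 < v" "v \<le> u" "u - v \<le> d * u"
  shows "\<bar>szego_gram (1 - u) (1 - v) - 1\<bar> \<le> d\<^sup>2"
proof -
  define g where "g = szego_gram (1 - u) (1 - v)"
  define w where "w = u + v - u * v"
  have "u * v \<le> 1 * v" using assms by (intro mult_right_mono) auto
  then have w: "u \<le> w" "w > 0" using assms unfolding w_def by linarith+
  have "u * (2 - u) * (v * (2 - v)) = w\<^sup>2 - (u - v)\<^sup>2"
    by (simp add: w_def power2_eq_square algebra_simps)
  then have "g\<^sup>2 = (w\<^sup>2 - (u - v)\<^sup>2) / w\<^sup>2"
    using szego_gram_square[of u v] assms by (simp add: g_def w_def)
  then have g2: "1 - g\<^sup>2 = ((u - v) / w)\<^sup>2"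
    using w(2) unfolding power_divide diff_divide_distrib[of "w\<^sup>2"] by simp
  have "g \<ge> 0" unfolding g_def using assms by (intro szego_gram_nonneg) auto
  have "g\<^sup>2 \<le> 1" using g2 by (metis diff_ge_0_iff_ge zero_le_power2)
  then have g1: "g \<le> 1" using \<open>g \<ge> 0\<close> by (simp add: abs_square_le_1)
  have "(u - v) / w \<le> d"
  proof -
    have "(u - v) / w \<le> (u - v) / u" using assms w by (intro divide_left_mono) auto
    also have "\<dots> \<le> d" using assms by (simp add: divide_le_eq)
    finally show ?thesis .
  qed
  moreover have "0 \<le> (u - v) / w" using assms w by simp
  ultimately have "1 - g\<^sup>2 \<le> d\<^sup>2" unfolding g2 by (intro power_mono)
  moreover have "g\<^sup>2 \<le> g" using g1 \<open>g \<ge> 0\<close> by (simp add: power2_eq_square mult_left_le)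
  ultimately show ?thesis using g1 by (simp add: g_def[symmetric])
qed

lemma Zspace_range_real:
  assumes "\<And>j::nat. \<bar>r j\<bar> < 1"
  shows "Zspace (range (\<lambda>j. complex_of_real (r j))) = orth (range (\<lambda>j. unit_szego (r j)))"
proof -
  have "range (\<lambda>j. complex_of_real (r j)) \<subseteq> ball 0 1" using assms by auto
  moreover have "sqrt (1 - (r j)\<^sup>2) \<noteq> 0" for j using abs_square_less_1[of "r j"] assms[of j] by simp
  ultimately show ?thesis
    by (auto simp: Zspace_eq_orth in_orth_iff unit_szego_def cinner_scaleR_right simp del: real_sqrt_eq_zero_cancel_iff)
qed

lemma limit_set_range:
  assumes "\<And>j::nat. r j \<noteq> 1" "r \<longlonglongrightarrow> (1::real)"
  shows "limit_set (range (\<lambda>j. complex_of_real (r j))) = {1}"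
proof -
  let ?z = "\<lambda>j. complex_of_real (r j)"
  have z: "?z \<longlonglongrightarrow> 1" using tendsto_of_real[OF assms(2), where 'a = complex] by simp
  have "closed (insert 1 (range ?z))"
    by (intro compact_imp_closed compact_sequence_with_limit z)
  then have "closure (range ?z) \<subseteq> insert 1 (range ?z)" by (intro closure_minimal) auto
  moreover have "1 \<in> closure (range ?z)"
    unfolding closure_sequential by (intro exI[of _ ?z] conjI allI rangeI z)
  moreover have "?z j \<noteq> 1" for j using assms(1)[of j] by simp
  then have "1 \<notin> range ?z" by force
  moreover have "C - R = {1}" if "C \<subseteq> insert 1 R" "1 \<in> C" "1 \<notin> R" for C R :: "complex set"
    using that by blast
  ultimately show ?thesis unfolding limit_set_def by blast
qed

lemma blaschke_condition_range:
  assumes "inj r" "\<And>j::nat. 0 \<le> r j" "\<And>j. r j \<le> 1" "summable (\<lambda>j. 1 - r j)"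
  shows "blaschke_condition (range (\<lambda>j. complex_of_real (r j)))"
proof -
  have "inj (\<lambda>j. complex_of_real (r j))" using assms(1) by (simp add: inj_def)
  moreover have "(\<lambda>j. 1 - r j) summable_on UNIV"
    by (rule norm_summable_imp_summable_on) (use assms in simp)
  ultimately show ?thesis
    unfolding blaschke_condition_def by (subst summable_on_reindex) (use assms in \<open>auto simp: o_def\<close>)
qed

text \<open>The distances to \<open>1\<close> decrease so fast that distinct normalised kernels are almost orthogonal,
  while the factor of \<open>paired_gap\<close> keeps the kernels at \<open>1 - paired_gap m j\<close> and \<open>1 - gap (j + m)\<close> close together.\<close>

definition gap :: "nat \<Rightarrow> real" where "gap n = (1/2) ^ (14 * n\<^sup>2 + 1)"
definition paired_gap :: "nat \<Rightarrow> nat \<Rightarrow> real" where "paired_gap m j = gap (j + m) * (1 - (1/2) ^ (j + 2))"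

lemma gap_bounds: "0 < gap n" "gap n \<le> 1/2"
proof -
  show "gap n \<le> 1/2" using power_decreasing[of 1 "14 * n\<^sup>2 + 1" "1/2::real"] by (simp add: gap_def)
qed (simp add: gap_def)

lemma gap_ratio:
  assumes "n < k" shows "gap k \<le> gap n * (1/2) ^ (14 * (n + k))"
proof -
  have "n\<^sup>2 + (n + k) \<le> k\<^sup>2"
  proof -
    obtain d where "k = Suc (n + d)" using less_imp_Suc_add[OF assms] by blast
    then show ?thesis by (simp add: power2_eq_square algebra_simps)
  qed
  then have "14 * n\<^sup>2 + 1 + 14 * (n + k) \<le> 14 * k\<^sup>2 + 1" by simp
  then show ?thesis unfolding gap_def power_add[symmetric] by (intro power_decreasing) auto
qed

lemma gap_less: "n < k \<Longrightarrow> gap k \<le> gap n / 2"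
proof -
  assume "n < k"
  then have "gap k \<le> gap n * (1/2) ^ (14 * (n + k))" by (rule gap_ratio)
  also have "\<dots> \<le> gap n * (1/2) ^ 1"
    using \<open>n < k\<close> gap_bounds(1)[of n] by (intro mult_left_mono power_decreasing) auto
  finally show ?thesis by simp
qed

lemma paired_gap_bounds: "gap (j + m) * (3/4) \<le> paired_gap m j" "paired_gap m j < gap (j + m)" "0 < paired_gap m j" "paired_gap m j \<le> 1/2"
proof -
  define p :: real where "p = (1/2) ^ (j + 2)"
  have "p \<le> (1/2) ^ 2" unfolding p_def by (rule power_decreasing) auto
  then have p: "0 < p" "3/4 \<le> 1 - p" by (simp_all add: p_def power2_eq_square)
  have t: "0 < gap (j + m)" "gap (j + m) \<le> 1/2" by (rule gap_bounds)+
  have paired_gap: "paired_gap m j = gap (j + m) * (1 - p)" by (simp add: paired_gap_def p_def)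
  show 1: "gap (j + m) * (3/4) \<le> paired_gap m j"
    unfolding paired_gap using t p by (intro mult_left_mono) auto
  then show "0 < paired_gap m j" using t by linarith
  have "0 < gap (j + m) * p" using t p by simp
  then show "paired_gap m j < gap (j + m)" unfolding paired_gap right_diff_distrib by linarith
  then show "paired_gap m j \<le> 1/2" using t by linarith
qed

lemma szego_gram_gap_le:
  assumes "n < k" "gap n * (3/4) \<le> u" "u \<le> gap n" "0 < v" "v \<le> gap k"
  shows "szego_gram (1 - u) (1 - v) \<le> (1/2) ^ (n + k + 4)"
proof (rule szego_gram_far_le)
  show "0 < u" "u < 1" "0 < v" "v < 1"
    using assms gap_bounds[of n] gap_bounds[of k] by linarith+
  have "v \<le> gap n * (1/2) ^ (14 * (n + k))" using gap_ratio[OF assms(1)] assms(5) by linarith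
  also have "\<dots> \<le> (4/3 * u) * (1/2) ^ (14 * (n + k))" using assms(2) by (intro mult_right_mono) auto
  finally have "4 * v / u \<le> (16/3) * (1/2) ^ (14 * (n + k))"
    using \<open>0 < u\<close> by (simp add: divide_le_eq)
  also have "\<dots> \<le> 2 ^ 3 * (1/2) ^ (14 * (n + k))" by (intro mult_right_mono) auto
  also have "\<dots> \<le> 2 ^ 3 * (1/2) ^ (2 * (n + k + 4) + 3)"
    using assms(1) by (intro mult_left_mono power_decreasing) auto
  also have "\<dots> = ((1/2) ^ (n + k + 4))\<^sup>2"
    unfolding power_add[of _ _ 3] power_mult[symmetric] by (simp add: power_divide mult.commute)
  finally show "4 * v / u \<le> ((1/2) ^ (n + k + 4))\<^sup>2" .
qed simp

lemma near_dual_unit_szego: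
  assumes r: "\<And>j. \<bar>r j\<bar> < 1" "\<And>j. \<bar>s j\<bar> < 1"
    and off: "\<And>i j. i \<noteq> j \<Longrightarrow> szego_gram (r j) (s i) \<le> (1/2) ^ (i + j + 4)"
    and diag: "\<And>i. \<bar>szego_gram (r i) (s i) - 1\<bar> \<le> (1/2) ^ (i + i + 4)"
  shows "near_dual (\<lambda>j. unit_szego (r j)) (\<lambda>j. unit_szego (s j))"
  unfolding near_dual_def
proof (intro allI)
  fix i j
  show "cmod (cinner (unit_szego (r j)) (unit_szego (s i)) - (if i = j then 1 else 0)) \<le> (1/2) ^ (i + j + 4)"
  proof (cases "i = j")
    case True
    have "cmod (of_real (szego_gram (r i) (s i)) - 1) = \<bar>szego_gram (r i) (s i) - 1\<bar>"
      by (metis norm_of_real of_real_1 of_real_diff)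
    then show ?thesis using True diag[of i] r by (simp add: cinner_unit_szego)
  next
    case False
    then show ?thesis using off[OF False] szego_gram_nonneg[OF r(1) r(2), of j i] r
      by (simp add: cinner_unit_szego)
  qed
qed

lemma szego_gram_off_diagonal_le:
  assumes "i \<noteq> j" and u: "\<And>n. gap (n + m) * (3/4) \<le> u n" "\<And>n. u n \<le> gap (n + m)"
    and v: "\<And>n. gap (n + m) * (3/4) \<le> v n" "\<And>n. v n \<le> gap (n + m)"
  shows "szego_gram (1 - u j) (1 - v i) \<le> (1/2) ^ (i + j + 4)"
proof -
  have pos: "0 < u n" "0 < v n" for n
    using u(1)[of n] v(1)[of n] gap_bounds(1)[of "n + m"] by linarith+
  have "szego_gram (1 - u j) (1 - v i) \<le> (1/2) ^ ((i + m) + (j + m) + 4)"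
  proof (cases "i < j")
    case True
    then have "szego_gram (1 - v i) (1 - u j) \<le> (1/2) ^ ((i + m) + (j + m) + 4)"
      using u v pos by (intro szego_gram_gap_le) auto
    then show ?thesis by (simp only: szego_gram_sym)
  next
    case False
    then have "szego_gram (1 - u j) (1 - v i) \<le> (1/2) ^ ((j + m) + (i + m) + 4)"
      using u v pos \<open>i \<noteq> j\<close> by (intro szego_gram_gap_le) auto
    then show ?thesis by (simp only: add.commute)
  qed
  also have "\<dots> \<le> ((1/2)::real) ^ (i + j + 4)" by (rule power_decreasing) auto
  finally show ?thesis .
qed

theorem admissible_pair_exists: "\<exists>a b. admissible_pair m a b"
proof -
  define r where "r j = 1 - paired_gap m j" for j
  define s where "s n = 1 - gap n" for n
  have gap34: "gap n * (3/4) \<le> gap n" for n using gap_bounds(1)[of n] by simp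
  have r: "0 \<le> r j" "r j < 1" "\<bar>r j\<bar> < 1" for j using paired_gap_bounds(3,4)[of m j] by (auto simp: r_def)
  have s: "0 \<le> s j" "s j < 1" "\<bar>s j\<bar> < 1" for j using gap_bounds[of j] by (auto simp: s_def)
  have xx: "near_dual (\<lambda>j. unit_szego (r j)) (\<lambda>j. unit_szego (r j))"
    using r szego_gram_off_diagonal_le[of _ _ m "paired_gap m" "paired_gap m"] paired_gap_bounds(1,2)
    by (intro near_dual_unit_szego) (auto simp: szego_gram_self r_def less_imp_le)
  have yy: "near_dual (\<lambda>j. unit_szego (s j)) (\<lambda>j. unit_szego (s j))"
    using s szego_gram_off_diagonal_le[of _ _ 0 gap gap] gap34
    by (intro near_dual_unit_szego) (auto simp: szego_gram_self s_def)
  have xy: "near_dual (\<lambda>j. unit_szego (r j)) (\<lambda>j. unit_szego (s (j + m)))"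
  proof (rule near_dual_unit_szego)
    show "szego_gram (r j) (s (i + m)) \<le> (1/2) ^ (i + j + 4)" if "i \<noteq> j" for i j
      unfolding r_def s_def using that paired_gap_bounds(1,2) gap34
      by (intro szego_gram_off_diagonal_le[where m = m and u = "paired_gap m" and v = "\<lambda>n. gap (n + m)"]) (auto simp: less_imp_le)
    show "\<bar>szego_gram (r i) (s (i + m)) - 1\<bar> \<le> (1/2) ^ (i + i + 4)" for i
    proof -
      have "\<bar>szego_gram (1 - gap (i + m)) (1 - paired_gap m i) - 1\<bar> \<le> ((1/2) ^ (i + 2))\<^sup>2"
        using gap_bounds[of "i + m"] paired_gap_bounds(2-4)[of m i]
        by (intro szego_gram_near_le) (auto simp: paired_gap_def algebra_simps)
      also have "(i + 2) * 2 = i + i + 4" by simp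
      then have "((1/2) ^ (i + 2))\<^sup>2 = ((1/2)::real) ^ (i + i + 4)" by (simp only: flip: power_mult)
      finally show ?thesis by (simp add: r_def s_def szego_gram_sym)
    qed
  qed (use r s in auto)
  define a where "a = range (\<lambda>j. complex_of_real (r j))"
  define b where "b = range (\<lambda>j. complex_of_real (s j))"
  have Za: "Zspace a = orth (range (\<lambda>j. unit_szego (r j)))"
    and Zb: "Zspace b = orth (range (\<lambda>j. unit_szego (s j)))"
    unfolding a_def b_def using r s by (intro Zspace_range_real; simp)+
  have inj_s: "inj s"
  proof (rule linorder_injI)
    fix x y :: nat assume "x < y"
    then show "s x \<noteq> s y" using gap_less[of x y] gap_bounds(1)[of x] by (simp add: s_def)
  qed
  have inj_r: "inj r"
  proof (rule linorder_injI)
    fix x y :: nat assume "x < y"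
    then show "r x \<noteq> r y"
      using gap_less[of "x + m" "y + m"] gap_bounds(1)[of "x + m"] paired_gap_bounds(1)[of x m] paired_gap_bounds(2)[of m y]
      by (simp add: r_def)
  qed
  have disj: "r j \<noteq> s n" for j n
  proof (cases "n \<le> j + m")
    case True
    then have "gap (j + m) \<le> gap n"
      using gap_less[of n "j + m"] gap_bounds(1)[of n] by (cases "n = j + m") auto
    then show ?thesis using paired_gap_bounds(2)[of m j] by (simp add: r_def s_def)
  next
    case False
    then show ?thesis using gap_less[of "j + m" n] gap_bounds(1)[of "j + m"] paired_gap_bounds(1)[of j m]
      by (simp add: r_def s_def)
  qed
  have gap_half: "gap n \<le> (1/2) ^ n" for n
  proof -
    have "n \<le> 14 * n\<^sup>2 + 1" by (cases n) (auto simp: power2_eq_square)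
    then show ?thesis unfolding gap_def by (intro power_decreasing) auto
  qed
  have sum_s: "summable (\<lambda>j. 1 - s j)"
    by (rule summable_comparison_test'[OF summable_geometric[of "1/2::real"]])
       (use gap_half gap_bounds(1) in \<open>auto simp: s_def less_imp_le\<close>)
  have "summable (\<lambda>j. 1 - s (j + m))" using sum_s by (subst summable_iff_shift)
  then have sum_r: "summable (\<lambda>j. 1 - r j)"
    by (rule summable_comparison_test') (use paired_gap_bounds in \<open>auto simp: r_def s_def less_imp_le\<close>)
  have lim: "q \<longlonglongrightarrow> 1" if "summable (\<lambda>j. 1 - q j)" for q :: "nat \<Rightarrow> real"
    using tendsto_diff[OF tendsto_const[of 1] summable_LIMSEQ_zero[OF that]] by simp
  have "admissible_pair m a b"
    unfolding admissible_pair_def has_hardy_dim_0_iff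
  proof (intro conjI)
    show "a \<subseteq> ball 0 1" "b \<subseteq> ball 0 1" using r s by (auto simp: a_def b_def)
    show "infinite a" "infinite b"
      unfolding a_def b_def using inj_r inj_s by (auto intro!: range_inj_infinite simp: inj_def)
    show "a \<inter> b = {}" using disj by (auto simp: a_def b_def)
    show "blaschke_condition a" "blaschke_condition b"
      unfolding a_def b_def using r s inj_r inj_s sum_r sum_s
      by (auto intro!: blaschke_condition_range simp: less_imp_le)
    show "limit_set a = {1}" "limit_set b = {1}"
      unfolding a_def b_def using r s by (auto intro!: limit_set_range lim sum_r sum_s simp: less_imp_neq)
    show "orth (Zspace a) \<inter> Zspace b = {0}"
      unfolding Za Zb by (rule near_dual_intersections(1)[OF xx yy xy])
    show "has_hardy_dim (Zspace a \<inter> orth (Zspace b)) m"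
      unfolding Za Zb by (rule near_dual_intersections(2)[OF xx yy xy])
  qed
  then show ?thesis by blast
qed

theorem theorem5p5:
  fixes m :: nat
  shows "(\<exists>a b. admissible_pair m a b) \<and>
    (\<forall>a b. admissible_pair m a b \<longrightarrow>
      ((\<exists>\<delta>. geodesic_joining \<delta> (Zspace a) (Zspace b)) \<longleftrightarrow> m = 0))"
proof (intro conjI allI impI admissible_pair_exists)
  fix a b assume "admissible_pair m a b"
  then have ab: "Zspace a \<in> Gr" "Zspace b \<in> Gr" "orth (Zspace a) \<inter> Zspace b = {0}"
      "has_hardy_dim (Zspace a \<inter> orth (Zspace b)) m"
    by (auto simp: admissible_pair_def has_hardy_dim_0_iff Zspace_in_Gr)
  show "(\<exists>\<delta>. geodesic_joining \<delta> (Zspace a) (Zspace b)) \<longleftrightarrow> m = 0"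
  proof
    assume "\<exists>\<delta>. geodesic_joining \<delta> (Zspace a) (Zspace b)"
    then have "Zspace a \<inter> orth (Zspace b) = {0}"
      using geodesic_imp_intersection_trivial ab(3) by blast
    then show "m = 0" using ab(4) has_hardy_dim_of_zero by simp
  next
    assume "m = 0"
    then show "\<exists>\<delta>. geodesic_joining \<delta> (Zspace a) (Zspace b)"
      using ab geodesic_exists by (simp add: has_hardy_dim_0_iff)
  qed
qed

end
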